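(* Let $p_0$ be an odd prime, $p$ a power of $p_0$, $q$ a power of $p$. Let $R(x) = \sum_{i=0}^e a_i x^{p^i} \in \mathbb{F}_q[x]$ with $e \geq 1$, $a_e \neq 0$, and let $A \subset H_R$ be a maximal abelian subgroup with $A \subset \mathbb{F}_q^2$. Suppose Condition $(\ast)$ holds for $R$ and $A$. Let $\overline{C}_R$ be the smooth projective compactification over $\mathbb{F}_q$ of $y^p - y = xR(x)$. Then: (1) $\overline{C}_R$ is $\mathbb{F}_{q^4}$-minimal; (2) if $q \equiv 1 \pmod 4$, $\overline{C}_R$ is $\mathbb{F}_{q^2}$-minimal; (3) if $q \equiv 3 \pmod 4$, $\overline{C}_R$ is $\mathbb{F}_{q^2}$-maximal.
   Context: $\mathbb{F}$ is an algebraic closure of $\mathbb{F}_{p_0}$; $\mathrm{Tr}_{q/p}$ denotes the trace $\mathbb{F}_q \to \mathbb{F}_p$. Define $E_R(x) = R(x)^{p^e} + \sum_{i=0}^e (a_i x)^{p^{e-i}}$, $V_R = \{x \in \mathbb{F} : E_R(x) = 0\}$, $f_R(x,y) = -\sum_{i=0}^{e-1}\left(\sum_{j=0}^{e-i-1}(a_i x^{p^i} y)^{p^j} + (xR(y))^{p^i}\right)$, and the Heisenberg group $H_R = \{(\alpha,\beta) \in \mathbb{F}^2 : \alpha \in V_R,\ \beta^p - \beta = \alpha R(\alpha)\}$ with law $(\alpha,\beta)(\alpha',\beta') = (\alpha+\alpha', \beta+\beta'+f_R(\alpha,\alpha'))$. For a maximal abelian subgroup $A$, let $\overline{A} \subset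 V_R$ be its image under $(\alpha,\beta) \mapsto \alpha$ (an $e$-dimensional $\mathbb{F}_p$-space, contained in $\mathbb{F}_q$ when $A \subset \mathbb{F}_q^2$). Let $F_A(x) = \prod_{\alpha \in \overline{A}}(x - \alpha) = \sum_{i=0}^e b_i x^{p^i}$ (monic, $\mathbb{F}_p$-linearized, $b_0 \neq 0$), let $c_A = (-1)^e a_e/(2b_0)$, and let $a(x) \in \mathbb{F}_q[x]$ be the unique $\mathbb{F}_p$-linearized polynomial with $F_A(a(x)) = x^q - x$; its root set $\mathrm{Ker}\, a \subset \mathbb{F}_q$. Condition $(\ast)$: for every $\lambda \in \mathbb{F}_q$ such that $\mathrm{Tr}_{q/p}(\lambda t) = 0$ for all $t \in \mathrm{Ker}\, a$, one has $\mathrm{Tr}_{q/p}(c_A^{-1}\lambda^2) = 0$. $\overline{C}_R$ has genus $g = p^e(p-1)/2$; for a power $Q$ of $q$ it is $\mathbb{F}_Q$-maximal (resp. minimal) if $|\overline{C}_R(\mathbb{F}_Q)| = Q+1+2gQ^{1/2}$ (resp. $Q+1-2gQ^{1/2}$). *)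

theory Defs
  imports
    "HOL-Algebra.Subrings"
    "HOL-Computational_Algebra.Computational_Algebra"
begin

section \<open>Finite subfields of an algebraic closure of a prime field\<close>

definition algebraic_over_prime_field :: "'a::field \<Rightarrow> bool" where
  "algebraic_over_prime_field x \<longleftrightarrow>
     (\<exists>P :: int poly. map_poly of_int P \<noteq> (0 :: 'a poly) \<and> poly (map_poly of_int P) x = 0)"

definition is_alg_closure_of_Fp :: "nat \<Rightarrow> 'a::alg_closed_field itself \<Rightarrow> bool" where
  "is_alg_closure_of_Fp p0 _ \<longleftrightarrow>
     CHAR('a) = p0 \<and> (\<forall>x :: 'a. algebraic_over_prime_field x)"

text \<open>Inside an algebraic closure of a prime field, the subfield with \<open>q\<close> elements
  (\<open>q\<close> a power of the characteristic) consists of the roots of \<open>x^q - x\<close>.\<close>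

definition Fq :: "nat \<Rightarrow> 'a::field set" where
  "Fq q = {x. x ^ q = x}"

text \<open>The trace from the field with \<open>p^m\<close> elements to the field with \<open>p\<close> elements, as the sum
  of the Galois conjugates.\<close>

definition Tr :: "nat \<Rightarrow> nat \<Rightarrow> 'a::field \<Rightarrow> 'a" where
  "Tr p m x = (\<Sum>i<m. x ^ (p ^ i))"

section \<open>The Heisenberg group\<close>

text \<open>Throughout, the polynomial \<open>R\<close> is given by \<open>p\<close>, \<open>e\<close> and its coefficients
  \<open>a 0, \<dots>, a e\<close>; other values of \<open>a\<close> are never used.\<close>

definition R_poly :: "nat \<Rightarrow> nat \<Rightarrow> (nat \<Rightarrow> 'a::field) \<Rightarrow> 'a poly" where
  "R_poly p e a = (\<Sum>i\<le>e. monom (a i) (p ^ i))"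

definition E_R :: "nat \<Rightarrow> nat \<Rightarrow> (nat \<Rightarrow> 'a::field) \<Rightarrow> 'a \<Rightarrow> 'a" where
  "E_R p e a x = poly (R_poly p e a) x ^ (p ^ e) + (\<Sum>i\<le>e. (a i * x) ^ (p ^ (e - i)))"

definition V_R :: "nat \<Rightarrow> nat \<Rightarrow> (nat \<Rightarrow> 'a::field) \<Rightarrow> 'a set" where
  "V_R p e a = {x. E_R p e a x = 0}"

definition f_R :: "nat \<Rightarrow> nat \<Rightarrow> (nat \<Rightarrow> 'a::field) \<Rightarrow> 'a \<Rightarrow> 'a \<Rightarrow> 'a" where
  "f_R p e a x y =
     - (\<Sum>i<e. (\<Sum>j<e - i. (a i * x ^ (p ^ i) * y) ^ (p ^ j))
              + (x * poly (R_poly p e a) y) ^ (p ^ i))"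

definition H_R :: "nat \<Rightarrow> nat \<Rightarrow> (nat \<Rightarrow> 'a::field) \<Rightarrow> ('a \<times> 'a) monoid" where
  "H_R p e a =
     \<lparr>carrier = {(\<alpha>, \<beta>). \<alpha> \<in> V_R p e a \<and> \<beta> ^ p - \<beta> = \<alpha> * poly (R_poly p e a) \<alpha>},
      monoid.mult = (\<lambda>(\<alpha>, \<beta>) (\<alpha>', \<beta>'). (\<alpha> + \<alpha>', \<beta> + \<beta>' + f_R p e a \<alpha> \<alpha>')),
      one = (0, 0)\<rparr>"

definition is_abelian_subgroup :: "('g, 'b) monoid_scheme \<Rightarrow> 'g set \<Rightarrow> bool" where
  "is_abelian_subgroup G A \<longleftrightarrow> subgroup A G \<and> comm_group (G\<lparr>carrier := A\<rparr>)"

definition maximal_abelian_subgroup :: "('g, 'b) monoid_scheme \<Rightarrow> 'g set \<Rightarrow> bool" where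
  "maximal_abelian_subgroup G A \<longleftrightarrow>
     is_abelian_subgroup G A \<and> (\<forall>B. is_abelian_subgroup G B \<and> A \<subseteq> B \<longrightarrow> B = A)"

section \<open>The condition on \<open>R\<close> and \<open>A\<close>\<close>

definition F_A :: "('a::field \<times> 'a) set \<Rightarrow> 'a poly" where
  "F_A A = (\<Prod>\<alpha>\<in>fst ` A. [:- \<alpha>, 1:])"

text \<open>\<open>F_A\<close> is a combination of the monomials \<open>x^(p^i)\<close>, so its coefficient \<open>b_0\<close> of
  \<open>x^(p^0)\<close> is the one in degree 1.\<close>

definition c_A :: "nat \<Rightarrow> (nat \<Rightarrow> 'a::field) \<Rightarrow> ('a \<times> 'a) set \<Rightarrow> 'a" where
  "c_A e a A = (- 1) ^ e * a e / (2 * coeff (F_A A) 1)"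

definition p_linearized :: "nat \<Rightarrow> 'a::field poly \<Rightarrow> bool" where
  "p_linearized p P \<longleftrightarrow> (\<forall>n. coeff P n \<noteq> 0 \<longrightarrow> (\<exists>i. n = p ^ i))"

definition a_poly :: "nat \<Rightarrow> nat \<Rightarrow> ('a::field \<times> 'a) set \<Rightarrow> 'a poly" where
  "a_poly p q A = (THE P. p_linearized p P \<and> (\<forall>n. coeff P n \<in> Fq q) \<and>
                          pcompose (F_A A) P = monom 1 q - monom 1 1)"

definition condition_star ::
  "nat \<Rightarrow> nat \<Rightarrow> nat \<Rightarrow> (nat \<Rightarrow> 'a::field) \<Rightarrow> ('a \<times> 'a) set \<Rightarrow> bool" where
  "condition_star p m e a A \<longleftrightarrow>
     (\<forall>l\<in>Fq (p ^ m).
        (\<forall>t. poly (a_poly p (p ^ m) A) t = 0 \<longrightarrow> Tr p m (l * t) = 0) \<longrightarrow>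
        Tr p m (inverse (c_A e a A) * l\<^sup>2) = 0)"

section \<open>Rational points of the smooth projective model of an affine curve\<close>

text \<open>The smooth projective curve birational to a given geometrically integral curve over a
  perfect field \<open>k\<close> is the abstract nonsingular curve of its function field \<open>K\<close>: its closed
  points are the valuation rings of \<open>K / k\<close> (the local rings of the curve), and its
  \<open>k\<close>-rational points are those whose residue field is \<open>k\<close>, that is the places of degree one.
  Below, \<open>k\<close> is given as a set of elements of the field \<open>K\<close>.\<close>

definition valuation_ring_over :: "('r, 'b) ring_scheme \<Rightarrow> 'r set \<Rightarrow> 'r set \<Rightarrow> bool" where
  "valuation_ring_over K k V \<longleftrightarrow>
     subring V K \<and> k \<subset> V \<and> V \<subset> carrier K \<and>
     (\<forall>z\<in>carrier K - {\<zero>\<^bsub>K\<^esub>}. z \<in> V \<or> inv\<^bsub>K\<^esub> z \<in> V)"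

definition maximal_ideal_of :: "('r, 'b) ring_scheme \<Rightarrow> 'r set \<Rightarrow> 'r set" where
  "maximal_ideal_of K V = V - Units (K\<lparr>carrier := V\<rparr>)"

definition degree_one_places :: "('r, 'b) ring_scheme \<Rightarrow> 'r set \<Rightarrow> 'r set set" where
  "degree_one_places K k =
     {V. valuation_ring_over K k V \<and> (\<forall>z\<in>V. \<exists>c\<in>k. z \<ominus>\<^bsub>K\<^esub> c \<in> maximal_ideal_of K V)}"

definition rational_functions_over :: "'a::field set \<Rightarrow> 'a poly fract set" where
  "rational_functions_over k =
     {Fract P Q | P Q. Q \<noteq> 0 \<and> (\<forall>n. coeff P n \<in> k) \<and> (\<forall>n. coeff Q n \<in> k)}"

text \<open>The function field \<open>k(x)[y] / (y^p - y - f(x))\<close> of the curve \<open>y^p - y = f(x)\<close> over the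
  subfield \<open>k\<close> of \<open>'a\<close>. Each residue class is represented by its remainder of degree
  less than \<open>p\<close> in \<open>y\<close>.\<close>

definition AS_poly :: "nat \<Rightarrow> 'a::field poly \<Rightarrow> 'a poly fract poly" where
  "AS_poly p f = monom 1 p - monom 1 1 - [:to_fract f:]"

definition AS_function_field ::
  "nat \<Rightarrow> 'a::field poly \<Rightarrow> 'a set \<Rightarrow> 'a poly fract poly ring" where
  "AS_function_field p f k =
     \<lparr>carrier = {z. degree z < p \<and> (\<forall>n. coeff z n \<in> rational_functions_over k)},
      monoid.mult = (\<lambda>z w. (z * w) mod AS_poly p f),
      one = 1,
      zero = 0,
      add = (+)\<rparr>"

text \<open>The \<open>k\<close>-rational points of the smooth projective compactification of \<open>y^p - y = f(x)\<close>.\<close>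

definition AS_curve_points :: "nat \<Rightarrow> 'a::field poly \<Rightarrow> 'a set \<Rightarrow> 'a poly fract poly set set" where
  "AS_curve_points p f k =
     degree_one_places (AS_function_field p f k) ((\<lambda>c. [:to_fract [:c:]:]) ` k)"

text \<open>The points over the field with \<open>Q\<close> elements of the smooth projective compactification of
  \<open>y^p - y = x R(x)\<close>.\<close>

definition C_R_points ::
  "nat \<Rightarrow> nat \<Rightarrow> (nat \<Rightarrow> 'a::field) \<Rightarrow> nat \<Rightarrow> 'a poly fract poly set set" where
  "C_R_points p e a Q = AS_curve_points p (monom 1 1 * R_poly p e a) (Fq Q)"

definition C_R_genus :: "nat \<Rightarrow> nat \<Rightarrow> real" where
  "C_R_genus p e = real (p ^ e * (p - 1)) / 2"

text \<open>Finiteness is stated because \<open>card\<close> is 0 on infinite sets.\<close>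

definition C_R_maximal :: "nat \<Rightarrow> nat \<Rightarrow> (nat \<Rightarrow> 'a::field) \<Rightarrow> nat \<Rightarrow> bool" where
  "C_R_maximal p e a Q \<longleftrightarrow> finite (C_R_points p e a Q) \<and>
     real (card (C_R_points p e a Q)) = real Q + 1 + 2 * C_R_genus p e * sqrt (real Q)"

definition C_R_minimal :: "nat \<Rightarrow> nat \<Rightarrow> (nat \<Rightarrow> 'a::field) \<Rightarrow> nat \<Rightarrow> bool" where
  "C_R_minimal p e a Q \<longleftrightarrow> finite (C_R_points p e a Q) \<and>
     real (card (C_R_points p e a Q)) = real Q + 1 - 2 * C_R_genus p e * sqrt (real Q)"

end

(*
On F_Q, for Q a power of q, there is a linearized identity
Tr(x R(x)) = Tr(c F_A(x)^2) with c = a_e / (2 b_0): up to h^p - h the bilinear form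
x R(y) + y R(x) equals G(x) F_A(y), and its symmetry, together with the isotropy of
the image of A under the commutator pairing, forces G to be a multiple of F_A. So the
zeros of the trace are counted by the zeros of the quadratic form Tr(c u^2) on the
image W of F_A. Condition (star) says that the orthogonal complement of W is
isotropic; hence the form induced on W modulo this complement has the same type as
Tr(c u^2) on all of F_Q. For Q = r^2 and c in F_r the zeros of the latter are found by letting the
2(r-1)-st roots of unity act: since Tr_{Q/r}(c u^2) = c u^2 (1 + u^(2(r-1))), everything
depends on whether -1 is a 2(r-1)-st power in F_Q, that is on r modulo 4. Taking r = q
and r = q^2 gives the number of affine points.

The rational places of the function field are the affine rational points and one
point at infinity. They are constructed from embeddings into Laurent series obtained
as fixed points of contractions. The embedding at infinity also shows that the
Artin-Schreier polynomial is irreducible, because the valuations of 1, y, ..., y^(p-1)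
are distinct modulo p. A place over a given point is unique because each function is a
power of a fixed element times a unit (after raising to the p-th power, at infinity).
*)

theory Submission
  imports Defs
begin

section \<open>Finite fields and additive polynomials\<close>

text \<open>\<open>condition_star\<close> speaks about F_q only, while points are counted over F_Q
  with Q = q^2 or q^4. The bridge is a size argument: the trace-orthogonal complement of F_A(F_Q)
  has p^e elements for every such Q, and the complement over F_q embeds into it by transitivity of
  the trace, so the two coincide. The factor 2 in \<open>c_A\<close> comes from polarising x R(x) to
  x R(y) + y R(x); the sign (-1)^e is harmless, since only the vanishing of a trace is tested.

  \<open>p\<close> is merely a prime power, so a subgroup of \<open>H_R\<close> is not visibly an
  F_p-space; this has to be deduced from maximality. Dimensions are replaced throughout by
  cardinalities, with equations multiplied by \<open>p\<close> so that no division occurs.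

  The function field is a record over polynomials, without type class arithmetic. Embeddings into
  Laurent series therefore also serve to carry places to subsets of a type with field operations,
  where orders and units are at hand; places seen through different embeddings are compared by
  conditions formulated in the function field itself.\<close>

lemma card_poly_roots_separable:
  fixes P :: "'a::alg_closed_field poly"
  assumes "P \<noteq> 0" and "\<And>x. poly P x = 0 \<Longrightarrow> poly (pderiv P) x \<noteq> 0"
  shows "card {x. poly P x = 0} = degree P"
proof -
  obtain A where A: "size A = degree P" "P = smult (lead_coeff P) (\<Prod>x\<in>#A. [:-x, 1:])"
    using alg_closed_imp_factorization[OF assms(1)] by blast
  have roots: "{x. poly P x = 0} = set_mset A"
    by (subst A(2)) (auto simp: poly_prod_mset prod_mset_zero_iff \<open>P \<noteq> 0\<close>)
  \<comment> \<open>A repeated linear factor would make \<open>x\<close> a root of the derivative as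
    well, so the multiset of roots is a set.\<close>
  have "count A x \<le> 1" for x
  proof (rule ccontr)
    assume "\<not> count A x \<le> 1"
    then have "{#x, x#} \<subseteq># A"
      by (auto simp: subseteq_mset_def)
    then obtain B where B: "A = {#x, x#} + B"
      by (metis mset_subset_eqD subset_mset.le_iff_add)
    define q where "q = smult (lead_coeff P) (\<Prod>x\<in>#B. [:-x, 1:])"
    have P: "P = [:-x, 1:] * ([:-x, 1:] * q)"
      by (subst A(2)) (simp add: B q_def mult.left_commute mult_smult_right)
    have "poly P x = 0" "poly (pderiv P) x = 0"
      by (simp_all add: P pderiv_mult del: mult_pCons_left)
    then show False using assms(2) by blast
  qed
  then have "A = mset_set (set_mset A)"
    by (intro multiset_eqI) (metis One_nat_def count_eq_zero_iff count_mset_set' finite_set_mset le_SucE le_zero_eq)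
  then have "size A = card (set_mset A)"
    by (metis size_mset_set)
  then show ?thesis using roots A(1) by simp
qed

lemma poly_eq_0_of_card_roots:
  fixes P :: "'a::idom poly"
  assumes "finite X" "\<And>x. x \<in> X \<Longrightarrow> poly P x = 0" "degree P < card X"
  shows "P = 0"
proof (rule ccontr)
  assume "P \<noteq> 0"
  then have "card X \<le> card {x. poly P x = 0}"
    by (intro card_mono poly_roots_finite) (auto simp: assms)
  also have "\<dots> \<le> degree P" by (rule card_poly_roots_bound[OF \<open>P \<noteq> 0\<close>])
  finally show False using assms(3) by simp
qed

text \<open>\<open>p\<close> is a power of the characteristic \<open>p0\<close>, so
  \<open>x ^ p\<close> is the \<open>s\<close>-th iterate of the absolute Frobenius, which is still
  additive. \<open>ty\<close> pins down the type \<open>'a\<close>.\<close>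

locale char_power =
  fixes ty :: "'a::alg_closed_field itself" and p0 s p :: nat
  assumes prime_p0: "prime p0" and char_p0: "CHAR('a) = p0"
    and s_pos: "s \<ge> 1" and p_eq: "p = p0 ^ s"
begin

lemma p_gt_1: "p > 1"
  using prime_gt_1_nat[OF prime_p0] s_pos unfolding p_eq
  by (metis One_nat_def less_le_trans one_less_power zero_less_one)

lemma p_pos [simp]: "p > 0" using p_gt_1 by simp

lemma of_nat_p [simp]: "of_nat p = (0::'a)"
  unfolding of_nat_eq_0_iff_char_dvd char_p0 p_eq using s_pos by (simp add: dvd_power)

lemma frob_add: "(x + y :: 'a) ^ (p ^ n) = x ^ (p ^ n) + y ^ (p ^ n)"
  by (rule freshmans_dream'[where n = "s * n"]) (simp_all add: char_p0 prime_p0 p_eq power_mult)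

lemma frob_sum: "(sum f I :: 'a) ^ (p ^ n) = (\<Sum>i\<in>I. f i ^ (p ^ n))"
  by (rule freshmans_dream_sum'[where n = "s * n"]) (simp_all add: char_p0 prime_p0 p_eq power_mult)

lemma frob_0 [simp]: "(0::'a) ^ (p ^ n) = 0"
  by (simp add: power_0_left)

lemma frob_minus: "(- x :: 'a) ^ (p ^ n) = - (x ^ (p ^ n))"
proof -
  have "(- x) ^ (p ^ n) + x ^ (p ^ n) = 0"
    by (simp add: frob_add[symmetric])
  then show ?thesis by (simp add: eq_neg_iff_add_eq_0)
qed

lemma frob_diff: "(x - y :: 'a) ^ (p ^ n) = x ^ (p ^ n) - y ^ (p ^ n)"
  using frob_add[of x "- y" n] by (simp add: frob_minus)

lemma frob_root: "\<exists>y::'a. y ^ (p ^ n) = x"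
  by (rule nth_root_exists) simp

lemmas frob1 = frob_add[of _ _ 1, simplified] frob_sum[of _ _ 1, simplified]
  frob_diff[of _ _ 1, simplified] frob_minus[of _ 1, simplified]

lemma of_nat_power_p [simp]: "n \<ge> 1 \<Longrightarrow> of_nat (p ^ n) = (0::'a)"
  by (simp add: power_0_left)

lemma Fq_closed:
  fixes x y :: 'a
  shows "(0::'a) \<in> Fq (p ^ n)" "(1::'a) \<in> Fq (p ^ n)"
    "x \<in> Fq (p ^ n) \<Longrightarrow> y \<in> Fq (p ^ n) \<Longrightarrow> x + y \<in> Fq (p ^ n)"
    "x \<in> Fq (p ^ n) \<Longrightarrow> y \<in> Fq (p ^ n) \<Longrightarrow> x - y \<in> Fq (p ^ n)"
    "x \<in> Fq (p ^ n) \<Longrightarrow> y \<in> Fq (p ^ n) \<Longrightarrow> x * y \<in> Fq (p ^ n)"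
    "x \<in> Fq (p ^ n) \<Longrightarrow> y \<in> Fq (p ^ n) \<Longrightarrow> x / y \<in> Fq (p ^ n)"
    "x \<in> Fq (p ^ n) \<Longrightarrow> - x \<in> Fq (p ^ n)"
    "x \<in> Fq (p ^ n) \<Longrightarrow> x ^ k \<in> Fq (p ^ n)"
    "x \<in> Fq (p ^ n) \<Longrightarrow> inverse x \<in> Fq (p ^ n)"
  by (simp_all add: Fq_def frob_add frob_diff frob_minus power_mult_distrib power_divide
      power_inverse mult.commute[of k] power_mult[symmetric] flip: power_mult)
     (metis mult.commute power_mult)

lemma Fq_sum: "(\<And>i. i \<in> I \<Longrightarrow> (f i :: 'a) \<in> Fq (p ^ n)) \<Longrightarrow> sum f I \<in> Fq (p ^ n)"
  by (simp add: Fq_def frob_sum)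

lemma card_Fq: "n \<ge> 1 \<Longrightarrow> card (Fq (p ^ n) :: 'a set) = p ^ n"
  and finite_Fq: "n \<ge> 1 \<Longrightarrow> finite (Fq (p ^ n) :: 'a set)"
proof -
  assume n: "n \<ge> 1"
  define P :: "'a poly" where "P = monom 1 (p ^ n) - monom 1 1"
  have big: "p ^ n > 1" using p_gt_1 n by (intro one_less_power) auto
  have deg: "degree P = p ^ n"
    unfolding P_def diff_conv_add_uminus
    by (subst degree_add_eq_left) (use big in \<open>auto simp: degree_monom_eq\<close>)
  have roots: "{x. poly P x = 0} = Fq (p ^ n)"
    by (auto simp: P_def Fq_def poly_monom)
  \<comment> \<open>A nonzero constant derivative excludes repeated roots, so the degree counts the
    elements.\<close>
  have "pderiv P = [:-1:]"
    using n by (simp add: P_def pderiv_diff pderiv_monom power_0_left one_pCons)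
  moreover have "P \<noteq> 0"
  proof
    assume "P = 0"
    then show False using deg big by (metis degree_0 not_one_less_zero)
  qed
  ultimately show "card (Fq (p ^ n) :: 'a set) = p ^ n" "finite (Fq (p ^ n) :: 'a set)"
    using card_poly_roots_separable[of P] roots deg poly_roots_finite[of P] by auto
qed

lemma Fq_mono: "Fq (p ^ m) \<subseteq> (Fq (p ^ (m * k)) :: 'a set)"
proof
  fix x :: 'a assume x: "x \<in> Fq (p ^ m)"
  have "x ^ ((p ^ m) ^ k) = x"
    using x by (induction k) (auto simp: Fq_def power_mult)
  then show "x \<in> Fq (p ^ (m * k))" by (simp add: Fq_def power_mult)
qed

lemma Fp_sub_Fq: "Fq p \<subseteq> (Fq (p ^ m) :: 'a set)"
  using Fq_mono[of 1 m] by simp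

lemma finite_Fp: "finite (Fq p :: 'a set)" and card_Fp: "card (Fq p :: 'a set) = p"
  using finite_Fq[of 1] card_Fq[of 1] by auto

lemmas Fp_closed = Fq_closed[where n = 1, simplified]

lemma Fp_power: "c \<in> Fq p \<Longrightarrow> (c::'a) ^ (p ^ n) = c"
  using Fp_sub_Fq[of n] by (auto simp: Fq_def)

lemma Tr_add: "Tr p n (x + y :: 'a) = Tr p n x + Tr p n y"
  by (simp add: Tr_def frob_add sum.distrib)

lemma Tr_diff: "Tr p n (x - y :: 'a) = Tr p n x - Tr p n y"
  by (simp add: Tr_def frob_diff sum_subtractf)

lemma Tr_0 [simp]: "Tr p n (0 :: 'a) = 0"
  by (simp add: Tr_def)

lemma Tr_minus: "Tr p n (- x :: 'a) = - Tr p n x"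
  using Tr_diff[of n 0 x] by simp

lemma Tr_scale: "c \<in> Fq p \<Longrightarrow> Tr p n (c * x :: 'a) = c * Tr p n x"
  by (simp add: Tr_def power_mult_distrib Fp_power sum_distrib_left)

lemma Tr_frob: "x \<in> Fq (p ^ n) \<Longrightarrow> Tr p n (x ^ p :: 'a) = Tr p n x"
proof -
  assume x: "x \<in> Fq (p ^ n)"
  have "Tr p n (x ^ p) = (\<Sum>i<n. x ^ (p ^ Suc i))"
    by (simp add: Tr_def power_mult)
  also have "\<dots> + x ^ (p ^ 0) = (\<Sum>i<Suc n. x ^ (p ^ i))"
    by (subst sum.lessThan_Suc_shift) simp
  finally show ?thesis using x by (simp add: Tr_def Fq_def)
qed

lemma Tr_in_Fp: "x \<in> Fq (p ^ n) \<Longrightarrow> Tr p n (x::'a) \<in> Fq p"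
  using Tr_frob[of x n] by (simp add: Fq_def Tr_def frob1 flip: power_mult) (simp add: mult.commute)

lemma Tr_comp: "Tr p (m * k) (x::'a) = Tr p m (Tr (p ^ m) k x)"
proof -
  \<comment> \<open>Every index below \<open>m * k\<close> is split as \<open>j * m + i\<close>,
    which groups the conjugates over the intermediate field.\<close>
  have *: "sum f {j * m..<j * m + m} = (\<Sum>i<m. f (j * m + i))" for f :: "nat \<Rightarrow> 'a" and j
    using sum.shift_bounds_nat_ivl[of f 0 "j * m" m] by (simp add: atLeast0LessThan add.commute)
  have "Tr p (m * k) x = (\<Sum>j<k. \<Sum>i<m. x ^ (p ^ (j * m + i)))"
    unfolding Tr_def mult.commute[of m k] sum.nat_group[symmetric]
    by (intro sum.cong refl *)
  also have "\<dots> = Tr p m (Tr (p ^ m) k x)"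
    unfolding Tr_def by (subst sum.swap) (simp add: frob_sum power_add power_mult mult.commute flip: power_mult)
  finally show ?thesis .
qed

end

section \<open>Counting in finite F_p-spaces and with bilinear pairings\<close>

lemma card_fiber_additive:
  fixes L :: "'a::ab_group_add \<Rightarrow> 'b::ab_group_add"
  assumes "\<And>x y. x \<in> X \<Longrightarrow> y \<in> X \<Longrightarrow> x + y \<in> X" "\<And>x y. x \<in> X \<Longrightarrow> y \<in> X \<Longrightarrow> x - y \<in> X"
    and "\<And>x y. x \<in> X \<Longrightarrow> y \<in> X \<Longrightarrow> L (x + y) = L x + L y"
    and "\<And>x y. x \<in> X \<Longrightarrow> y \<in> X \<Longrightarrow> L (x - y) = L x - L y"
    and "x0 \<in> X"
  shows "card {x \<in> X. L x = L x0} = card {x \<in> X. L x = 0}"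
  by (rule bij_betw_same_card[of "\<lambda>x. x - x0"], rule bij_betw_byWitness[where f' = "\<lambda>x. x + x0"])
     (auto simp: assms)

lemma card_image_times_kernel:
  fixes L :: "'a::ab_group_add \<Rightarrow> 'b::ab_group_add"
  assumes "finite X"
    and "\<And>x y. x \<in> X \<Longrightarrow> y \<in> X \<Longrightarrow> x + y \<in> X" "\<And>x y. x \<in> X \<Longrightarrow> y \<in> X \<Longrightarrow> x - y \<in> X"
    and "\<And>x y. x \<in> X \<Longrightarrow> y \<in> X \<Longrightarrow> L (x + y) = L x + L y"
    and "\<And>x y. x \<in> X \<Longrightarrow> y \<in> X \<Longrightarrow> L (x - y) = L x - L y"
  shows "card X = card (L ` X) * card {x \<in> X. L x = 0}"
proof -
  have "card X = (\<Sum>t\<in>L ` X. card {x \<in> X. L x = t})"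
    using sum.image_gen[OF assms(1), of "\<lambda>_. 1::nat" L] by simp
  also have "\<dots> = (\<Sum>t\<in>L ` X. card {x \<in> X. L x = 0})"
    using card_fiber_additive[of X L] assms by (intro sum.cong) auto
  finally show ?thesis by simp
qed

context char_power begin

text \<open>Finiteness is part of the notion because sizes stand in for dimensions. Scalars come
  from \<open>Fq p\<close>, whose size need not be prime, so additive closure would not imply
  closure under scalars.\<close>

definition Fp_subspace :: "'a set \<Rightarrow> bool" where
  "Fp_subspace X \<longleftrightarrow> finite X \<and> 0 \<in> X \<and> (\<forall>x\<in>X. \<forall>y\<in>X. x + y \<in> X) \<and> (\<forall>c\<in>Fq p. \<forall>x\<in>X. c * x \<in> X)"

lemma Fp_subspaceD:
  assumes "Fp_subspace X"
  shows "finite X" "0 \<in> X" "x \<in> X \<Longrightarrow> y \<in> X \<Longrightarrow> x + y \<in> X" "c \<in> Fq p \<Longrightarrow> x \<in> X \<Longrightarrow> c * x \<in> X"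
    "x \<in> X \<Longrightarrow> - x \<in> X" "x \<in> X \<Longrightarrow> y \<in> X \<Longrightarrow> x - y \<in> X"
proof -
  show neg: "- x \<in> X" if "x \<in> X" for x
    using bspec[OF bspec[OF conjunct2[OF conjunct2[OF conjunct2[OF assms[unfolded Fp_subspace_def]]]]
      Fp_closed(7)[OF Fp_closed(2)]] that] by simp
  show "x - y \<in> X" if "x \<in> X" "y \<in> X"
    using assms neg[OF that(2)] that unfolding Fp_subspace_def by (metis diff_conv_add_uminus)
qed (use assms in \<open>auto simp: Fp_subspace_def\<close>)

lemma Fp_subspace_Fq: "n \<ge> 1 \<Longrightarrow> Fp_subspace (Fq (p ^ n))"
  using Fq_closed(1,3,5)[where n = n] subsetD[OF Fp_sub_Fq[of n]] finite_Fq by (auto simp: Fp_subspace_def)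

text \<open>A nonzero F_p-linear functional is onto \<open>Fq p\<close>, and its fibres are
  translates of the kernel, hence of equal size.\<close>

lemma card_functional_fiber:
  fixes L :: "'a \<Rightarrow> 'a"
  assumes X: "Fp_subspace X"
    and L: "\<And>x y. x \<in> X \<Longrightarrow> y \<in> X \<Longrightarrow> L (x + y) = L x + L y"
      "\<And>c x. c \<in> Fq p \<Longrightarrow> x \<in> X \<Longrightarrow> L (c * x) = c * L x"
      "\<And>x. x \<in> X \<Longrightarrow> L x \<in> Fq p"
    and x1: "x1 \<in> X" "L x1 \<noteq> 0" and t: "t \<in> Fq p"
  shows "p * card {x \<in> X. L x = t} = card X"
proof -
  note XD = Fp_subspaceD[OF X]
  have Ldiff: "L (x - y) = L x - L y" if "x \<in> X" "y \<in> X" for x y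
    using L(1)[of x "-y"] L(2)[of "-1" y] that XD(5)[OF that(2)] Fp_closed(7)[OF Fp_closed(2)] by simp
  have img: "L ` X = Fq p"
  proof (intro equalityI subsetI)
    fix u :: 'a assume u: "u \<in> Fq p"
    have "u / L x1 \<in> Fq p" using u L(3)[OF x1(1)] by (rule Fp_closed)
    then have "L ((u / L x1) * x1) = (u / L x1) * L x1" "(u / L x1) * x1 \<in> X"
      by (rule L(2)[OF _ x1(1)], rule XD(4)[OF _ x1(1)])
    moreover have "(u / L x1) * L x1 = u" using x1(2) by simp
    ultimately have "u = L ((u / L x1) * x1)" by (simp only:)
    then show "u \<in> L ` X" using \<open>(u / L x1) * x1 \<in> X\<close> by (rule image_eqI)
  next
    show "u \<in> Fq p" if "u \<in> L ` X" for u using that L(3) by blast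
  qed
  have "t \<in> L ` X" using t by (simp only: img)
  then obtain x0 where "x0 \<in> X" "t = L x0" by (rule imageE)
  then have "card {x \<in> X. L x = t} = card {x \<in> X. L x = 0}" unfolding \<open>t = L x0\<close>
    using card_fiber_additive[of X L x0, OF XD(3) XD(6) L(1) Ldiff] by blast
  moreover have "card X = card (L ` X) * card {x \<in> X. L x = 0}"
    by (rule card_image_times_kernel[OF XD(1) XD(3) XD(6) L(1) Ldiff])
  ultimately show ?thesis using img card_Fp by simp
qed

text \<open>Row by row: an \<open>x\<close> in the left kernel contributes all of \<open>Y\<close>,
  any other \<open>x\<close> the fraction 1/p of it. Only linearity along the rows enters, so
  \<open>X\<close> may be any finite set.\<close>

lemma card_pairing_zeros:
  fixes B :: "'a \<Rightarrow> 'a \<Rightarrow> 'a"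
  assumes X: "finite X" and Y: "Fp_subspace Y"
    and B: "\<And>x y y'. x \<in> X \<Longrightarrow> y \<in> Y \<Longrightarrow> y' \<in> Y \<Longrightarrow> B x (y + y') = B x y + B x y'"
      "\<And>c x y. c \<in> Fq p \<Longrightarrow> x \<in> X \<Longrightarrow> y \<in> Y \<Longrightarrow> B x (c * y) = c * B x y"
      "\<And>x y. x \<in> X \<Longrightarrow> y \<in> Y \<Longrightarrow> B x y \<in> Fq p"
  shows "p * card {(x, y). x \<in> X \<and> y \<in> Y \<and> B x y = 0} =
    card X * card Y + (p - 1) * (card {x \<in> X. \<forall>y\<in>Y. B x y = 0} * card Y)"
proof -
  define K where "K = {x \<in> X. \<forall>y\<in>Y. B x y = 0}"
  note YD = Fp_subspaceD[OF Y]
  have "{(x, y). x \<in> X \<and> y \<in> Y \<and> B x y = 0} = Sigma X (\<lambda>x. {y \<in> Y. B x y = 0})" by auto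
  then have "p * card {(x, y). x \<in> X \<and> y \<in> Y \<and> B x y = 0} = (\<Sum>x\<in>X. p * card {y \<in> Y. B x y = 0})"
    using X YD(1) by (simp add: sum_distrib_left)
  also have "\<dots> = (\<Sum>x\<in>X. card Y + (if x \<in> K then (p - 1) * card Y else 0))"
  proof (intro sum.cong refl)
    fix x assume x: "x \<in> X"
    show "p * card {y \<in> Y. B x y = 0} = card Y + (if x \<in> K then (p - 1) * card Y else 0)"
    proof (cases "x \<in> K")
      case True
      then have "{y \<in> Y. B x y = 0} = Y" by (auto simp: K_def)
      then show ?thesis using True p_gt_1 by (simp add: diff_mult_distrib)
    next
      case False
      then obtain y where "y \<in> Y" "B x y \<noteq> 0" using x by (auto simp: K_def)
      then show ?thesis
        using False card_functional_fiber[OF Y B(1)[OF x] B(2)[OF _ x] B(3)[OF x] _ _ Fp_closed(1)] by simp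
    qed
  qed
  also have "\<dots> = card X * card Y + card K * ((p - 1) * card Y)"
  proof -
    have "X \<inter> {x. x \<in> K} = K" by (auto simp: K_def)
    then show ?thesis using X by (simp add: sum.distrib sum.If_cases)
  qed
  finally show ?thesis by (simp add: K_def mult.left_commute)
qed

text \<open>Zeros of \<open>B\<close> counted by rows and by columns give the same number;
  cancelling the common term leaves a comparison of the two kernels. This replaces the equality of
  row rank and column rank.\<close>

lemma card_pairing_kernels:
  fixes B :: "'a \<Rightarrow> 'a \<Rightarrow> 'a"
  assumes X: "Fp_subspace X" and Y: "Fp_subspace Y"
    and B: "\<And>x y y'. x \<in> X \<Longrightarrow> y \<in> Y \<Longrightarrow> y' \<in> Y \<Longrightarrow> B x (y + y') = B x y + B x y'"
      "\<And>c x y. c \<in> Fq p \<Longrightarrow> x \<in> X \<Longrightarrow> y \<in> Y \<Longrightarrow> B x (c * y) = c * B x y"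
      "\<And>x y. x \<in> X \<Longrightarrow> y \<in> Y \<Longrightarrow> B x y \<in> Fq p"
      "\<And>x x' y. x \<in> X \<Longrightarrow> x' \<in> X \<Longrightarrow> y \<in> Y \<Longrightarrow> B (x + x') y = B x y + B x' y"
      "\<And>c x y. c \<in> Fq p \<Longrightarrow> x \<in> X \<Longrightarrow> y \<in> Y \<Longrightarrow> B (c * x) y = c * B x y"
  shows "card {x \<in> X. \<forall>y\<in>Y. B x y = 0} * card Y = card {y \<in> Y. \<forall>x\<in>X. B x y = 0} * card X"
proof -
  have "p * card {(x, y). x \<in> X \<and> y \<in> Y \<and> B x y = 0} =
      card X * card Y + (p - 1) * (card {x \<in> X. \<forall>y\<in>Y. B x y = 0} * card Y)"
    by (rule card_pairing_zeros[OF Fp_subspaceD(1)[OF X] Y B(1,2,3)])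
  moreover have "p * card {(y, x). y \<in> Y \<and> x \<in> X \<and> B x y = 0} =
      card Y * card X + (p - 1) * (card {y \<in> Y. \<forall>x\<in>X. B x y = 0} * card X)"
    by (rule card_pairing_zeros[OF Fp_subspaceD(1)[OF Y] X B(4,5,3)])
  moreover have "card {(x, y). x \<in> X \<and> y \<in> Y \<and> B x y = 0} = card {(y, x). y \<in> Y \<and> x \<in> X \<and> B x y = 0}"
    by (rule bij_betw_same_card[of prod.swap], rule bij_betw_byWitness[where f' = prod.swap]) auto
  ultimately show ?thesis using p_gt_1 by simp
qed

lemma infinite_UNIV_a: "infinite (UNIV :: 'a set)"
proof
  assume fin: "finite (UNIV :: 'a set)"
  define N where "N = Suc (card (UNIV :: 'a set))"
  have "N < p ^ N" using p_gt_1 by (intro power_gt_expt) auto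
  also have "\<dots> = card (Fq (p ^ N) :: 'a set)" by (rule card_Fq[symmetric]) (simp add: N_def)
  also have "\<dots> \<le> card (UNIV :: 'a set)" by (rule card_mono[OF fin]) simp
  finally show False by (simp add: N_def)
qed

lemma poly_ext: "(\<And>x. poly P x = poly Q (x::'a)) \<Longrightarrow> P = Q"
  using poly_roots_finite[of "P - Q"] infinite_UNIV_a by (cases "P = Q") auto

section \<open>Additive polynomials and vanishing polynomials of subspaces\<close>

definition lin :: "nat \<Rightarrow> (nat \<Rightarrow> 'a) \<Rightarrow> 'a \<Rightarrow> 'a" where
  "lin d b x = (\<Sum>i\<le>d. b i * x ^ (p ^ i))"

lemma lin_add: "lin d b (x + y) = lin d b x + lin d b y"
  by (simp add: lin_def frob_add sum.distrib distrib_left)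

lemma lin_0 [simp]: "lin d b 0 = 0"
  by (simp add: lin_def)

lemma lin_diff: "lin d b (x - y) = lin d b x - lin d b y"
  by (simp add: lin_def frob_diff sum_subtractf right_diff_distrib)

lemma lin_scale: "c \<in> Fq p \<Longrightarrow> lin d b (c * x) = c * lin d b x"
  by (simp add: lin_def power_mult_distrib Fp_power sum_distrib_left mult.left_commute)

definition lin_poly :: "nat \<Rightarrow> (nat \<Rightarrow> 'a) \<Rightarrow> 'a poly" where
  "lin_poly d b = (\<Sum>i\<le>d. monom (b i) (p ^ i))"

lemma poly_lin_poly [simp]: "poly (lin_poly d b) x = lin d b x"
  by (simp add: lin_poly_def lin_def poly_sum poly_monom)

lemma coeff_lin_poly: "coeff (lin_poly d b) (p ^ i) = (if i \<le> d then b i else 0)"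
  using p_gt_1 by (auto simp: lin_poly_def coeff_sum)

lemma coeff_lin_poly_1: "coeff (lin_poly d b) 1 = b 0"
  using coeff_lin_poly[of d b 0] by simp

lemma degree_lin_poly_le: "degree (lin_poly d b) \<le> p ^ d"
  unfolding lin_poly_def
  by (rule degree_sum_le)
     (use p_gt_1 in \<open>auto intro!: order.trans[OF degree_monom_le] power_increasing\<close>)

lemma degree_lin_poly: "b d \<noteq> 0 \<Longrightarrow> degree (lin_poly d b) = p ^ d"
  using degree_lin_poly_le[of d b] le_degree[of "lin_poly d b" "p ^ d"] by (simp add: coeff_lin_poly)

lemma p_linearized_lin_poly: "p_linearized p (lin_poly d b)"
  unfolding p_linearized_def lin_poly_def by (auto simp: coeff_sum split: if_splits elim!: sum.not_neutral_contains_not_neutral)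

lemma lin_eq_0:
  assumes "finite X" "card X > p ^ d" "\<And>x. x \<in> X \<Longrightarrow> lin d b x = 0" "i \<le> d"
  shows "b i = 0"
proof -
  have "lin_poly d b = 0"
    by (rule poly_eq_0_of_card_roots[OF assms(1)]) (use assms degree_lin_poly_le[of d b] in auto)
  then show ?thesis using coeff_lin_poly[of d b i] assms(4) by simp
qed

text \<open>This is x^p - x = prod (x - c), rescaled by \<open>w\<close>. For nonzero
  \<open>w\<close> both sides are monic of degree \<open>p\<close> in \<open>T\<close> and vanish at
  the \<open>p\<close> points \<open>c * w\<close>; for \<open>w = 0\<close> both are T^p.\<close>

lemma prod_Fp_multiples: "(\<Prod>c\<in>Fq p. T - c * w) = T ^ p - w ^ (p - 1) * (T::'a)"
proof (cases "w = 0")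
  case False
  define P where "P = (\<Prod>c\<in>Fq p. [:- (c * w), 1:]) - (monom 1 p - monom (w ^ (p - 1)) 1)"
  have deg1: "degree (\<Prod>c\<in>Fq p. [:- (c * w), 1:]) = p"
    by (subst degree_prod_eq_sum_degree) (auto simp: card_Fp)
  have deg2: "degree (monom 1 p - monom (w ^ (p - 1)) 1) = p"
    unfolding diff_conv_add_uminus
    by (subst degree_add_eq_left) (use p_gt_1 False in \<open>auto simp: degree_monom_eq\<close>)
  have lc: "coeff (\<Prod>c\<in>Fq p. [:- (c * w), 1:]) p = 1"
    using lead_coeff_prod[of "\<lambda>c. [:- (c * w), 1:]" "Fq p"] deg1 by simp
  have "degree P < p"
  proof -
    have "degree P \<le> p" unfolding P_def by (rule degree_diff_le) (simp_all only: deg1 deg2 order.refl)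
    moreover have "coeff P p = 0" using lc p_gt_1 by (simp add: P_def)
    ultimately show ?thesis
      by (metis degree_0 leading_coeff_0_iff order_le_imp_less_or_eq p_pos)
  qed
  moreover have "poly P x = 0" if x: "x \<in> (\<lambda>c. c * w) ` Fq p" for x
  proof -
    obtain c where c: "c \<in> Fq p" "x = c * w" using x by auto
    have "w ^ p = w ^ (p - 1) * w" using p_pos by (metis power_minus_mult)
    then show ?thesis using c finite_Fp
      by (auto simp: P_def poly_prod poly_monom power_mult_distrib Fq_def intro!: prod_zero)
  qed
  moreover have "card ((\<lambda>c. c * w) ` Fq p) = p"
    using False by (subst card_image) (auto simp: inj_on_def card_Fp)
  ultimately have "P = 0"
    by (intro poly_eq_0_of_card_roots[of "(\<lambda>c. c * w) ` Fq p"]) (auto simp: finite_Fp)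
  then have "poly P T = 0" by simp
  then show ?thesis by (simp add: P_def poly_prod poly_monom)
qed (use p_gt_1 in \<open>simp add: card_Fp power_0_left\<close>)

text \<open>Let F be the vanishing polynomial of \<open>Z\<close> and w = F(v). The product over the
  coset of \<open>c * v\<close> is F(x) - c w, and the product of these over \<open>c\<close> is F^p
  - w^(p-1) F. So additivity survives the adjunction of one vector.\<close>

lemma vanishing_poly_extend:
  assumes Z: "Fp_subspace Z" and v: "v \<notin> Z" and b: "b d = 1" "\<And>x. (\<Prod>\<alpha>\<in>Z. x - \<alpha>) = lin d b x"
  defines "Z' \<equiv> (\<lambda>(z, c). z + c * v) ` (Z \<times> Fq p)"
  shows "Fp_subspace Z'" "card Z' = p * card Z" "\<exists>b'. b' (Suc d) = 1 \<and> (\<forall>x. (\<Prod>\<alpha>\<in>Z'. x - \<alpha>) = lin (Suc d) b' x)"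
    "Z \<subseteq> Z'" "v \<in> Z'"
proof -
  note ZD = Fp_subspaceD[OF Z]
  have inj: "inj_on (\<lambda>(z, c). z + c * v) (Z \<times> Fq p)"
  proof (rule inj_onI, clarify)
    fix z c z' c' assume A: "z \<in> Z" "c \<in> Fq p" "z' \<in> Z" "c' \<in> Fq p" "z + c * v = z' + c' * v"
    have eq: "(c - c') * v = z' - z" using A(5) by (simp add: algebra_simps)
    have "c = c'"
    proof (rule ccontr)
      assume ne: "c \<noteq> c'"
      have "inverse (c - c') * (z' - z) \<in> Z"
        by (intro ZD(4) ZD(6) Fp_closed(9) Fp_closed(4) A)
      moreover have "inverse (c - c') * (z' - z) = v"
        using ne by (simp add: eq[symmetric])
      ultimately show False using v by simp
    qed
    then show "z = z' \<and> c = c'" using A(5) by simp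
  qed
  show "card Z' = p * card Z"
    unfolding Z'_def card_image[OF inj] by (simp add: card_cartesian_product card_Fp)
  have Z': "Z' = {z + c * v | z c. z \<in> Z \<and> c \<in> Fq p}" by (auto simp: Z'_def)
  show "Z \<subseteq> Z'"
  proof
    fix z assume "z \<in> Z"
    then show "z \<in> Z'" unfolding Z' using Fp_closed(1)
      by (intro CollectI exI[of _ z] exI[of _ "0 :: 'a"]) simp
  qed
  show "v \<in> Z'" unfolding Z' using Fp_closed(2) ZD(2)
    by (intro CollectI exI[of _ "0 :: 'a"] exI[of _ "1 :: 'a"]) simp
  show "Fp_subspace Z'"
    unfolding Fp_subspace_def
  proof (intro conjI ballI)
    show "finite Z'" unfolding Z'_def using ZD finite_Fp by simp
    show "0 \<in> Z'" using \<open>Z \<subseteq> Z'\<close> ZD by auto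
    fix x y assume "x \<in> Z'" "y \<in> Z'"
    then obtain z c z' c' where *: "x = z + c * v" "y = z' + c' * v" "z \<in> Z" "z' \<in> Z" "c \<in> Fq p" "c' \<in> Fq p"
      unfolding Z' by blast
    then have "x + y = (z + z') + (c + c') * v" by (simp add: algebra_simps)
    then show "x + y \<in> Z'" unfolding Z' using * ZD(3) Fp_closed(3) by blast
  next
    fix k x :: 'a assume "k \<in> Fq p" "x \<in> Z'"
    then obtain z c where *: "x = z + c * v" "z \<in> Z" "c \<in> Fq p" unfolding Z' by blast
    then have "k * x = (k * z) + (k * c) * v" by (simp add: algebra_simps)
    then show "k * x \<in> Z'" unfolding Z' using * \<open>k \<in> Fq p\<close> ZD(4) Fp_closed(5) by blast
  qed
  define w where "w = lin d b v"
  \<comment> \<open>The first part is the \<open>p\<close>-th power of the old polynomial, which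
    shifts the coefficients by one Frobenius; the second part subtracts its multiple by
    w^(p-1).\<close>
  define b' where "b' i = (if i = 0 then 0 else b (i - 1) ^ p) - (if i \<le> d then w ^ (p - 1) * b i else 0)" for i
  have "(\<Prod>\<alpha>\<in>Z'. x - \<alpha>) = lin (Suc d) b' x" for x
  proof -
    have "(\<Prod>\<alpha>\<in>Z'. x - \<alpha>) = (\<Prod>(z, c)\<in>Z \<times> Fq p. x - (z + c * v))"
      unfolding Z'_def by (subst prod.reindex[OF inj]) (simp add: case_prod_unfold)
    also have "\<dots> = (\<Prod>c\<in>Fq p. \<Prod>z\<in>Z. (x - c * v) - z)"
      by (subst prod.cartesian_product[symmetric], subst prod.swap) (simp add: algebra_simps)
    also have "\<dots> = (\<Prod>c\<in>Fq p. lin d b x - c * w)"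
      by (intro prod.cong refl) (simp add: b lin_diff lin_scale w_def)
    also have "\<dots> = lin d b x ^ p - w ^ (p - 1) * lin d b x"
      by (rule prod_Fp_multiples)
    also have "\<dots> = lin (Suc d) b' x"
    proof -
      have "lin d b x ^ p = (\<Sum>i\<le>d. b i ^ p * x ^ (p ^ Suc i))"
        by (simp add: lin_def frob1 power_mult_distrib mult.commute flip: power_mult)
      also have "\<dots> = (\<Sum>i\<le>Suc d. (if i = 0 then 0 else b (i - 1) ^ p) * x ^ (p ^ i))"
        by (subst sum.atMost_Suc_shift) simp
      finally show ?thesis
        by (simp add: lin_def b'_def left_diff_distrib sum_subtractf sum_distrib_left mult.assoc)
    qed
    finally show ?thesis .
  qed
  moreover have "b' (Suc d) = 1" by (simp add: b'_def b)
  ultimately show "\<exists>b'. b' (Suc d) = 1 \<and> (\<forall>x. (\<Prod>\<alpha>\<in>Z'. x - \<alpha>) = lin (Suc d) b' x)" by blast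
qed

text \<open>Vectors of \<open>X\<close> are adjoined one at a time, starting from {0}. Each step
  multiplies the size by \<open>p\<close>, so the same induction shows that the size is a power of
  \<open>p\<close>.\<close>

lemma subspace_vanishing_lin:
  assumes X: "Fp_subspace X"
  shows "\<exists>d b. card X = p ^ d \<and> b d = 1 \<and> (\<forall>x. (\<Prod>\<alpha>\<in>X. x - \<alpha>) = lin d b x)"
proof -
  have *: ?thesis if "Fp_subspace Z" "Z \<subseteq> X" "card Z = p ^ d" "b d = 1" "\<And>x. (\<Prod>\<alpha>\<in>Z. x - \<alpha>) = lin d b x" for Z d b
    using that
  proof (induction "card X - card Z" arbitrary: Z d b rule: less_induct)
    case less
    note XD = Fp_subspaceD[OF X]
    show ?case
    proof (cases "Z = X")
      case False
      then obtain v where v: "v \<in> X" "v \<notin> Z" using less.prems by blast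
      note ext = vanishing_poly_extend[OF less.prems(1) v(2) less.prems(4,5)]
      define Z' where "Z' = (\<lambda>(z, c). z + c * v) ` (Z \<times> Fq p)"
      obtain b' where b': "b' (Suc d) = 1" "\<And>x. (\<Prod>\<alpha>\<in>Z'. x - \<alpha>) = lin (Suc d) b' x"
        using ext(3) unfolding Z'_def by blast
      have sub: "Z' \<subseteq> X" using XD v less.prems(2) by (auto simp: Z'_def)
      have "card Z < card Z'"
        using ext(4,5) v(2) finite_subset[OF sub XD(1)] unfolding Z'_def[symmetric] by (intro psubset_card_mono) auto
      moreover have "card Z' \<le> card X" using sub XD by (intro card_mono)
      ultimately have "card X - card Z' < card X - card Z" by simp
      then show ?thesis
        using less.hyps[of Z' "Suc d" b'] ext(1,2) sub b' less.prems(3) unfolding Z'_def[symmetric] by simp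
    qed (use less.prems in blast)
  qed
  have "Fp_subspace {0}" by (simp add: Fp_subspace_def)
  then show ?thesis
    using *[of "{0}" 0 "\<lambda>_. 1"] Fp_subspaceD[OF X] by (simp add: lin_def)
qed

lemma poly_vanishing: "poly (\<Prod>\<alpha>\<in>X. [:- \<alpha>, 1:]) x = (\<Prod>\<alpha>\<in>X. x - (\<alpha>::'a))"
  by (simp add: poly_prod)

section \<open>The trace form over a finite field\<close>

lemma exists_Tr_mult_nonzero:
  assumes "m \<ge> 1" "l \<in> Fq (p ^ m)" "l \<noteq> (0::'a)"
  shows "\<exists>x\<in>Fq (p ^ m). Tr p m (l * x) \<noteq> 0"
proof (rule ccontr)
  assume neg: "\<not> ?thesis"
  obtain k where k: "m = Suc k" using assms(1) by (cases m) auto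
  \<comment> \<open>As a polynomial the trace is additive of degree p^(m-1) with all coefficients 1,
    too small a degree to vanish on p^m elements.\<close>
  have "lin k (\<lambda>_. 1) y = 0" if y: "y \<in> Fq (p ^ m)" for y
  proof -
    have "y / l \<in> Fq (p ^ m)" using y assms(2) by (rule Fq_closed)
    then have "Tr p m (l * (y / l)) = 0" using neg by blast
    then show ?thesis using assms(3) by (simp add: Tr_def lin_def k lessThan_Suc_atMost)
  qed
  moreover have "p ^ k < p ^ m" using p_gt_1 by (simp add: k)
  ultimately have "(1::'a) = 0"
    using lin_eq_0[of "Fq (p ^ m)" k "\<lambda>_. 1" 0] finite_Fq[OF assms(1)] card_Fq[OF assms(1)] by simp
  then show False by simp
qed

lemma card_Tr_kernel:
  assumes "m \<ge> 1" "l \<in> Fq (p ^ m)" "l \<noteq> (0::'a)"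
  shows "p * card {x \<in> Fq (p ^ m). Tr p m (l * x) = 0} = p ^ m"
proof -
  obtain x1 where x1: "x1 \<in> Fq (p ^ m)" "Tr p m (l * x1) \<noteq> 0"
    using exists_Tr_mult_nonzero[OF assms] by blast
  have "p * card {x \<in> Fq (p ^ m). Tr p m (l * x) = 0} = card (Fq (p ^ m) :: 'a set)"
  proof (rule card_functional_fiber[where L = "\<lambda>x. Tr p m (l * x)", OF Fp_subspace_Fq[OF assms(1)] _ _ _ x1 Fp_closed(1)])
    fix c x :: 'a assume "c \<in> Fq p"
    then show "Tr p m (l * (c * x)) = c * Tr p m (l * x)"
      by (simp add: Tr_scale[symmetric] mult.left_commute)
  qed (auto simp: distrib_left Tr_add intro!: Tr_in_Fp Fq_closed assms)
  then show ?thesis by (simp add: card_Fq[OF assms(1)])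
qed

text \<open>Nondegeneracy of the trace makes the kernel on the side of \<open>W\<close> trivial, and
  \<open>card_pairing_kernels\<close> gives the size of the complement. The factor \<open>c\<close>
  is present because the complement is taken for the polar form of Tr(c u^2).\<close>

lemma card_trace_perp:
  assumes "m \<ge> 1" "Fp_subspace W" "W \<subseteq> Fq (p ^ m)" "c \<in> Fq (p ^ m)" "c \<noteq> 0"
  shows "card {l \<in> Fq (p ^ m). \<forall>w\<in>W. Tr p m (c * l * w) = 0} * card W = p ^ m"
proof -
  have "card {l \<in> Fq (p ^ m). \<forall>w\<in>W. Tr p m (c * l * w) = 0} * card W =
      card {w \<in> W. \<forall>l\<in>Fq (p ^ m). Tr p m (c * l * w) = 0} * card (Fq (p ^ m) :: 'a set)"
  proof (rule card_pairing_kernels[OF Fp_subspace_Fq[OF assms(1)] assms(2)])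
    fix k x y :: 'a assume "k \<in> Fq p"
    then show "Tr p m (c * x * (k * y)) = k * Tr p m (c * x * y)"
      "Tr p m (c * (k * x) * y) = k * Tr p m (c * x * y)"
      by (simp_all add: Tr_scale[symmetric] mult_ac)
  qed (use assms in \<open>auto simp: algebra_simps Tr_add intro!: Tr_in_Fp Fq_closed\<close>)
  moreover have "{w \<in> W. \<forall>l\<in>Fq (p ^ m). Tr p m (c * l * w) = 0} = {0}"
  proof (intro equalityI subsetI)
    fix w assume w: "w \<in> {w \<in> W. \<forall>l\<in>Fq (p ^ m). Tr p m (c * l * w) = 0}"
    have "c * w \<in> Fq (p ^ m)" using w assms by (intro Fq_closed) auto
    moreover have "Tr p m (c * w * l) = 0" if "l \<in> Fq (p ^ m)" for l
      using w that by (auto simp: mult_ac)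
    ultimately have "c * w = 0" using exists_Tr_mult_nonzero[OF assms(1), of "c * w"] by blast
    then show "w \<in> {0}" using assms by simp
  qed (use Fp_subspaceD[OF assms(2)] in auto)
  ultimately show ?thesis by (simp add: card_Fq[OF assms(1)])
qed

lemma Fp_subspace_trace_perp:
  assumes "m \<ge> 1"
  shows "Fp_subspace {l \<in> Fq (p ^ m). \<forall>w\<in>W. Tr p m (c * l * w) = 0}"
  unfolding Fp_subspace_def
proof (intro conjI ballI)
  show "finite {l \<in> Fq (p ^ m). \<forall>w\<in>W. Tr p m (c * l * w) = 0}"
    by (rule finite_subset[OF _ finite_Fq[OF assms]]) auto
next
  fix x y assume "x \<in> {l \<in> Fq (p ^ m). \<forall>w\<in>W. Tr p m (c * l * w) = 0}"
    "y \<in> {l \<in> Fq (p ^ m). \<forall>w\<in>W. Tr p m (c * l * w) = 0}"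
  then show "x + y \<in> {l \<in> Fq (p ^ m). \<forall>w\<in>W. Tr p m (c * l * w) = 0}"
    by (auto simp: distrib_left distrib_right Tr_add intro: Fq_closed)
next
  fix k x :: 'a assume k: "k \<in> Fq p" and x: "x \<in> {l \<in> Fq (p ^ m). \<forall>w\<in>W. Tr p m (c * l * w) = 0}"
  have "Tr p m (c * (k * x) * w) = k * Tr p m (c * x * w)" for w
    using k by (simp add: Tr_scale[symmetric] mult_ac)
  then show "k * x \<in> {l \<in> Fq (p ^ m). \<forall>w\<in>W. Tr p m (c * l * w) = 0}"
    using x Fq_closed(5)[OF subsetD[OF Fp_sub_Fq[of m] k]] by auto
qed (auto intro: Fq_closed)

text \<open>One inclusion is symmetry; equality follows by size, \<open>card_trace_perp\<close>
  being applied to \<open>W\<close> and then to its complement.\<close>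

lemma trace_perp_perp:
  assumes "m \<ge> 1" "Fp_subspace W" "W \<subseteq> Fq (p ^ m)" "c \<in> Fq (p ^ m)" "c \<noteq> 0"
  defines "P \<equiv> {l \<in> Fq (p ^ m). \<forall>w\<in>W. Tr p m (c * l * w) = 0}"
  shows "W = {u \<in> Fq (p ^ m). \<forall>v\<in>P. Tr p m (c * u * v) = 0}"
proof (rule card_subset_eq)
  let ?P' = "{u \<in> Fq (p ^ m). \<forall>v\<in>P. Tr p m (c * u * v) = 0}"
  show "finite ?P'" by (rule finite_subset[OF _ finite_Fq[OF assms(1)]]) auto
  show "W \<subseteq> ?P'" using assms(3) by (auto simp: P_def mult_ac)
  have P: "Fp_subspace P" unfolding P_def by (rule Fp_subspace_trace_perp[OF assms(1)])
  have 1: "card P * card W = p ^ m" unfolding P_def by (rule card_trace_perp[OF assms(1-5)])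
  have 2: "card ?P' * card P = p ^ m"
    by (rule card_trace_perp[OF assms(1) P _ assms(4,5)]) (auto simp: P_def)
  have "card P * card W = card P * card ?P'" unfolding 1 using 2 by (subst mult.commute) (rule sym)
  moreover have "card P \<noteq> 0" using Fp_subspaceD[OF P] by auto
  ultimately show "card W = card ?P'" by (simp only: mult_cancel1 simp_thms)
qed

lemma card_nth_roots:
  assumes "of_nat N \<noteq> (0::'a)" "w \<noteq> 0"
  shows "card {x::'a. x ^ N = w} = N"
proof -
  have N: "N > 0" using assms(1) by (cases N) auto
  define P where "P = monom (1::'a) N - [:w:]"
  have deg: "degree P = N" unfolding P_def diff_conv_add_uminus
    by (subst degree_add_eq_left) (use N in \<open>auto simp: degree_monom_eq\<close>)
  have "card {x. poly P x = 0} = degree P"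
  proof (rule card_poly_roots_separable)
    show "P \<noteq> 0" using deg N by auto
    fix x assume "poly P x = 0"
    then have "x ^ N = w" by (simp add: P_def poly_monom)
    then have "x \<noteq> 0" using assms(2) N by (auto simp: power_0_left)
    then show "poly (pderiv P) x \<noteq> 0"
      using assms(1) by (simp add: P_def pderiv_diff pderiv_monom poly_monom)
  qed
  then show ?thesis unfolding deg by (simp add: P_def poly_monom)
qed

text \<open>Pairs (u, v) with \<open>u\<close> in the field, \<open>v\<close> in the complement P of
  \<open>W\<close> and q(u + v) = 0 are counted twice. Translation by \<open>v\<close> permutes the
  field. For fixed \<open>u\<close> in \<open>W\<close>, q is constant on u + P; for
  \<open>u\<close> outside \<open>W\<close>, q(u + v) is a nonconstant affine function of
  \<open>v\<close>, so exactly |P|/p of the \<open>v\<close> are zeros.\<close>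

lemma card_isotropic_subspace:
  assumes two: "(2::'a) \<noteq> 0"
    and W: "m \<ge> 1" "Fp_subspace W" "W \<subseteq> Fq (p ^ m)" "c \<in> Fq (p ^ m)" "c \<noteq> 0"
    and iso: "\<And>v. v \<in> Fq (p ^ m) \<Longrightarrow> (\<forall>w\<in>W. Tr p m (c * v * w) = 0) \<Longrightarrow> Tr p m (c * v\<^sup>2) = 0"
  shows "p * card {u \<in> Fq (p ^ m). Tr p m (c * u\<^sup>2) = 0} + card W =
    p * card {u \<in> W. Tr p m (c * u\<^sup>2) = 0} + p ^ m"
proof -
  define F where "F = (Fq (p ^ m) :: 'a set)"
  define P where "P = {v \<in> F. \<forall>w\<in>W. Tr p m (c * v * w) = 0}"
  define q where "q u = Tr p m (c * u\<^sup>2)" for u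
  note FD = Fp_subspaceD[OF Fp_subspace_Fq[OF W(1)], folded F_def]
  have P: "Fp_subspace P" unfolding P_def F_def by (rule Fp_subspace_trace_perp[OF W(1)])
  note PD = Fp_subspaceD[OF P]
  have WP: "W = {u \<in> F. \<forall>v\<in>P. Tr p m (c * u * v) = 0}"
    unfolding P_def F_def by (rule trace_perp_perp[OF W])
  have PF: "P \<subseteq> F" by (auto simp: P_def)
  have qP: "q v = 0" if "v \<in> P" for v
    using iso[of v] that by (auto simp: P_def q_def F_def)
  have q_add: "q (u + v) = q u + q v + 2 * Tr p m (c * u * v)" for u v
  proof -
    have "c * (u + v)\<^sup>2 = c * u\<^sup>2 + c * v\<^sup>2 + (c * u * v + c * u * v)"
      by (simp add: power2_eq_square algebra_simps)
    then show ?thesis by (simp only: q_def Tr_add mult_2)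
  qed
  have inner: "p * card {v \<in> P. q (u + v) = 0} = (if u \<in> W then (if q u = 0 then p * card P else 0) else card P)"
    if u: "u \<in> F" for u
  proof (cases "u \<in> W")
    case True
    then have "q (u + v) = q u" if "v \<in> P" for v
      using that WP qP by (auto simp: q_add)
    then have "{v \<in> P. q (u + v) = 0} = (if q u = 0 then P else {})" by auto
    then show ?thesis using True by simp
  next
    case False
    then obtain v1 where v1: "v1 \<in> P" "Tr p m (c * u * v1) \<noteq> 0" using WP u by blast
    have eq: "{v \<in> P. q (u + v) = 0} = {v \<in> P. 2 * Tr p m (c * u * v) = - q u}"
      using qP by (auto simp: q_add eq_neg_iff_add_eq_0 add.commute[of _ "q u"])
    have "(2::'a) \<in> Fq p" using Fp_closed(3)[OF Fp_closed(2,2)] by simp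
    have "p * card {v \<in> P. 2 * Tr p m (c * u * v) = - q u} = card P"
    proof (rule card_functional_fiber[where L = "\<lambda>v. 2 * Tr p m (c * u * v)", OF P _ _ _ v1(1)])
      fix k x :: 'a assume "k \<in> Fq p"
      then show "2 * Tr p m (c * u * (k * x)) = k * (2 * Tr p m (c * u * x))"
        by (simp add: Tr_scale[symmetric] mult_ac)
    next
      fix x assume "x \<in> P"
      then show "2 * Tr p m (c * u * x) \<in> Fq p"
        using PF u W(4) \<open>2 \<in> Fq p\<close> unfolding F_def by (intro Fp_closed(5) Tr_in_Fp Fq_closed) auto
    next
      show "- q u \<in> Fq p" unfolding q_def using u W(4) unfolding F_def
        by (intro Fp_closed(7) Tr_in_Fp Fq_closed) auto
    qed (use v1 two in \<open>auto simp: distrib_left Tr_add\<close>)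
    then show ?thesis using False eq by simp
  qed
  have "card P * card {u \<in> F. q u = 0} = (\<Sum>v\<in>P. card {u \<in> F. q (u + v) = 0})"
  proof -
    have "card {u \<in> F. q (u + v) = 0} = card {u \<in> F. q u = 0}" if "v \<in> P" for v
      by (rule bij_betw_same_card[of "\<lambda>u. u + v"], rule bij_betw_byWitness[where f' = "\<lambda>u. u - v"])
         (use that PF FD in auto)
    then show ?thesis by simp
  qed
  also have "\<dots> = (\<Sum>u\<in>F. card {v \<in> P. q (u + v) = 0})"
  proof -
    have "(\<Sum>v\<in>P. \<Sum>u\<in>F. if q (u + v) = 0 then 1 else (0::nat)) = (\<Sum>u\<in>F. \<Sum>v\<in>P. if q (u + v) = 0 then 1 else 0)"
      by (rule sum.swap)
    then show ?thesis using FD(1) PD(1) by (simp add: sum.If_cases Collect_conj_eq Int_commute)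
  qed
  finally have "p * (card P * card {u \<in> F. q u = 0}) = (\<Sum>u\<in>F. p * card {v \<in> P. q (u + v) = 0})"
    by (simp add: sum_distrib_left)
  also have "\<dots> = (\<Sum>u\<in>F. if u \<in> W then (if q u = 0 then p * card P else 0) else card P)"
    using inner by (intro sum.cong) auto
  also have "\<dots> = p * card P * card {u \<in> W. q u = 0} + card P * (p ^ m - card W)"
  proof -
    have 1: "F \<inter> {u. u \<in> W} = W" and 2: "F \<inter> - {u. u \<in> W} = F - W" using WP by auto
    have 3: "finite W" using W by (auto dest: Fp_subspaceD)
    have 4: "card (F - W) = p ^ m - card W"
      using 1 FD(1) card_Fq[OF W(1)] 3 unfolding F_def by (subst card_Diff_subset) auto
    have 5: "W \<inter> {u. q u = 0} = {u \<in> W. q u = 0}" by auto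
    have 6: "F \<inter> W = W" "F \<inter> - W = F - W" using WP by auto
    show ?thesis using FD(1) 3 by (simp add: sum.If_cases 4 5 6)
  qed
  finally have "card P * (p * card {u \<in> F. q u = 0}) = card P * (p * card {u \<in> W. q u = 0} + (p ^ m - card W))"
    by (simp add: algebra_simps)
  moreover have "card P > 0" using PD by (auto simp: card_gt_0_iff)
  moreover have "card W \<le> p ^ m" using card_mono[OF finite_Fq[OF W(1)] W(3)] card_Fq[OF W(1)] by simp
  ultimately show ?thesis by (simp add: F_def q_def)
qed

lemma two_nonzero:
  assumes "odd p"
  shows "(2::'a) \<noteq> 0"
proof
  assume "(2::'a) = 0"
  then have "p0 dvd 2" using of_nat_eq_0_iff_char_dvd[of 2, where 'a = 'a] by (simp add: char_p0)
  then have "p0 = 2" using primes_dvd_imp_eq[OF prime_p0 two_is_prime_nat] by simp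
  then show False using assms s_pos by (simp add: p_eq)
qed

section \<open>Zeros of Tr(c u^2) over a quadratic extension\<close>

lemma Tr_quadratic_extension:
  assumes "c \<in> Fq (p ^ n)"
  shows "Tr p (n * 2) (c * u\<^sup>2 :: 'a) = Tr p n (c * (u\<^sup>2 + u ^ (2 * p ^ n)))"
proof -
  have "Tr (p ^ n) 2 (c * u\<^sup>2) = c * u\<^sup>2 + c ^ (p ^ n) * u ^ (2 * p ^ n)"
    by (simp add: Tr_def numeral_2_eq_2 power_mult_distrib mult_2 power_add)
  also have "c ^ (p ^ n) = c" using assms by (simp add: Fq_def)
  finally show ?thesis by (simp add: Tr_comp distrib_left)
qed

text \<open>With r = p^n, the squares of the 2(r - 1)-st roots of unity run through the nonzero
  elements of F_r, each hit twice. So the count is twice the number of nonzero elements of a trace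
  hyperplane.\<close>

lemma card_Tr_square_multiples:
  assumes odd: "odd p" and n: "n \<ge> 1" and d: "d \<in> Fq (p ^ n)" "d \<noteq> (0::'a)"
  shows "card {\<rho>. \<rho> ^ (2 * (p ^ n - 1)) = 1 \<and> Tr p n (d * \<rho>\<^sup>2) = 0} = 2 * (p ^ (n - 1) - 1)"
proof -
  note two = two_nonzero[OF odd]
  define K where "K = {w \<in> Fq (p ^ n). Tr p n (d * w) = 0}"
  have r: "p ^ n > 1" using p_gt_1 n by (intro one_less_power) auto
  have K0: "0 \<in> K" by (simp add: K_def Fq_closed)
  have finK: "finite K" unfolding K_def by (rule finite_subset[OF _ finite_Fq[OF n]]) auto
  have "p * card K = p ^ n" unfolding K_def by (rule card_Tr_kernel[OF n d])
  also have "\<dots> = p * p ^ (n - 1)" using n by (simp add: power_eq_if)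
  finally have cK: "card K = p ^ (n - 1)" using p_pos by (simp only: mult_cancel1) auto
  have unit: "w ^ (p ^ n - 1) = 1 \<longleftrightarrow> w \<in> Fq (p ^ n)" if "w \<noteq> 0" for w :: 'a
  proof -
    have "w ^ (p ^ n) = w ^ Suc (p ^ n - 1)" using r by simp
    then have "w ^ (p ^ n) = w * w ^ (p ^ n - 1)" by (simp only: power_Suc)
    then have "w \<in> Fq (p ^ n) \<longleftrightarrow> w * w ^ (p ^ n - 1) = w" by (simp only: Fq_def mem_Collect_eq)
    then show ?thesis using that by simp
  qed
  have "{\<rho>. \<rho> ^ (2 * (p ^ n - 1)) = 1 \<and> Tr p n (d * \<rho>\<^sup>2) = 0} = (\<Union>w\<in>K - {0}. {\<rho>. \<rho>\<^sup>2 = w})"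
  proof -
    have "\<rho> ^ (2 * (p ^ n - 1)) = 1 \<longleftrightarrow> \<rho> \<noteq> 0 \<and> \<rho>\<^sup>2 \<in> Fq (p ^ n)" for \<rho> :: 'a
      using unit[of "\<rho>\<^sup>2"] r by (cases "\<rho> = 0") (auto simp: power_mult power_0_left)
    then show ?thesis unfolding K_def by (intro Set.set_eqI) (simp add: conj_ac)
  qed
  also have "card \<dots> = (\<Sum>w\<in>K - {0}. card {\<rho>. \<rho>\<^sup>2 = w})"
  proof (rule card_UN_disjoint)
    show "\<forall>w\<in>K - {0}. finite {\<rho>. \<rho>\<^sup>2 = w}"
    proof
      fix w assume "w \<in> K - {0}"
      then have "card {\<rho>. \<rho>\<^sup>2 = w} = 2" using card_nth_roots[of 2 w] two by simp
      then show "finite {\<rho>. \<rho>\<^sup>2 = w}" by (intro card_ge_0_finite) simp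
    qed
  qed (use finK in auto)
  also have "\<dots> = (\<Sum>w\<in>K - {0}. 2)"
    using card_nth_roots[of 2] two by (intro sum.cong) auto
  also have "\<dots> = 2 * (p ^ (n - 1) - 1)"
    using K0 finK by (simp add: cK)
  finally show ?thesis .
qed

lemma card_quadratic_trace_zeros:
  assumes odd: "odd p" and n: "n \<ge> 1" and c: "c \<in> Fq (p ^ n)" "c \<noteq> (0::'a)"
  defines "r \<equiv> p ^ n"
  defines "N \<equiv> card {u \<in> Fq (p ^ (n * 2)). Tr p (n * 2) (c * u\<^sup>2) = 0}"
  shows "(r mod 4 = 1 \<longrightarrow> p * N + r * (p - 1) = r\<^sup>2) \<and> (r mod 4 = 3 \<longrightarrow> p * N = r\<^sup>2 + r * (p - 1))"
proof -
  have r: "r > 1" unfolding r_def using p_gt_1 n by (intro one_less_power) auto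
  have odr: "odd r" using odd by (simp add: r_def)
  have Q: "p ^ (n * 2) = r\<^sup>2" by (simp add: r_def power_mult)
  \<comment> \<open>The size of a trace hyperplane in F_r.\<close>
  define t where "t = p ^ (n - 1)"
  have rt: "r = p * t" using n by (simp add: r_def t_def power_eq_if)
  have t: "t \<ge> 1" using p_pos by (simp add: t_def Suc_le_eq)
  \<comment> \<open>For \<open>u\<close> in F_(r^2) this is the relative trace of u^2 to
    F_r.\<close>
  define T :: "'a \<Rightarrow> 'a" where "T u = u\<^sup>2 + u ^ (2 * r)" for u
  define G where "G = {\<rho> :: 'a. \<rho> ^ (2 * (r - 1)) = 1}"
  define F where "F = (Fq (r\<^sup>2) - {0} :: 'a set)"
  define Z where "Z = {u \<in> F. T u = 0}"
  define M where "M = {u \<in> F. Tr p n (c * T u) = 0}"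
  have r0: "of_nat r = (0::'a)" using n by (simp add: r_def)
  note two = two_nonzero[OF odd]
  have N0: "of_nat (2 * (r - 1)) \<noteq> (0::'a)"
    using r two by (simp add: of_nat_diff r0)
  have cG: "card G = 2 * (r - 1)" unfolding G_def by (rule card_nth_roots[OF N0]) simp
  have finG: "finite G" by (rule card_ge_0_finite) (use cG r in simp)
  have finF: "finite F" unfolding F_def using finite_Fq[of "n * 2"] n Q by simp
  have cF: "card F = r\<^sup>2 - 1" unfolding F_def using card_Fq[of "n * 2"] n Q finite_Fq[of "n * 2"] Fq_closed(1)[of "n * 2"]
    by (subst card_Diff_singleton) auto
  have G0: "\<rho> \<noteq> 0" if "\<rho> \<in> G" for \<rho> using that r by (auto simp: G_def power_0_left)
  \<comment> \<open>Since \<open>r\<close> is odd, 2(r - 1) divides r^2 - 1, so all of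
    \<open>G\<close> lies in F_(r^2).\<close>
  have r2: "r\<^sup>2 - 1 = 2 * (r - 1) * ((r + 1) div 2)"
  proof -
    have "2 * ((r + 1) div 2) = r + 1" using odr by simp
    then have "2 * (r - 1) * ((r + 1) div 2) = (r - 1) * (r + 1)"
      by (metis mult.assoc mult.commute)
    also have "\<dots> = r\<^sup>2 - 1" using r by (simp add: power2_eq_square algebra_simps)
    finally show ?thesis by simp
  qed
  have unitF: "u \<in> F \<longleftrightarrow> u \<noteq> 0 \<and> u ^ (r\<^sup>2 - 1) = 1" for u
  proof -
    have "r\<^sup>2 = Suc (r\<^sup>2 - 1)" using r by (simp add: power2_eq_square)
    then have "u ^ (r\<^sup>2) = u * u ^ (r\<^sup>2 - 1)" by (metis power_Suc)
    then show ?thesis by (auto simp: F_def Fq_def)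
  qed
  have GF: "\<rho> \<in> F" if "\<rho> \<in> G" for \<rho>
    using that G0[OF that] unfolding unitF r2 power_mult by (simp add: G_def power_mult)
  have T\<rho>: "T (\<rho> * u) = \<rho>\<^sup>2 * T u" if "\<rho> \<in> G" for \<rho> u
  proof -
    have "2 * r = 2 + 2 * (r - 1)" using r by simp
    then have "\<rho> ^ (2 * r) = \<rho>\<^sup>2 * \<rho> ^ (2 * (r - 1))"
      by (metis power_add)
    then have "\<rho> ^ (2 * r) = \<rho>\<^sup>2" using that by (simp add: G_def)
    then show ?thesis by (simp add: T_def power_mult_distrib distrib_left)
  qed
  have TF: "T u \<in> Fq (p ^ n)" if "u \<in> F" for u
  proof -
    have "(u ^ (2 * r)) ^ r = (u ^ (r\<^sup>2))\<^sup>2" by (simp add: power2_eq_square mult_ac flip: power_mult power_add)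
       (simp add: algebra_simps mult_2 mult_2_right)
    also have "\<dots> = u\<^sup>2" using that by (simp add: F_def Fq_def)
    finally show ?thesis by (simp add: T_def Fq_def frob_add flip: r_def)
       (simp add: add.commute r_def frob_add flip: power_mult)
  qed
  \<comment> \<open>Each element of \<open>G\<close> permutes \<open>F\<close>, so counting zeros in
    \<open>u\<close> may be averaged over \<open>G\<close>. For fixed \<open>u\<close> the condition
    then depends on \<rho> only through \<rho>^2 T(u), a multiple by an arbitrary nonzero element of
    F_r.\<close>
  have "card G * card M = (\<Sum>\<rho>\<in>G. card {u \<in> F. Tr p n (c * T (\<rho> * u)) = 0})"
  proof -
    have "card {u \<in> F. Tr p n (c * T (\<rho> * u)) = 0} = card M" if \<rho>: "\<rho> \<in> G" for \<rho>
    proof (rule bij_betw_same_card[of "\<lambda>u. \<rho> * u"], rule bij_betw_byWitness[where f' = "\<lambda>u. u / \<rho>"])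
      have F: "\<rho> * u \<in> F" "u / \<rho> \<in> F" if "u \<in> F" for u
        using that GF[OF \<rho>] by (auto simp: F_def Fq_def power_mult_distrib power_divide)
      show "(\<lambda>u. \<rho> * u) ` {u \<in> F. Tr p n (c * T (\<rho> * u)) = 0} \<subseteq> M"
        "(\<lambda>u. u / \<rho>) ` M \<subseteq> {u \<in> F. Tr p n (c * T (\<rho> * u)) = 0}"
        using F G0[OF \<rho>] by (auto simp: M_def)
    qed (use G0[OF \<rho>] in auto)
    then show ?thesis by simp
  qed
  also have "\<dots> = (\<Sum>u\<in>F. card {\<rho> \<in> G. Tr p n (c * T (\<rho> * u)) = 0})"
  proof -
    have "(\<Sum>\<rho>\<in>G. \<Sum>u\<in>F. if Tr p n (c * T (\<rho> * u)) = 0 then 1 else (0::nat)) =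
        (\<Sum>u\<in>F. \<Sum>\<rho>\<in>G. if Tr p n (c * T (\<rho> * u)) = 0 then 1 else 0)"
      by (rule sum.swap)
    then show ?thesis using finF finG by (simp add: sum.If_cases Collect_conj_eq Int_commute)
  qed
  also have "\<dots> = (\<Sum>u\<in>F. if u \<in> Z then 2 * (r - 1) else 2 * (t - 1))"
  proof (intro sum.cong refl)
    fix u assume u: "u \<in> F"
    show "card {\<rho> \<in> G. Tr p n (c * T (\<rho> * u)) = 0} = (if u \<in> Z then 2 * (r - 1) else 2 * (t - 1))"
    proof (cases "u \<in> Z")
      case True
      then have "{\<rho> \<in> G. Tr p n (c * T (\<rho> * u)) = 0} = G" by (auto simp: Z_def T\<rho>)
      then show ?thesis using True cG by simp
    next
      case False
      have "{\<rho> \<in> G. Tr p n (c * T (\<rho> * u)) = 0} =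
          {\<rho>. \<rho> ^ (2 * (p ^ n - 1)) = 1 \<and> Tr p n (c * T u * \<rho>\<^sup>2) = 0}"
        using T\<rho>[of _ u] by (auto simp: G_def r_def mult_ac)
      moreover have "c * T u \<in> Fq (p ^ n)" "c * T u \<noteq> 0"
        using Fq_closed(5)[OF c(1) TF[OF u]] False u c by (auto simp: Z_def)
      ultimately show ?thesis
        using card_Tr_square_multiples[OF odd n, of "c * T u"] False by (simp add: t_def)
    qed
  qed
  also have "\<dots> = 2 * (r - 1) * card Z + 2 * (t - 1) * (r\<^sup>2 - 1 - card Z)"
  proof -
    have 1: "F \<inter> Z = Z" and 2: "F \<inter> - Z = F - Z" by (auto simp: Z_def)
    have 3: "card (F - Z) = r\<^sup>2 - 1 - card Z"
      using finF cF finite_subset[of Z F] by (subst card_Diff_subset) (auto simp: Z_def)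
    show ?thesis using finF by (simp add: sum.If_cases 1 2 3)
  qed
  finally have "2 * ((r - 1) * card M) = 2 * ((r - 1) * card Z + (t - 1) * (r\<^sup>2 - 1 - card Z))"
    by (simp add: cG algebra_simps)
  then have main: "(r - 1) * card M = (r - 1) * card Z + (t - 1) * (r\<^sup>2 - 1 - card Z)"
    by (simp only: mult_cancel1) simp
  have NM: "N = Suc (card M)"
  proof -
    have "{u \<in> Fq (p ^ (n * 2)). Tr p (n * 2) (c * u\<^sup>2) = 0} = insert 0 M"
      using Tr_quadratic_extension[OF c(1)] Fq_closed(1)[of "n * 2"]
      r by (auto simp: M_def F_def Q T_def r_def[symmetric] power_0_left)
    moreover have "0 \<notin> M" "finite M" using finF by (auto simp: M_def F_def)
    ultimately show ?thesis by (simp add: N_def)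
  qed
  have Zeq: "Z = {u \<in> F. u ^ (2 * (r - 1)) = - 1}"
  proof -
    have "T u = u\<^sup>2 * (1 + u ^ (2 * (r - 1)))" for u
    proof -
      have "2 * r = 2 + 2 * (r - 1)" using r by simp
      then have "u ^ (2 * r) = u\<^sup>2 * u ^ (2 * (r - 1))" by (metis power_add)
      then show ?thesis by (simp add: T_def distrib_left)
    qed
    then show ?thesis by (auto simp: Z_def F_def eq_neg_iff_add_eq_0 add.commute)
  qed
  \<comment> \<open>A nonzero \<open>u\<close> in the field has u^(r^2 - 1) = 1. Hence -1 is a 2(r -
    1)-st power there exactly when (r + 1)/2 is even, that is for r congruent to 3 mod 4.\<close>
  have Zpow: "u ^ (r\<^sup>2 - 1) = (- 1) ^ ((r + 1) div 2)" if "u ^ (2 * (r - 1)) = - 1" for u :: 'a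
    unfolding r2 power_mult[of u "2 * (r - 1)"] that ..
  have sq: "r\<^sup>2 - 1 = (r - 1) * (r + 1)" using r by (simp add: power2_eq_square algebra_simps)
  show ?thesis
  proof (intro conjI impI)
    assume r4: "r mod 4 = 1"
    then have "odd ((r + 1) div 2)" by presburger
    then have "Z = {}" using Zpow two unitF unfolding Zeq
      by (auto simp: minus_one_power_iff)
    then have "(r - 1) * card M = (t - 1) * ((r - 1) * (r + 1))" using main sq by (simp only: card.empty) simp
    then have "(r - 1) * card M = (r - 1) * ((t - 1) * (r + 1))" by (simp only: mult_ac)
    then have "card M = (t - 1) * (r + 1)" using r by (simp only: mult_cancel1) auto
    \<comment> \<open>Integers avoid truncated subtraction. The summand 1 counts u = 0.\<close>
    then have "int N = 1 + (int t - 1) * (int r + 1)" using NM t by (cases t) (simp_all add: algebra_simps)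
    then have "int N = int t * int r + int t - int r" by (simp add: algebra_simps)
    then have "int p * int N = int p * (int t * int r + int t - int r)" by (simp only:)
    also have "\<dots> = int r ^ 2 + int r - int p * int r" by (simp add: rt power2_eq_square algebra_simps)
    finally have "int (p * N + r * (p - 1)) = int (r\<^sup>2)"
      using p_gt_1 by (cases p) (simp_all add: algebra_simps)
    then show "p * N + r * (p - 1) = r\<^sup>2" by (simp only: of_nat_eq_iff)
  next
    assume r4: "r mod 4 = 3"
    then have ev: "even ((r + 1) div 2)" by presburger
    have "Z = {u. u ^ (2 * (r - 1)) = - 1}" using Zpow ev unitF r unfolding Zeq
      by (auto simp: power_0_left)
    then have Z: "card Z = 2 * (r - 1)" using card_nth_roots[OF N0, of "- 1"] by simp
    have "r\<^sup>2 - 1 - card Z = (r - 1) * (r - 1)"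
      unfolding sq Z using r by (simp add: algebra_simps power2_eq_square flip: diff_mult_distrib)
    then have "(r - 1) * card M = (r - 1) * (2 * (r - 1) + (t - 1) * (r - 1))"
      unfolding main Z by (simp only: distrib_left mult_ac)
    then have "card M = 2 * (r - 1) + (t - 1) * (r - 1)" using r by (simp only: mult_cancel1) auto
    then have "int N = 1 + (2 * (int r - 1) + (int t - 1) * (int r - 1))" using NM t r by (cases t; cases r) (simp_all add: algebra_simps)
    then have "int N = int t * int r + int r - int t" by (simp add: algebra_simps)
    then have "int p * int N = int p * (int t * int r + int r - int t)" by (simp only:)
    also have "\<dots> = int r ^ 2 - int r + int p * int r" by (simp add: rt power2_eq_square algebra_simps)
    finally have "int (p * N) = int (r\<^sup>2 + r * (p - 1))"
      using p_gt_1 by (cases p) (simp_all add: algebra_simps)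
    then show "p * N = r\<^sup>2 + r * (p - 1)" by (simp only: of_nat_eq_iff)
  qed
qed

section \<open>Separability and Artin-Schreier telescoping\<close>

lemma pderiv_lin_poly: "pderiv (lin_poly d b) = [:b 0:]"
proof -
  have "pderiv (lin_poly d b) = (\<Sum>i\<le>d. monom (of_nat (p ^ i) * b i) (p ^ i - 1))"
    unfolding lin_poly_def by (subst higher_pderiv_sum[of 1, simplified]) (simp add: pderiv_monom)
  also have "\<dots> = (\<Sum>i\<le>d. if i = 0 then [:b 0:] else 0)"
    by (intro sum.cong refl) (auto simp: monom_0 power_0_left)
  finally show ?thesis by simp
qed

lemma card_lin_roots:
  assumes "b 0 \<noteq> 0" "b d \<noteq> 0"
  shows "card {x. lin d b x = 0} = p ^ d"
proof -
  have "pderiv (lin_poly d b) = [:b 0:]" by (rule pderiv_lin_poly)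
  moreover have "lin_poly d b \<noteq> 0" using coeff_lin_poly[of d b 0] assms(1) by auto
  ultimately have "card {x. poly (lin_poly d b) x = 0} = degree (lin_poly d b)"
    using assms(1) by (intro card_poly_roots_separable) auto
  then show ?thesis by (simp add: degree_lin_poly[of b d] assms(2))
qed

text \<open>Modulo elements h^p - h, \<open>t\<close> equals t^(p^n), and the partial trace is an
  explicit primitive h. The later identities up to h^p - h are assembled from this one.\<close>

lemma AS_telescope: "(\<Sum>j<n. (t::'a) ^ (p ^ j)) ^ p - (\<Sum>j<n. t ^ (p ^ j)) = t ^ (p ^ n) - t"
proof -
  have "(\<Sum>j<n. t ^ (p ^ j)) ^ p = (\<Sum>j<n. t ^ (p ^ Suc j))"
    by (simp add: frob1 mult.commute flip: power_mult)
  then show ?thesis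
    using sum.lessThan_Suc_shift[of "\<lambda>j. t ^ (p ^ j)" n] by (simp add: algebra_simps)
qed

end

section \<open>The Heisenberg group\<close>

locale heisenberg = char_power ty p0 s p
  for ty :: "'a::alg_closed_field itself" and p0 s p +
  fixes e :: nat and a :: "nat \<Rightarrow> 'a"
  assumes e_pos: "e \<ge> 1" and a_e: "a e \<noteq> 0"
begin

abbreviation "V \<equiv> V_R p e a"
abbreviation "f \<equiv> f_R p e a"
abbreviation "E \<equiv> E_R p e a"

definition R :: "'a \<Rightarrow> 'a" where "R = lin e a"

lemma R_poly_eq: "R_poly p e a = lin_poly e a"
  by (simp add: R_poly_def lin_poly_def)

lemma poly_R_poly [simp]: "poly (R_poly p e a) x = R x"
  by (simp add: R_poly_eq R_def)

lemma R_add: "R (x + y) = R x + R y" and R_0 [simp]: "R 0 = 0" and R_diff: "R (x - y) = R x - R y"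
  and R_scale: "c \<in> Fq p \<Longrightarrow> R (c * x) = c * R x"
  by (simp_all add: R_def lin_add lin_diff lin_scale)

text \<open>\<open>E\<close> is an additive polynomial of degree p^(2e); both of its summands
  contribute at k = e. Its lowest coefficient is \<open>a e\<close>, which makes it
  separable.\<close>

definition E_coeff :: "nat \<Rightarrow> 'a" where
  "E_coeff k = (if k \<le> e then a (e - k) ^ (p ^ k) else 0) + (if e \<le> k then a (k - e) ^ (p ^ e) else 0)"

lemma E_lin: "E x = lin (2 * e) E_coeff x"
proof -
  have "(\<Sum>i\<le>e. (a i * x) ^ (p ^ (e - i))) = (\<Sum>k\<le>e. a (e - k) ^ (p ^ k) * x ^ (p ^ k))"
    by (rule sum.reindex_bij_witness[where i = "\<lambda>k. e - k" and j = "\<lambda>k. e - k"])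
       (auto simp: power_mult_distrib)
  also have "\<dots> = (\<Sum>k\<le>2 * e. (if k \<le> e then a (e - k) ^ (p ^ k) else 0) * x ^ (p ^ k))"
    by (rule sum.mono_neutral_cong_left) auto
  finally have 1: "(\<Sum>i\<le>e. (a i * x) ^ (p ^ (e - i))) = \<dots>" .
  have "R x ^ (p ^ e) = (\<Sum>i\<le>e. a i ^ (p ^ e) * x ^ (p ^ (i + e)))"
    by (simp add: R_def lin_def frob_sum power_mult_distrib power_add flip: power_mult)
  also have "\<dots> = (\<Sum>k\<in>{e..2 * e}. a (k - e) ^ (p ^ e) * x ^ (p ^ k))"
    by (rule sum.reindex_bij_witness[where i = "\<lambda>k. k - e" and j = "\<lambda>k. k + e"]) auto
  also have "\<dots> = (\<Sum>k\<le>2 * e. (if e \<le> k then a (k - e) ^ (p ^ e) else 0) * x ^ (p ^ k))"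
    by (rule sum.mono_neutral_cong_left) auto
  finally show ?thesis
    unfolding E_R_def 1 by (simp add: lin_def E_coeff_def distrib_right sum.distrib)
qed

lemma E_coeff_0: "E_coeff 0 = a e" and E_coeff_top: "E_coeff (2 * e) = a e ^ (p ^ e)"
  using e_pos by (auto simp: E_coeff_def)

lemma card_V: "card V = p ^ (2 * e)"
  unfolding V_R_def E_lin using card_lin_roots[of E_coeff "2 * e"] E_coeff_0 E_coeff_top a_e by simp

lemma finite_V: "finite V"
  by (rule card_ge_0_finite) (simp add: card_V)

lemma Fp_subspace_V: "Fp_subspace V"
  using finite_V unfolding Fp_subspace_def V_R_def E_lin by (auto simp: lin_add lin_scale)

lemma f_add_left: "f (x + x') y = f x y + f x' y"
  by (simp add: f_R_def distrib_left distrib_right frob_add sum.distrib algebra_simps)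

lemma f_add_right: "f x (y + y') = f x y + f x y'"
  by (simp add: f_R_def distrib_left distrib_right frob_add sum.distrib R_add)

lemma f_scale_left: "c \<in> Fq p \<Longrightarrow> f (c * x) y = c * f x y"
  by (simp add: f_R_def power_mult_distrib Fp_power sum_distrib_left distrib_left mult_ac)

lemma f_scale_right: "c \<in> Fq p \<Longrightarrow> f x (c * y) = c * f x y"
  by (simp add: f_R_def R_scale power_mult_distrib Fp_power sum_distrib_left distrib_left mult_ac)

lemma f_0 [simp]: "f x 0 = 0" "f 0 y = 0"
  using f_add_right[of x 0 0] f_add_left[of 0 0 y] by (simp_all only: add_0_left add_cancel_right_right)

lemma f_minus: "f x (- y) = - f x y" "f (- x) y = - f x y"
  using f_add_right[of x y "- y"] f_add_left[of x "- x" y]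
  by (simp_all add: eq_neg_iff_add_eq_0 add.commute)

text \<open>\<open>f x y\<close> is an Artin-Schreier primitive of the polar form x R(y) + y R(x),
  up to a term that vanishes for \<open>y\<close> in \<open>V\<close>. This is what makes the
  carrier of \<open>H\<close> closed under the product.\<close>

lemma f_AS: "f x y ^ p - f x y = x * R y + y * R x - x ^ (p ^ e) * E y"
proof -
  define A where "A = (\<Sum>i<e. \<Sum>j<e - i. (a i * x ^ (p ^ i) * y) ^ (p ^ j))"
  define B where "B = (\<Sum>i<e. (x * R y) ^ (p ^ i))"
  have f: "f x y = - (A + B)" by (simp add: f_R_def A_def B_def sum.distrib)
  have B: "B ^ p - B = (x * R y) ^ (p ^ e) - x * R y"
    unfolding B_def by (rule AS_telescope)
  have "A ^ p - A = (\<Sum>i<e. (\<Sum>j<e - i. (a i * x ^ (p ^ i) * y) ^ (p ^ j)) ^ p - (\<Sum>j<e - i. (a i * x ^ (p ^ i) * y) ^ (p ^ j)))"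
    unfolding A_def frob1(2) sum_subtractf ..
  also have "\<dots> = (\<Sum>i<e. (a i * x ^ (p ^ i) * y) ^ (p ^ (e - i)) - a i * x ^ (p ^ i) * y)"
    by (simp only: AS_telescope)
  \<comment> \<open>The added summand i = e is zero, its Frobenius exponent being p^0.\<close>
  also have "\<dots> = (\<Sum>i\<le>e. (a i * x ^ (p ^ i) * y) ^ (p ^ (e - i)) - a i * x ^ (p ^ i) * y)"
    by (simp add: lessThan_Suc_atMost[symmetric])
  also have "\<dots> = x ^ (p ^ e) * (\<Sum>i\<le>e. (a i * y) ^ (p ^ (e - i))) - y * R x"
  proof -
    have "(a i * x ^ (p ^ i) * y) ^ (p ^ (e - i)) = x ^ (p ^ e) * (a i * y) ^ (p ^ (e - i))" if "i \<le> e" for i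
      using that by (simp add: power_mult_distrib mult_ac flip: power_mult power_add)
    then show ?thesis
      by (simp add: sum_subtractf sum_distrib_left R_def lin_def mult_ac)
  qed
  finally have A: "A ^ p - A = x ^ (p ^ e) * (\<Sum>i\<le>e. (a i * y) ^ (p ^ (e - i))) - y * R x" .
  have "f x y ^ p - f x y = - (A ^ p - A) - (B ^ p - B)"
    unfolding f by (simp add: frob1)
  then show ?thesis
    unfolding A B by (simp add: E_R_def power_mult_distrib algebra_simps)
qed

text \<open>The commutator pairing: elements of \<open>H\<close> commute iff \<omega> vanishes on
  their first coordinates.\<close>

definition \<omega> :: "'a \<Rightarrow> 'a \<Rightarrow> 'a" where "\<omega> x y = f x y - f y x"

lemma \<omega>_add: "\<omega> (x + x') y = \<omega> x y + \<omega> x' y" "\<omega> x (y + y') = \<omega> x y + \<omega> x y'"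
  and \<omega>_scale: "c \<in> Fq p \<Longrightarrow> \<omega> (c * x) y = c * \<omega> x y" "c \<in> Fq p \<Longrightarrow> \<omega> x (c * y) = c * \<omega> x y"
  and \<omega>_0: "\<omega> 0 y = 0" "\<omega> x 0 = 0"
  and \<omega>_swap: "\<omega> y x = - \<omega> x y" and \<omega>_self: "\<omega> x x = 0"
  by (simp_all add: \<omega>_def f_add_left f_add_right f_scale_left f_scale_right right_diff_distrib)

lemma \<omega>_AS: "\<omega> x y ^ p - \<omega> x y = y ^ (p ^ e) * E x - x ^ (p ^ e) * E y"
  using f_AS[of x y] f_AS[of y x] by (simp add: \<omega>_def frob1 algebra_simps)

lemma \<omega>_in_Fp: "x \<in> V \<Longrightarrow> y \<in> V \<Longrightarrow> \<omega> x y \<in> Fq p"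
  using \<omega>_AS[of x y] by (simp add: V_R_def Fq_def)

text \<open>The property wanted of functions such as \<omega> is that a nonconstant polynomial
  function over an algebraically closed field is onto. A predicate closed under arithmetic avoids
  writing the polynomials down.\<close>

definition poly_fun :: "('a \<Rightarrow> 'a) \<Rightarrow> bool" where "poly_fun g \<longleftrightarrow> (\<exists>P. \<forall>x. g x = poly P x)"

lemma poly_fun_intros:
  "poly_fun (\<lambda>x. x)"
  "poly_fun (\<lambda>x. c)"
  "poly_fun g \<Longrightarrow> poly_fun h \<Longrightarrow> poly_fun (\<lambda>x. g x + h x)"
  "poly_fun g \<Longrightarrow> poly_fun h \<Longrightarrow> poly_fun (\<lambda>x. g x * h x)"
  "poly_fun g \<Longrightarrow> poly_fun h \<Longrightarrow> poly_fun (\<lambda>x. g x - h x)"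
  "poly_fun g \<Longrightarrow> poly_fun (\<lambda>x. - g x)"
  "poly_fun g \<Longrightarrow> poly_fun (\<lambda>x. g x ^ n)"
  unfolding poly_fun_def
  by (rule exI[of _ "[:0, 1:]"], simp)
     (rule exI[of _ "[:c:]"], simp, metis poly_add, metis poly_mult, metis poly_diff,
      metis poly_minus, metis poly_power)

lemma poly_fun_sum: "(\<And>i. i \<in> I \<Longrightarrow> poly_fun (g i)) \<Longrightarrow> poly_fun (\<lambda>x. \<Sum>i\<in>I. g i x)"
  by (induction I rule: infinite_finite_induct) (auto intro: poly_fun_intros)

lemma poly_fun_lin: "poly_fun (lin d b)"
  unfolding lin_def by (intro poly_fun_sum poly_fun_intros)

lemma poly_fun_\<omega>: "poly_fun (\<omega> x)" "poly_fun (\<lambda>x. \<omega> x y)"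
  unfolding \<omega>_def f_R_def poly_R_poly R_def lin_def
  by (intro poly_fun_sum poly_fun_intros)+

lemma poly_fun_surj:
  assumes "poly_fun g" "g x \<noteq> g y"
  shows "\<exists>z. g z = t"
proof -
  obtain P where P: "\<And>x. g x = poly P x" using assms(1) by (auto simp: poly_fun_def)
  have "degree (P - [:t:]) > 0"
  proof (rule ccontr)
    assume "\<not> 0 < degree (P - [:t:])"
    then obtain k where "P - [:t:] = [:k:]" by (auto elim: degree_eq_zeroE)
    then have "P = [:k + t:]" by (simp add: diff_eq_eq)
    then show False using assms(2) P by simp
  qed
  then obtain z where "poly (P - [:t:]) z = 0" using alg_closed_imp_poly_has_root by blast
  then show ?thesis using P by auto
qed

lemma V_proper: "\<exists>y. E y \<noteq> 0"
proof -
  obtain y where "y \<notin> V" using finite_V infinite_UNIV_a by (metis ex_new_if_finite)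
  then show ?thesis by (auto simp: V_R_def)
qed

text \<open>For \<open>x \<in> V\<close>, a point \<open>y\<close> with \<open>\<omega> x y = 1\<close> lies in \<open>V\<close>, because then \<open>x ^ (p ^ e) * E y = 0\<close>; and
  a nonconstant polynomial function takes the value 1.\<close>

lemma \<omega>_nondegenerate:
  assumes "x \<in> V" "\<And>y. y \<in> V \<Longrightarrow> \<omega> x y = 0"
  shows "x = 0"
proof (rule ccontr)
  assume x: "x \<noteq> 0"
  have AS: "\<omega> x y ^ p - \<omega> x y = - (x ^ (p ^ e) * E y)" for y
    using \<omega>_AS[of x y] assms(1) by (simp add: V_R_def)
  obtain y where "E y \<noteq> 0" using V_proper by blast
  \<comment> \<open>Since x^(p^e) E(y) is nonzero, \<open>\<omega> x y\<close> is not fixed by the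
    \<open>p\<close>-th power, so it differs from the value 0 taken at y = 0.\<close>
  then have "\<omega> x y \<noteq> \<omega> x 0" using AS[of y] x p_pos by (auto simp: \<omega>_0 power_0_left simp del: p_pos)
  then obtain z where z: "\<omega> x z = 1" using poly_fun_surj[OF poly_fun_\<omega>(1)] by blast
  then have "z \<in> V" using AS[of z] x by (simp add: V_R_def)
  then show False using assms(2) z by simp
qed

abbreviation "H \<equiv> H_R p e a"

lemma carrier_H: "(\<alpha>, \<beta>) \<in> carrier H \<longleftrightarrow> \<alpha> \<in> V \<and> \<beta> ^ p - \<beta> = \<alpha> * R \<alpha>"
  by (simp add: H_R_def)

lemma mult_H: "(\<alpha>, \<beta>) \<otimes>\<^bsub>H\<^esub> (\<alpha>', \<beta>') = (\<alpha> + \<alpha>', \<beta> + \<beta>' + f \<alpha> \<alpha>')"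
  by (simp add: H_R_def)

lemma one_H: "\<one>\<^bsub>H\<^esub> = (0, 0)"
  by (simp add: H_R_def)

lemma lift_exists: "u \<in> V \<Longrightarrow> \<exists>\<beta>. (u, \<beta>) \<in> carrier H"
proof -
  have "poly_fun (\<lambda>\<beta>::'a. \<beta> ^ p - \<beta>)" by (intro poly_fun_intros)
  moreover have "\<exists>x y :: 'a. x ^ p - x \<noteq> y ^ p - y"
  proof -
    obtain x :: 'a where "x \<notin> Fq p" using finite_Fp infinite_UNIV_a by (metis ex_new_if_finite)
    then have "x ^ p - x \<noteq> 0 ^ p - 0" using p_gt_1 by (simp add: Fq_def power_0_left)
    then show ?thesis by blast
  qed
  ultimately have "\<exists>\<beta>. \<beta> ^ p - \<beta> = u * R u" using poly_fun_surj by blast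
  then show "u \<in> V \<Longrightarrow> ?thesis" by (auto simp: carrier_H)
qed

text \<open>The second coordinate of the inverse is dictated by f(\<alpha>, -\<alpha>) =
  -f(\<alpha>, \<alpha>).\<close>

lemma inv_carrier:
  assumes "(\<alpha>, \<beta>) \<in> carrier H"
  shows "(- \<alpha>, - \<beta> + f \<alpha> \<alpha>) \<in> carrier H"
proof -
  have E: "E \<alpha> = 0" using assms by (simp add: carrier_H V_R_def)
  have "- \<alpha> \<in> V" using assms Fp_subspaceD(5)[OF Fp_subspace_V] by (simp add: carrier_H)
  moreover have "(- \<beta> + f \<alpha> \<alpha>) ^ p - (- \<beta> + f \<alpha> \<alpha>) = - (\<beta> ^ p - \<beta>) + (f \<alpha> \<alpha> ^ p - f \<alpha> \<alpha>)"
    by (simp add: frob1)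
  moreover have "R (- \<alpha>) = - R \<alpha>" using R_diff[of 0 \<alpha>] by simp
  moreover have "\<beta> ^ p - \<beta> = \<alpha> * R \<alpha>" using assms by (simp add: carrier_H)
  ultimately show ?thesis using E by (simp only: carrier_H f_AS) simp
qed

lemma inv_H:
  assumes "(\<alpha>, \<beta>) \<in> carrier H"
  shows "inv\<^bsub>H\<^esub> (\<alpha>, \<beta>) = (- \<alpha>, - \<beta> + f \<alpha> \<alpha>)"
  unfolding m_inv_def
proof (rule the_equality)
  show "(- \<alpha>, - \<beta> + f \<alpha> \<alpha>) \<in> carrier H \<and> (\<alpha>, \<beta>) \<otimes>\<^bsub>H\<^esub> (- \<alpha>, - \<beta> + f \<alpha> \<alpha>) = \<one>\<^bsub>H\<^esub> \<and>
      (- \<alpha>, - \<beta> + f \<alpha> \<alpha>) \<otimes>\<^bsub>H\<^esub> (\<alpha>, \<beta>) = \<one>\<^bsub>H\<^esub>"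
    using inv_carrier[OF assms] by (simp add: mult_H one_H f_minus)
next
  fix y assume y: "y \<in> carrier H \<and> (\<alpha>, \<beta>) \<otimes>\<^bsub>H\<^esub> y = \<one>\<^bsub>H\<^esub> \<and> y \<otimes>\<^bsub>H\<^esub> (\<alpha>, \<beta>) = \<one>\<^bsub>H\<^esub>"
  obtain \<gamma> \<delta> where yy: "y = (\<gamma>, \<delta>)" by (cases y)
  have "\<gamma> = - \<alpha>" using y by (simp add: yy mult_H one_H eq_neg_iff_add_eq_0 add.commute)
  moreover have "\<delta> = - \<beta> + f \<alpha> \<alpha>"
    using y unfolding yy calculation by (simp add: mult_H one_H f_minus algebra_simps eq_neg_iff_add_eq_0)
  ultimately show "y = (- \<alpha>, - \<beta> + f \<alpha> \<alpha>)" using yy by simp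
qed

lemma mult_carrier:
  assumes "(\<alpha>, \<beta>) \<in> carrier H" "(\<alpha>', \<beta>') \<in> carrier H"
  shows "(\<alpha> + \<alpha>', \<beta> + \<beta>' + f \<alpha> \<alpha>') \<in> carrier H"
proof -
  have "\<alpha> + \<alpha>' \<in> V" using assms Fp_subspaceD(3)[OF Fp_subspace_V] by (simp add: carrier_H)
  moreover have "(\<beta> + \<beta>' + f \<alpha> \<alpha>') ^ p - (\<beta> + \<beta>' + f \<alpha> \<alpha>') =
      (\<beta> ^ p - \<beta>) + (\<beta>' ^ p - \<beta>') + (f \<alpha> \<alpha>' ^ p - f \<alpha> \<alpha>')"
    by (simp add: frob1)
  moreover have "E \<alpha>' = 0" using assms by (simp add: carrier_H V_R_def)
  ultimately show ?thesis using assms by (simp add: carrier_H f_AS R_add algebra_simps)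
qed

text \<open>Isotropy of \<open>U\<close> is commutativity of its full preimage, and associativity is
  additivity of \<open>f\<close> in each argument. These are the subgroups against which the
  maximality of \<open>A\<close> is tested.\<close>

lemma isotropic_abelian_subgroup:
  assumes U: "U \<subseteq> V" "0 \<in> U" "\<And>x y. x \<in> U \<Longrightarrow> y \<in> U \<Longrightarrow> x + y \<in> U" "\<And>x. x \<in> U \<Longrightarrow> - x \<in> U"
    and iso: "\<And>x y. x \<in> U \<Longrightarrow> y \<in> U \<Longrightarrow> \<omega> x y = 0"
  defines "B \<equiv> {x \<in> carrier H. fst x \<in> U}"
  shows "is_abelian_subgroup H B"
  unfolding is_abelian_subgroup_def
proof
  have mem: "(\<alpha>, \<beta>) \<in> B \<longleftrightarrow> (\<alpha>, \<beta>) \<in> carrier H \<and> \<alpha> \<in> U" for \<alpha> \<beta> by (simp add: B_def)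
  have closed: "x \<otimes>\<^bsub>H\<^esub> y \<in> B" if "x \<in> B" "y \<in> B" for x y
    using that mult_carrier U(3) by (cases x; cases y) (auto simp: mem mult_H)
  have one: "\<one>\<^bsub>H\<^esub> \<in> B" using U by (auto simp: one_H mem carrier_H power_0_left)
  have inv: "inv\<^bsub>H\<^esub> x \<in> B" if "x \<in> B" for x
    using that inv_carrier U(4) by (cases x) (auto simp: mem inv_H)
  show "subgroup B H"
    by (rule subgroup.intro) (use closed one inv in \<open>auto simp: B_def\<close>)
  show "comm_group (H\<lparr>carrier := B\<rparr>)"
  proof (rule comm_groupI; simp)
    show "x \<otimes>\<^bsub>H\<^esub> y \<in> B" if "x \<in> B" "y \<in> B" for x y using closed that .
    show "\<one>\<^bsub>H\<^esub> \<in> B" by (rule one)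
    show "x \<otimes>\<^bsub>H\<^esub> y \<otimes>\<^bsub>H\<^esub> z = x \<otimes>\<^bsub>H\<^esub> (y \<otimes>\<^bsub>H\<^esub> z)" for x y z
      by (cases x; cases y; cases z) (simp add: mult_H f_add_left f_add_right add_ac)
    show "x \<otimes>\<^bsub>H\<^esub> y = y \<otimes>\<^bsub>H\<^esub> x" if "x \<in> B" "y \<in> B" for x y
      using that iso by (cases x; cases y) (auto simp: mult_H mem \<omega>_def add_ac)
    show "\<one>\<^bsub>H\<^esub> \<otimes>\<^bsub>H\<^esub> x = x" for x by (cases x) (simp add: mult_H one_H)
    show "\<exists>y\<in>B. y \<otimes>\<^bsub>H\<^esub> x = \<one>\<^bsub>H\<^esub>" if "x \<in> B" for x
      using inv[OF that] that by (cases x) (auto simp: mem inv_H mult_H one_H f_minus intro!: bexI[of _ "inv\<^bsub>H\<^esub> x"])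
  qed
qed

context
  fixes A
  assumes maxA: "maximal_abelian_subgroup H A"
begin

lemma subgroup_A: "subgroup A H" and comm_A: "comm_group (H\<lparr>carrier := A\<rparr>)"
  using maxA by (auto simp: maximal_abelian_subgroup_def is_abelian_subgroup_def)

lemma Abar_closed:
  shows "fst ` A \<subseteq> V" "0 \<in> fst ` A" "x \<in> fst ` A \<Longrightarrow> y \<in> fst ` A \<Longrightarrow> x + y \<in> fst ` A"
    "x \<in> fst ` A \<Longrightarrow> - x \<in> fst ` A" "x \<in> fst ` A \<Longrightarrow> y \<in> fst ` A \<Longrightarrow> \<omega> x y = 0"
proof -
  have sub: "A \<subseteq> carrier H" using subgroup.subset[OF subgroup_A] .
  show "fst ` A \<subseteq> V" using sub by (auto simp: carrier_H)
  show "0 \<in> fst ` A" using subgroup.one_closed[OF subgroup_A] by (force simp: one_H)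
  show "x + y \<in> fst ` A" "\<omega> x y = 0" if xy: "x \<in> fst ` A" "y \<in> fst ` A" for x y
  proof -
    obtain \<beta> \<gamma> where *: "(x, \<beta>) \<in> A" "(y, \<gamma>) \<in> A" using xy by auto
    show "x + y \<in> fst ` A"
      using subgroup.m_closed[OF subgroup_A *] by (force simp: mult_H)
    have "(x, \<beta>) \<otimes>\<^bsub>H\<^esub> (y, \<gamma>) = (y, \<gamma>) \<otimes>\<^bsub>H\<^esub> (x, \<beta>)"
      using comm_monoid.m_comm[OF comm_group.axioms(1)[OF comm_A], of "(x, \<beta>)" "(y, \<gamma>)"] * by simp
    then show "\<omega> x y = 0" by (simp add: mult_H \<omega>_def)
  qed
  show "- x \<in> fst ` A" if x: "x \<in> fst ` A" for x
  proof -
    obtain \<beta> where *: "(x, \<beta>) \<in> A" using x by auto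
    then show ?thesis
      using subgroup.m_inv_closed[OF subgroup_A *] sub by (force simp: inv_H)
  qed
qed

text \<open>The full preimage of \<open>U\<close> is an abelian subgroup containing
  \<open>A\<close>, hence equal to \<open>A\<close>; and every point of \<open>U\<close> has a lift
  to \<open>H\<close>, because \<beta>^p - \<beta> is onto.\<close>

lemma maximal_isotropic:
  assumes "U \<subseteq> V" "0 \<in> U" "\<And>x y. x \<in> U \<Longrightarrow> y \<in> U \<Longrightarrow> x + y \<in> U" "\<And>x. x \<in> U \<Longrightarrow> - x \<in> U"
    and "\<And>x y. x \<in> U \<Longrightarrow> y \<in> U \<Longrightarrow> \<omega> x y = 0" and "fst ` A \<subseteq> U"
  shows "U = fst ` A"
proof -
  define B where "B = {x \<in> carrier H. fst x \<in> U}"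
  have "is_abelian_subgroup H B" unfolding B_def by (rule isotropic_abelian_subgroup) (use assms in auto)
  moreover have "A \<subseteq> B"
    using subgroup.subset[OF subgroup_A] assms(6) by (auto simp: B_def)
  ultimately have "B = A" using maxA by (auto simp: maximal_abelian_subgroup_def)
  moreover have "U \<subseteq> fst ` B"
  proof
    fix u assume "u \<in> U"
    then obtain \<beta> where "(u, \<beta>) \<in> carrier H" using lift_exists assms(1) by blast
    then show "u \<in> fst ` B" using \<open>u \<in> U\<close> by (force simp: B_def)
  qed
  ultimately show ?thesis using assms(6) by auto
qed

text \<open>A vector orthogonal to the image can be adjoined with all its F_p-multiples without
  losing isotropy, \<omega> being alternating. At this stage the image is known only as an additive
  subgroup; its closure under F_p is read off from this description afterwards.\<close>

lemma Abar_eq_perp: "fst ` A = {v \<in> V. \<forall>\<alpha>\<in>fst ` A. \<omega> v \<alpha> = 0}"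
proof (intro equalityI subsetI)
  fix v assume "v \<in> {v \<in> V. \<forall>\<alpha>\<in>fst ` A. \<omega> v \<alpha> = 0}"
  then have v: "v \<in> V" "\<And>\<alpha>. \<alpha> \<in> fst ` A \<Longrightarrow> \<omega> v \<alpha> = 0" by auto
  have v': "\<omega> \<alpha> v = 0" if "\<alpha> \<in> fst ` A" for \<alpha> using v(2)[OF that] \<omega>_swap[of \<alpha> v] by simp
  define U where "U = {\<alpha> + c * v | \<alpha> c. \<alpha> \<in> fst ` A \<and> c \<in> Fq p}"
  note VD = Fp_subspaceD[OF Fp_subspace_V]
  have AU: "fst ` A \<subseteq> U"
  proof
    fix \<alpha> assume "\<alpha> \<in> fst ` A"
    then show "\<alpha> \<in> U" unfolding U_def using Fp_closed(1)
      by (intro CollectI exI[of _ \<alpha>] exI[of _ "0::'a"]) simp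
  qed
  have "U = fst ` A"
  proof (rule maximal_isotropic[OF _ _ _ _ _ AU])
    show "U \<subseteq> V" using Abar_closed(1) v(1) VD by (auto simp: U_def)
    show "0 \<in> U" using AU Abar_closed(2) by blast
  next
    fix x y assume "x \<in> U" "y \<in> U"
    then obtain \<alpha> c \<alpha>' c' where *: "x = \<alpha> + c * v" "y = \<alpha>' + c' * v" "\<alpha> \<in> fst ` A" "\<alpha>' \<in> fst ` A" "c \<in> Fq p" "c' \<in> Fq p"
      unfolding U_def by blast
    have "x + y = (\<alpha> + \<alpha>') + (c + c') * v" using * by (simp add: algebra_simps)
    then show "x + y \<in> U" unfolding U_def using Abar_closed(3)[OF *(3,4)] Fp_closed(3)[OF *(5,6)] by blast
    show "\<omega> x y = 0"
      using * by (simp add: \<omega>_add \<omega>_scale \<omega>_self v v' Abar_closed(5))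
  next
    fix x assume "x \<in> U"
    then obtain \<alpha> c where *: "x = \<alpha> + c * v" "\<alpha> \<in> fst ` A" "c \<in> Fq p"
      unfolding U_def by blast
    have "- x = (- \<alpha>) + (- c) * v" using * by (simp add: algebra_simps)
    then show "- x \<in> U" unfolding U_def using Abar_closed(4)[OF *(2)] Fp_closed(7)[OF *(3)] by blast
  qed
  moreover have "v \<in> U" unfolding U_def using Abar_closed(2) Fp_closed(2)
    by (intro CollectI exI[of _ "0::'a"] exI[of _ "1::'a"]) simp
  ultimately show "v \<in> fst ` A" by simp
qed (use Abar_closed in auto)

lemma Fp_subspace_Abar: "Fp_subspace (fst ` A)"
  unfolding Fp_subspace_def
proof (intro conjI ballI)
  show "finite (fst ` A)" using finite_subset[OF Abar_closed(1) finite_V] .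
  fix c x :: 'a assume c: "c \<in> Fq p" and x: "x \<in> fst ` A"
  have "c * x \<in> V" using Fp_subspaceD(4)[OF Fp_subspace_V c] x Abar_closed(1) by blast
  moreover have "\<omega> (c * x) \<alpha> = 0" if "\<alpha> \<in> fst ` A" for \<alpha>
    using Abar_closed(5)[OF x that] by (simp add: \<omega>_scale c)
  ultimately show "c * x \<in> fst ` A" by (subst Abar_eq_perp) blast
qed (use Abar_closed in auto)

text \<open>The image is its own orthogonal complement in the nondegenerate space \<open>V\<close>,
  so the square of its size is |V| = p^(2e).\<close>

lemma card_Abar: "card (fst ` A) = p ^ e"
proof -
  have "card {x \<in> V. \<forall>y\<in>fst ` A. \<omega> x y = 0} * card (fst ` A) =
      card {y \<in> fst ` A. \<forall>x\<in>V. \<omega> x y = 0} * card V"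
    by (rule card_pairing_kernels[OF Fp_subspace_V Fp_subspace_Abar])
       (use Abar_closed(1) in \<open>auto simp: \<omega>_add \<omega>_scale intro!: \<omega>_in_Fp\<close>)
  moreover have "{y \<in> fst ` A. \<forall>x\<in>V. \<omega> x y = 0} = {0}"
  proof (intro equalityI subsetI)
    fix y assume y: "y \<in> {y \<in> fst ` A. \<forall>x\<in>V. \<omega> x y = 0}"
    then have "\<omega> y x = 0" if "x \<in> V" for x using that \<omega>_swap[of y x] by simp
    moreover have "y \<in> V" using y Abar_closed(1) by blast
    ultimately show "y \<in> {0}" using \<omega>_nondegenerate by blast
  qed (use Abar_closed(2) \<omega>_0 in auto)
  ultimately have "card (fst ` A) * card (fst ` A) = p ^ (2 * e)"
    using card_V Abar_eq_perp by simp
  then have "(card (fst ` A))\<^sup>2 = (p ^ e)\<^sup>2" by (simp add: power2_eq_square mult_2 power_add)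
  then show ?thesis by (simp only: power2_eq_iff_nonneg zero_le)
qed

end

end

section \<open>Diagonalising x R(x) by the vanishing polynomial of an isotropic space\<close>

lemma poly_eq_of_agree:
  fixes P Q :: "'a::idom poly"
  assumes "degree P \<le> n" "degree Q \<le> n" "coeff P n = coeff Q n" "n > 0"
    and "finite X" "card X \<ge> n" "\<And>x. x \<in> X \<Longrightarrow> poly P x = poly Q x"
  shows "P = Q"
proof -
  have "degree (P - Q) \<le> n" using assms(1,2) by (rule degree_diff_le)
  moreover have "coeff (P - Q) n = 0" using assms(3) by simp
  ultimately have "degree (P - Q) < n"
    using assms(4) by (metis degree_0 leading_coeff_0_iff order_le_less)
  then have "P - Q = 0"
    by (intro poly_eq_0_of_card_roots[OF assms(5)]) (use assms in auto)
  then show ?thesis by simp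
qed

context char_power begin

lemma coeff_vanishing_in_Fq:
  assumes "X \<subseteq> Fq (p ^ M)"
  shows "coeff (\<Prod>\<alpha>\<in>X. [:- \<alpha>, 1 :: 'a:]) n \<in> Fq (p ^ M)"
  using assms
proof (induction X arbitrary: n rule: infinite_finite_induct)
  case (insert x X)
  have "coeff [:- x, 1:] i \<in> Fq (p ^ M)" for i
    using insert.prems by (auto simp: coeff_pCons intro!: Fq_closed split: nat.splits)
  moreover have "coeff (\<Prod>\<alpha>\<in>X. [:- \<alpha>, 1:]) i \<in> Fq (p ^ M)" for i using insert by simp
  ultimately have "coeff ([:- x, 1:] * (\<Prod>\<alpha>\<in>X. [:- \<alpha>, 1:])) n \<in> Fq (p ^ M)"
    unfolding coeff_mult by (intro Fq_sum Fq_closed(5))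
  then show ?case using insert by (simp only: prod.insert[OF insert(1,2)])
qed (auto simp: Fq_closed coeff_1)

lemma vanishing_lin:
  assumes "Fp_subspace X" "card X = p ^ d"
  obtains b where "b d = 1" "(\<Prod>\<alpha>\<in>X. [:- \<alpha>, 1:]) = lin_poly d b"
    "\<And>x. (\<Prod>\<alpha>\<in>X. x - \<alpha>) = lin d b x" "\<And>x. lin d b x = 0 \<longleftrightarrow> x \<in> X"
proof -
  obtain d' b where b: "card X = p ^ d'" "b d' = 1" "\<And>x. (\<Prod>\<alpha>\<in>X. x - \<alpha>) = lin d' b x"
    using subspace_vanishing_lin[OF assms(1)] by blast
  have "d' = d" using b(1) assms(2) p_gt_1 by (simp add: power_inject_exp)
  moreover have "lin d' b x = 0 \<longleftrightarrow> x \<in> X" for x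
    unfolding b(3)[symmetric] using Fp_subspaceD(1)[OF assms(1)] by (auto simp: prod_zero_iff)
  moreover have "(\<Prod>\<alpha>\<in>X. [:- \<alpha>, 1:]) = lin_poly d' b"
    by (rule poly_ext) (simp add: poly_vanishing b(3))
  ultimately show ?thesis using b that by blast
qed

lemma Fp_subspace_lin_image:
  assumes "Fp_subspace X"
  shows "Fp_subspace (lin d b ` X)"
  unfolding Fp_subspace_def
proof (intro conjI ballI)
  note XD = Fp_subspaceD[OF assms]
  show "finite (lin d b ` X)" using XD by simp
  show "0 \<in> lin d b ` X" using XD(2) by (rule rev_image_eqI) simp
  show "x + y \<in> lin d b ` X" if "x \<in> lin d b ` X" "y \<in> lin d b ` X" for x y
    using that XD(3) by (auto simp: lin_add[symmetric])
  show "c * x \<in> lin d b ` X" if "c \<in> Fq p" "x \<in> lin d b ` X" for c x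
    using that XD(4) by (auto simp: lin_scale[symmetric])
qed

lemma card_lin_image:
  assumes "Fp_subspace X"
  shows "card X = card (lin d b ` X) * card {x \<in> X. lin d b x = 0}"
  by (rule card_image_times_kernel) (use Fp_subspaceD[OF assms] in \<open>auto simp: lin_add lin_diff\<close>)

end

context heisenberg begin

context
  fixes X b
  assumes X: "Fp_subspace X" "X \<subseteq> V" and iso: "\<And>x y. x \<in> X \<Longrightarrow> y \<in> X \<Longrightarrow> \<omega> x y = 0"
    and b: "b e = 1" "\<And>x. lin e b x = 0 \<longleftrightarrow> x \<in> X" and card_X: "card X = p ^ e"
begin

text \<open>With b 0 = 0, \<open>lin e b\<close> would be the \<open>p\<close>-th power of an
  additive polynomial of degree at most p^(e-1). Vanishing on the p^e points of \<open>X\<close>,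
  that polynomial would be zero, against b e = 1.\<close>

lemma b_0: "b 0 \<noteq> 0"
proof
  assume 0: "b 0 = 0"
  have "lin e b x = lin (e - 1) (\<lambda>i. SOME y. y ^ p = b (Suc i)) x ^ p" for x
  proof -
    have root: "(SOME y. y ^ p = b (Suc i)) ^ p = b (Suc i)" for i
      using someI_ex[OF nth_root_exists[OF p_pos]] .
    have "lin e b x = (\<Sum>i\<le>Suc (e - 1). b i * x ^ (p ^ i))" using e_pos by (simp add: lin_def)
    also have "\<dots> = (\<Sum>i\<le>e - 1. b (Suc i) * x ^ (p ^ Suc i))"
      by (subst sum.atMost_Suc_shift) (simp add: 0)
    also have "\<dots> = lin (e - 1) (\<lambda>i. SOME y. y ^ p = b (Suc i)) x ^ p"
      by (simp add: lin_def frob1 power_mult_distrib root mult.commute flip: power_mult)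
    finally show ?thesis .
  qed
  then have "lin (e - 1) (\<lambda>i. SOME y. y ^ p = b (Suc i)) x = 0" if "x \<in> X" for x
    using that b(2)[of x] p_pos by simp
  moreover have "card X > p ^ (e - 1)" using card_X p_gt_1 e_pos by simp
  ultimately have "(SOME y. y ^ p = b (Suc i)) = 0" if "i \<le> e - 1" for i
    using lin_eq_0[OF Fp_subspaceD(1)[OF X(1)]] that by blast
  then have "(SOME y. y ^ p = b (Suc (e - 1))) = 0" by simp
  then have "(0::'a) ^ p = b (Suc (e - 1))"
    using someI_ex[OF nth_root_exists[OF p_pos, of "b (Suc (e - 1))"]] by metis
  then show False using b(1) e_pos p_pos by (simp add: power_0_left)
qed

text \<open>Right division of the additive polynomial \<open>E\<close> by \<open>lin e b\<close>: the quotient vanishes on the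
  image of \<open>V\<close>.\<close>

lemma E_factor: "\<exists>l. (\<forall>x. E x = lin e l (lin e b x)) \<and> l 0 * b 0 = a e"
proof -
  define W where "W = lin e b ` V"
  have W: "Fp_subspace W" unfolding W_def by (rule Fp_subspace_lin_image[OF Fp_subspace_V])
  have "{x \<in> V. lin e b x = 0} = X" using b(2) X(2) by auto
  then have "card W * p ^ e = p ^ (2 * e)"
    using card_lin_image[OF Fp_subspace_V, of e b] card_V card_X by (simp add: W_def)
  also have "\<dots> = p ^ e * p ^ e" by (simp add: mult_2 power_add)
  finally have "card W = p ^ e" using p_pos by (simp del: p_pos)
  then obtain l where l: "l e = 1" "\<And>x. lin e l x = 0 \<longleftrightarrow> x \<in> W"
    using vanishing_lin[OF W] by blast
  \<comment> \<open>The leading coefficient of \<open>E\<close>; the quotient is \<open>c\<close>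
    times the monic vanishing polynomial of \<open>W\<close>.\<close>
  define c where "c = a e ^ (p ^ e)"
  define P where "P = smult c (pcompose (lin_poly e l) (lin_poly e b))"
  have degs: "degree (lin_poly e l) = p ^ e" "degree (lin_poly e b) = p ^ e"
    using l b by (simp_all add: degree_lin_poly)
  have dP: "degree P = p ^ (2 * e)"
    using a_e by (simp add: P_def c_def degree_pcompose degs mult_2 power_add)
  have "lead_coeff P = c"
    unfolding P_def lead_coeff_smult using p_pos
    by (subst lead_coeff_comp) (simp_all add: degs coeff_lin_poly l b)
  then have lcP: "coeff P (p ^ (2 * e)) = c" using dP by simp
  \<comment> \<open>Equal coefficients in degree p^(2e) and equal values at the p^(2e) points of
    \<open>V\<close> suffice.\<close>
  have "lin_poly (2 * e) E_coeff = P"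
  proof (rule poly_eq_of_agree[OF degree_lin_poly_le _ _ _ finite_V])
    show "poly (lin_poly (2 * e) E_coeff) x = poly P x" if "x \<in> V" for x
    proof -
      have "lin e l (lin e b x) = 0" using l(2) that by (auto simp: W_def)
      moreover have "E x = 0" using that by (simp add: V_R_def)
      ultimately show ?thesis by (simp add: P_def poly_pcompose E_lin[symmetric])
    qed
  qed (use lcP in \<open>simp_all add: dP card_V coeff_lin_poly E_coeff_top c_def\<close>)
  then have eq: "lin (2 * e) E_coeff x = c * lin e l (lin e b x)" for x
    by (metis P_def poly_lin_poly poly_pcompose poly_smult)
  \<comment> \<open>Comparing derivatives compares the coefficients of x, which gives the value of
    \<open>l 0 * b 0\<close>.\<close>
  have "pderiv (lin_poly (2 * e) E_coeff) = pderiv P" using \<open>_ = P\<close> by simp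
  then have "[:a e:] = [:c * l 0 * b 0:]"
    by (simp add: P_def pderiv_smult pderiv_pcompose pderiv_lin_poly E_coeff_0 pcompose_pCons mult.assoc)
  then have "c * l 0 * b 0 = a e" by simp
  moreover have "c * lin e l y = lin e (\<lambda>i. c * l i) y" for y by (simp add: lin_def sum_distrib_left mult.assoc)
  ultimately show ?thesis using eq by (intro exI[of _ "\<lambda>i. c * l i"]) (simp add: E_lin)
qed

text \<open>Up to \<open>h ^ p - h\<close> the bilinear form \<open>x R y + y R x\<close> is \<open>G x * lin e b y\<close>. Its symmetry
  forces \<open>G\<close> to vanish on \<open>X\<close>, so that \<open>G\<close> is a multiple of \<open>lin e b\<close>.\<close>

lemma form_modulo_AS:
  shows "\<exists>g. \<forall>x. x * R x + x * R x - g e * (lin e b x)\<^sup>2 =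
      (f x x + (\<Sum>i\<le>e. \<Sum>j<e - i. (x ^ (p ^ i) * (g e * b i) * lin e b x) ^ (p ^ j))) ^ p -
      (f x x + (\<Sum>i\<le>e. \<Sum>j<e - i. (x ^ (p ^ i) * (g e * b i) * lin e b x) ^ (p ^ j))) \<and> g e = a e / b 0"
proof -
  let ?F = "lin e b"
  obtain l where l: "\<And>x. E x = lin e l (?F x)" "l 0 * b 0 = a e" using E_factor by blast
  \<comment> \<open>The adjoint of the quotient. Taking p^(e-i)-th roots of its coefficients moves
    the Frobenius from F(y) to x: (x^(p^i) g_i F(y))^(p^(e-i)) is the term x^(p^e) l_(e-i)
    F(y)^(p^(e-i)) of x^(p^e) E(y).\<close>
  define g where "g i = (SOME y. y ^ (p ^ (e - i)) = l (e - i))" for i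
  have g: "g i ^ (p ^ (e - i)) = l (e - i)" for i
    unfolding g_def by (rule someI_ex[OF frob_root])
  have ge: "g e = a e / b 0" using g[of e] l(2) b_0 by (simp add: field_simps)
  define G where "G = lin e g"
  define k where "k x y = (\<Sum>i\<le>e. \<Sum>j<e - i. (x ^ (p ^ i) * g i * ?F y) ^ (p ^ j))" for x y
  have k_AS: "k x y ^ p - k x y = x ^ (p ^ e) * E y - G x * ?F y" for x y
  proof -
    have "k x y ^ p - k x y = (\<Sum>i\<le>e. (x ^ (p ^ i) * g i * ?F y) ^ (p ^ (e - i)) - x ^ (p ^ i) * g i * ?F y)"
      unfolding k_def frob1(2) sum_subtractf[symmetric]
      by (simp only: AS_telescope frob1(2)[symmetric] sum_subtractf)
    also have "(\<Sum>i\<le>e. (x ^ (p ^ i) * g i * ?F y) ^ (p ^ (e - i)) - x ^ (p ^ i) * g i * ?F y) =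
        (\<Sum>i\<le>e. x ^ (p ^ e) * (l (e - i) * ?F y ^ (p ^ (e - i)))) - G x * ?F y"
    proof -
      have "(x ^ (p ^ i) * g i * t) ^ (p ^ (e - i)) = x ^ (p ^ e) * (l (e - i) * t ^ (p ^ (e - i)))"
        if "i \<le> e" for i t
        using that by (simp add: power_mult_distrib g flip: power_mult power_add)
      then have "(\<Sum>i\<le>e. (x ^ (p ^ i) * g i * ?F y) ^ (p ^ (e - i))) =
          (\<Sum>i\<le>e. x ^ (p ^ e) * (l (e - i) * ?F y ^ (p ^ (e - i))))"
        by (intro sum.cong) auto
      moreover have "(\<Sum>i\<le>e. x ^ (p ^ i) * g i * ?F y) = G x * ?F y"
        unfolding G_def lin_def[of e g] sum_distrib_right
        by (intro sum.cong refl) (simp only: mult.commute[of "g _"])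
      ultimately show ?thesis by (simp only: sum_subtractf)
    qed
    also have "(\<Sum>i\<le>e. x ^ (p ^ e) * (l (e - i) * ?F y ^ (p ^ (e - i)))) = x ^ (p ^ e) * E y"
      unfolding l(1) lin_def sum_distrib_left
      by (rule sum.reindex_bij_witness[where i = "\<lambda>k. e - k" and j = "\<lambda>k. e - k"]) auto
    finally show ?thesis .
  qed
  define h where "h x y = f x y + k x y" for x y
  have h_AS: "h x y ^ p - h x y = x * R y + y * R x - G x * ?F y" for x y
  proof -
    have "h x y ^ p - h x y = (f x y ^ p - f x y) + (k x y ^ p - k x y)" by (simp add: h_def frob1)
    then show ?thesis by (simp add: f_AS k_AS)
  qed
  have k0: "k x \<alpha> = 0" if "\<alpha> \<in> X" for x \<alpha>
    using b(2)[of \<alpha>] that by (simp add: k_def)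
  have G0: "G \<alpha> = 0" if \<alpha>: "\<alpha> \<in> X" for \<alpha>
  proof (rule ccontr)
    assume ne: "G \<alpha> \<noteq> 0"
    \<comment> \<open>By symmetry of the polar form u^p - u = G(\<alpha>) F(x), so \<open>u\<close>
      is not constant and takes the value 1 somewhere. At such a point F = 0, so it lies in
      \<open>X\<close>; but on \<open>X\<close> isotropy makes \<open>u\<close> vanish.\<close>
    define u where "u x = h x \<alpha> - h \<alpha> x" for x
    have u_AS: "u x ^ p - u x = G \<alpha> * ?F x" for x
    proof -
      have "u x ^ p - u x = (h x \<alpha> ^ p - h x \<alpha>) - (h \<alpha> x ^ p - h \<alpha> x)" by (simp add: u_def frob1)
      also have "\<dots> = G \<alpha> * ?F x - G x * ?F \<alpha>" by (simp add: h_AS algebra_simps)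
      finally show ?thesis using b(2)[of \<alpha>] \<alpha> by simp
    qed
    have u0: "u x = 0" if "x \<in> X" for x
      using iso[OF that \<alpha>] k0[OF \<alpha>] k0[OF that] by (simp add: u_def h_def \<omega>_def)
    have "u = (\<lambda>x. \<omega> x \<alpha> - k \<alpha> x)" using k0[OF \<alpha>] by (simp add: fun_eq_iff u_def h_def \<omega>_def)
    moreover have "poly_fun (\<lambda>x. \<omega> x \<alpha> - k \<alpha> x)"
      unfolding k_def by (intro poly_fun_intros poly_fun_sum poly_fun_\<omega> poly_fun_lin)
    ultimately have pu: "poly_fun u" by simp
    obtain x where "x \<notin> X" using Fp_subspaceD(1)[OF X(1)] infinite_UNIV_a by (metis ex_new_if_finite)
    then have "u x \<noteq> u 0" using u_AS[of x] ne b(2)[of x] u0[of 0] Fp_subspaceD(2)[OF X(1)] p_pos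
      by (auto simp: power_0_left simp del: p_pos)
    then obtain z where z: "u z = 1" using poly_fun_surj[OF pu] by blast
    then have "z \<in> X" using u_AS[of z] ne b(2)[of z] by simp
    then show False using u0 z by simp
  qed
  \<comment> \<open>Both sides vanish on the p^e points of \<open>X\<close> and have the same
    coefficient in degree p^e.\<close>
  have "lin_poly e g = smult (g e) (lin_poly e b)"
  proof (rule poly_eq_of_agree[OF degree_lin_poly_le _ _ _ Fp_subspaceD(1)[OF X(1)]])
    show "degree (smult (g e) (lin_poly e b)) \<le> p ^ e"
      using degree_lin_poly_le degree_smult_le order.trans by blast
    show "poly (lin_poly e g) x = poly (smult (g e) (lin_poly e b)) x" if "x \<in> X" for x
      using G0[OF that] b(2)[of x] that by (simp add: G_def)
  qed (simp_all add: coeff_lin_poly b(1) card_X)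
  then have gi: "g i = g e * b i" if "i \<le> e" for i
    using that coeff_lin_poly[of e g i] coeff_lin_poly[of e b i] by simp
  have "G x = g e * ?F x" for x unfolding G_def lin_def sum_distrib_left
  proof (intro sum.cong refl)
    fix i assume "i \<in> {..e}"
    then have "g i = g e * b i" by (intro gi) simp
    then show "g i * x ^ (p ^ i) = g e * (b i * x ^ (p ^ i))" by (simp only: mult.assoc)
  qed
  then have "x * R x + x * R x - g e * (?F x)\<^sup>2 = h x x ^ p - h x x" for x
    by (simp add: h_AS power2_eq_square)
  \<comment> \<open>The roots \<open>g i\<close> were chosen in the algebraic closure. Rewritten as
    \<open>g e * b i\<close>, they exhibit the primitive over every field containing the
    coefficients of \<open>R\<close> and of \<open>lin e b\<close>, as the trace argument
    requires.\<close>
  moreover have "h x x = f x x + (\<Sum>i\<le>e. \<Sum>j<e - i. (x ^ (p ^ i) * (g e * b i) * ?F x) ^ (p ^ j))" for x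
    unfolding h_def k_def
  proof (intro arg_cong2[where f = "(+)"] sum.cong refl)
    fix i j assume "i \<in> {..e}"
    then have "g i = g e * b i" by (intro gi) simp
    then show "(x ^ (p ^ i) * g i * ?F x) ^ (p ^ j) = (x ^ (p ^ i) * (g e * b i) * ?F x) ^ (p ^ j)"
      by (simp only:)
  qed
  ultimately show ?thesis using ge by (intro exI[of _ g]) simp
qed

text \<open>The primitive from \<open>form_modulo_AS\<close> stays in F_(p^M), where h^p - h has
  trace 0. The factor 2 comes from setting y = x in the polar form.\<close>

lemma trace_form:
  assumes M: "M \<ge> 1" and aF: "\<And>i. i \<le> e \<Longrightarrow> a i \<in> Fq (p ^ M)" and bF: "\<And>i. i \<le> e \<Longrightarrow> b i \<in> Fq (p ^ M)"
    and x: "x \<in> Fq (p ^ M)"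
  shows "2 * Tr p M (x * R x) = Tr p M (a e / b 0 * (lin e b x)\<^sup>2)"
proof -
  obtain g where g: "g e = a e / b 0" and eq: "x * R x + x * R x - g e * (lin e b x)\<^sup>2 =
      (f x x + (\<Sum>i\<le>e. \<Sum>j<e - i. (x ^ (p ^ i) * (g e * b i) * lin e b x) ^ (p ^ j))) ^ p -
      (f x x + (\<Sum>i\<le>e. \<Sum>j<e - i. (x ^ (p ^ i) * (g e * b i) * lin e b x) ^ (p ^ j)))"
    using form_modulo_AS by blast
  define h where "h = f x x + (\<Sum>i\<le>e. \<Sum>j<e - i. (x ^ (p ^ i) * (g e * b i) * lin e b x) ^ (p ^ j))"
  have "g e \<in> Fq (p ^ M)" unfolding g by (intro Fq_closed aF bF) auto
  then have "h \<in> Fq (p ^ M)"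
    unfolding h_def f_R_def poly_R_poly R_def lin_def
    by (intro Fq_closed Fq_sum aF bF x) auto
  then have "Tr p M (h ^ p - h) = 0" by (simp add: Tr_diff Tr_frob)
  then have "Tr p M (x * R x + x * R x - g e * (lin e b x)\<^sup>2) = 0" unfolding eq h_def .
  then have "Tr p M (x * R x) + Tr p M (x * R x) - Tr p M (g e * (lin e b x)\<^sup>2) = 0"
    by (simp only: Tr_diff Tr_add)
  then show ?thesis unfolding g mult_2 by (simp only: right_minus_eq)
qed

end

end

section \<open>Descent of the condition to F_q, and the count of trace zeros\<close>

context char_power begin

lemma lin_frob:
  assumes "\<And>i. i \<le> d \<Longrightarrow> c i \<in> Fq (p ^ m)"
  shows "lin d c x ^ (p ^ m) = lin d c (x ^ (p ^ m))"
proof -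
  have "lin d c x ^ (p ^ m) = (\<Sum>i\<le>d. c i ^ (p ^ m) * x ^ (p ^ i * p ^ m))"
    by (simp add: lin_def frob_sum power_mult_distrib flip: power_mult)
  also have "\<dots> = (\<Sum>i\<le>d. c i * x ^ (p ^ m * p ^ i))"
    using assms by (intro sum.cong) (auto simp: Fq_def mult.commute)
  finally show ?thesis by (simp add: lin_def power_mult)
qed

lemma lin_in_Fq: "(\<And>i. i \<le> d \<Longrightarrow> c i \<in> Fq (p ^ m)) \<Longrightarrow> x \<in> Fq (p ^ m) \<Longrightarrow> lin d c x \<in> Fq (p ^ m)"
  using lin_frob[of d c m x] by (simp add: Fq_def)

lemma relative_trace_in_Fq:
  assumes "(x::'a) \<in> Fq (p ^ (m * k))"
  shows "Tr (p ^ m) k x \<in> Fq (p ^ m)"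
proof -
  have "Tr (p ^ m) k x ^ (p ^ m) = (\<Sum>i<k. x ^ ((p ^ m) ^ Suc i))"
    unfolding Tr_def frob_sum power_mult[symmetric] power_Suc by (simp only: mult.commute)
  also have "\<dots> + x = (\<Sum>i<Suc k. x ^ ((p ^ m) ^ i))"
    by (subst sum.lessThan_Suc_shift) simp
  also have "\<dots> = Tr (p ^ m) k x + x"
    using assms by (simp add: Tr_def Fq_def power_mult)
  finally show ?thesis by (simp add: Fq_def)
qed

text \<open>An additive polynomial over F_(p^m) commutes with the p^m-power map, hence with the
  relative trace, a sum of iterates of that map.\<close>

lemma relative_trace_lin:
  assumes "\<And>i. i \<le> d \<Longrightarrow> c i \<in> Fq (p ^ m)"
  shows "Tr (p ^ m) k (lin d c x) = lin d c (Tr (p ^ m) k x)"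
proof -
  have "lin d c x ^ ((p ^ m) ^ j) = lin d c (x ^ ((p ^ m) ^ j))" for j
  proof -
    have "c i \<in> Fq (p ^ (m * j))" if "i \<le> d" for i using assms[OF that] Fq_mono by blast
    then show ?thesis using lin_frob[of d c "m * j" x] by (simp add: power_mult)
  qed
  moreover have "(\<Sum>j<k. lin d c (y j)) = lin d c (\<Sum>j<k. y j)" for y
    by (induction k) (simp_all add: lin_add)
  ultimately show ?thesis by (simp add: Tr_def)
qed

lemma relative_trace_scale:
  assumes "(l::'a) \<in> Fq (p ^ m)"
  shows "Tr (p ^ m) k (l * x) = l * Tr (p ^ m) k x"
proof -
  have "l ^ ((p ^ m) ^ j) = l" for j
    using subsetD[OF Fq_mono[of m j] assms] by (simp add: Fq_def power_mult)
  then show ?thesis by (simp add: Tr_def power_mult_distrib sum_distrib_left)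
qed

lemma Tr_of_subfield:
  assumes "z \<in> Fq (p ^ m)" "Tr p m z = 0"
  shows "Tr p (m * k) (z::'a) = 0"
proof -
  have "Tr p m (of_nat k * z) = 0" by (induction k) (simp_all add: distrib_right Tr_add assms(2))
  moreover have "Tr (p ^ m) k z = of_nat k * z"
    using relative_trace_scale[OF assms(1), of k 1] by (simp add: Tr_def mult.commute)
  ultimately show ?thesis by (simp add: Tr_comp)
qed

end

context heisenberg begin

lemma poly_fun_finite_range:
  assumes "poly_fun g" "finite Y" "\<And>x. g x \<in> Y"
  shows "g x = g y"
proof (rule ccontr)
  assume ne: "g x \<noteq> g y"
  obtain t where "t \<notin> Y" using assms(2) infinite_UNIV_a by (metis ex_new_if_finite)
  then show False using poly_fun_surj[OF assms(1) ne, of t] assms(3) by metis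
qed

text \<open>The kernel of a(x) is F_A(F_q). The vanishing polynomial of this image, composed with
  F_A, is x^q - x by degree and roots. That the two factors may be interchanged and that a(x) is
  unique both rest on one fact: a polynomial function with values in a finite set is
  constant.\<close>

lemma roots_a_poly:
  assumes X: "Fp_subspace (fst ` A)" "fst ` A \<subseteq> Fq (p ^ m)" and m: "m \<ge> 1"
    and b: "b d = 1" "F_A A = lin_poly d b" "\<And>x. lin d b x = 0 \<longleftrightarrow> x \<in> fst ` A"
  shows "poly (a_poly p (p ^ m) A) t = 0 \<longleftrightarrow> t \<in> lin d b ` Fq (p ^ m)"
proof -
  define W where "W = lin d b ` Fq (p ^ m)"
  have bF: "b i \<in> Fq (p ^ m)" if "i \<le> d" for i
    using coeff_vanishing_in_Fq[OF X(2), of "p ^ i"] that coeff_lin_poly[of d b i] b(2) by (simp add: F_A_def)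
  have W: "Fp_subspace W" unfolding W_def by (rule Fp_subspace_lin_image[OF Fp_subspace_Fq[OF m]])
  have WF: "W \<subseteq> Fq (p ^ m)" using lin_in_Fq bF by (auto simp: W_def)
  obtain d' c where c: "card W = p ^ d'" "c d' = 1" "(\<Prod>\<alpha>\<in>W. [:- \<alpha>, 1:]) = lin_poly d' c"
      "\<And>x. lin d' c x = 0 \<longleftrightarrow> x \<in> W"
    using subspace_vanishing_lin[OF W] vanishing_lin[OF W] by metis
  have cF: "c i \<in> Fq (p ^ m)" if "i \<le> d'" for i
    using coeff_vanishing_in_Fq[OF WF, of "p ^ i"] that coeff_lin_poly[of d' c i] c(3) by simp
  define q where "q = p ^ m"
  have q: "q > 1" unfolding q_def using p_gt_1 m by (intro one_less_power) auto
  have cX: "card (fst ` A) = p ^ d"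
    using arg_cong[OF b(2), of degree] degree_lin_poly[of b d] b(1)
    unfolding F_A_def by (subst (asm) degree_prod_eq_sum_degree) auto
  have "{x \<in> Fq (p ^ m). lin d b x = 0} = fst ` A" using X(2) b(3) by auto
  then have q_eq: "q = p ^ d' * p ^ d"
    using card_lin_image[OF Fp_subspace_Fq[OF m], of d b] c(1) cX card_Fq[OF m] by (simp add: q_def W_def)
  have degs: "degree (lin_poly d b) = p ^ d" "degree (lin_poly d' c) = p ^ d'"
    using b c by (simp_all add: degree_lin_poly)
  have AS: "degree (monom 1 q - monom (1::'a) 1) = q" "coeff (monom 1 q - monom (1::'a) 1) q = 1"
  proof -
    show "degree (monom 1 q - monom (1::'a) 1) = q" unfolding diff_conv_add_uminus
      by (subst degree_add_eq_left) (use q in \<open>auto simp: degree_monom_eq\<close>)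
    show "coeff (monom 1 q - monom (1::'a) 1) q = 1" using q by simp
  qed
  have comp1: "pcompose (lin_poly d' c) (lin_poly d b) = monom 1 q - monom 1 1"
  proof (rule poly_eq_of_agree[OF _ _ _ _ finite_Fq[OF m]])
    show "degree (pcompose (lin_poly d' c) (lin_poly d b)) \<le> q" by (simp add: degree_pcompose degs q_eq)
    have "lead_coeff (pcompose (lin_poly d' c) (lin_poly d b)) = 1"
      using p_pos by (subst lead_coeff_comp) (simp_all add: degs coeff_lin_poly b c del: p_pos)
    then show "coeff (pcompose (lin_poly d' c) (lin_poly d b)) q = coeff (monom 1 q - monom 1 1) q"
      unfolding AS(2) by (simp add: degree_pcompose degs flip: q_eq)
    show "poly (pcompose (lin_poly d' c) (lin_poly d b)) x = poly (monom 1 q - monom 1 1) x"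
      if "x \<in> Fq (p ^ m)" for x
      using that c(4)[of "lin d b x"] by (auto simp: poly_pcompose poly_monom W_def Fq_def q_def)
  qed (use q AS card_Fq[OF m] in \<open>auto simp: q_def\<close>)
  have cb: "lin d' c (lin d b x) = x ^ q - x" for x
    using arg_cong[OF comp1, of "\<lambda>P. poly P x"] by (simp add: poly_pcompose poly_monom)
  \<comment> \<open>Write F for \<open>lin d b\<close> and C for \<open>lin d' c\<close>. Then
    C(F(C(x))) = C(x)^q - C(x) = C(x^q - x), because C has coefficients in F_q; so the difference
    \<open>g\<close> takes values in the kernel \<open>W\<close> of C.\<close>
  have bc: "lin d b (lin d' c x) = x ^ q - x" for x
  proof -
    define g where "g x = lin d b (lin d' c x) - (x ^ q - x)" for x
    have "lin d' c (g x) = 0" for x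
      using lin_frob[of d' c m x] cF by (simp add: g_def lin_diff cb q_def)
    then have "g x \<in> W" for x using c(4) by blast
    moreover have "g = poly (pcompose (lin_poly d b) (lin_poly d' c) - (monom 1 q - monom 1 1))"
      by (simp add: fun_eq_iff g_def poly_pcompose poly_monom)
    then have "poly_fun g" unfolding poly_fun_def by blast
    ultimately have "g x = g 0" using poly_fun_finite_range Fp_subspaceD(1)[OF W] by blast
    also have "g 0 = 0" using q by (simp add: g_def)
    finally show ?thesis by (simp add: g_def)
  qed
  have "a_poly p (p ^ m) A = lin_poly d' c"
    unfolding a_poly_def q_def[symmetric] b(2)
  proof (rule the_equality)
    have "coeff (lin_poly d' c) n \<in> Fq q" for n
      using coeff_vanishing_in_Fq[OF WF, of n] c(3) by (simp add: q_def)
    moreover have "pcompose (lin_poly d b) (lin_poly d' c) = monom 1 q - monom 1 1"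
      by (rule poly_ext) (simp add: poly_pcompose poly_monom bc)
    ultimately show "p_linearized p (lin_poly d' c) \<and> (\<forall>n. coeff (lin_poly d' c) n \<in> Fq q) \<and>
        pcompose (lin_poly d b) (lin_poly d' c) = monom 1 q - monom 1 1"
      using p_linearized_lin_poly by blast
  next
    fix P assume P: "p_linearized p P \<and> (\<forall>n. coeff P n \<in> Fq q) \<and>
      pcompose (lin_poly d b) P = monom 1 q - monom 1 1"
    have "lin d b (poly P x) = x ^ q - x" for x
      using arg_cong[of _ _ "\<lambda>P. poly P x", OF conjunct2[OF conjunct2[OF P]]] by (simp add: poly_pcompose poly_monom)
    then have "poly P x - lin d' c x \<in> fst ` A" for x
      using b(3)[of "poly P x - lin d' c x"] by (simp add: lin_diff bc)
    moreover have "poly_fun (\<lambda>x. poly P x - lin d' c x)"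
      by (intro poly_fun_intros poly_fun_lin) (auto simp: poly_fun_def)
    ultimately have "poly P x - lin d' c x = poly P 0 - lin d' c 0" for x
      using poly_fun_finite_range[of "\<lambda>x. poly P x - lin d' c x"] Fp_subspaceD(1)[OF X(1)] by blast
    \<comment> \<open>A linearized polynomial has no constant term, 0 not being a power of
      \<open>p\<close>.\<close>
    moreover have "poly P 0 = 0"
    proof (rule ccontr)
      assume "poly P 0 \<noteq> 0"
      then obtain i where "0 = p ^ i" using P unfolding p_linearized_def by (metis poly_0_coeff_0)
      then show False using p_pos by simp
    qed
    ultimately show "P = lin_poly d' c" by (intro poly_ext) simp
  qed
  then show ?thesis using c(4) by (simp add: W_def)
qed

text \<open>With r = q^k the field F_(r^2) is a quadratic extension of a field containing c, as
  \<open>card_quadratic_trace_zeros\<close> demands. The form depends on L(x) alone, which reduces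
  the count to \<open>W M\<close>, and \<open>card_isotropic_subspace\<close> compares
  \<open>W M\<close> with the whole field.\<close>

theorem card_trace_zeros:
  assumes odd: "odd p" and m: "m \<ge> 1" and aF: "\<And>i. i \<le> e \<Longrightarrow> a i \<in> Fq (p ^ m)"
    and maxA: "maximal_abelian_subgroup H A" and AF: "A \<subseteq> Fq (p ^ m) \<times> Fq (p ^ m)"
    and star: "condition_star p m e a A" and k: "k \<ge> 1"
  defines "r \<equiv> p ^ (m * k)"
  defines "N \<equiv> card {x \<in> Fq (r\<^sup>2). Tr p (m * k * 2) (x * R x) = 0}"
  shows "(r mod 4 = 1 \<longrightarrow> p * N + r * (p - 1) * p ^ e = r\<^sup>2) \<and>
    (r mod 4 = 3 \<longrightarrow> p * N = r\<^sup>2 + r * (p - 1) * p ^ e)"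
proof -
  define X where "X = fst ` A"
  have X: "Fp_subspace X" "card X = p ^ e" "X \<subseteq> V" "\<And>x y. x \<in> X \<Longrightarrow> y \<in> X \<Longrightarrow> \<omega> x y = 0"
    using Fp_subspace_Abar[OF maxA] card_Abar[OF maxA] Abar_closed[OF maxA] by (auto simp: X_def)
  have XF: "X \<subseteq> Fq (p ^ m)" using AF by (auto simp: X_def)
  obtain b where b: "b e = 1" "F_A A = lin_poly e b" "\<And>x. lin e b x = 0 \<longleftrightarrow> x \<in> X"
    using vanishing_lin[OF X(1,2)] by (metis F_A_def X_def)
  have bF: "b i \<in> Fq (p ^ m)" if "i \<le> e" for i
    using coeff_vanishing_in_Fq[OF XF, of "p ^ i"] that coeff_lin_poly[of e b i] b(2) by (simp add: F_A_def X_def)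
  have b0: "b 0 \<noteq> 0" by (rule b_0[of X]) (use X b in auto)
  define M where "M = m * k * 2"
  have M: "M \<ge> 1" "m * (k * 2) = M" "m * k \<ge> 1" using m k by (auto simp: M_def Suc_le_eq)
  have r2: "r\<^sup>2 = p ^ M" by (simp add: r_def M_def power_mult)
  define L where "L = lin e b"
  have mM: "Fq (p ^ m) \<subseteq> (Fq (p ^ M) :: 'a set)" using Fq_mono[of m "k * 2"] M by simp
  have mr: "Fq (p ^ m) \<subseteq> (Fq (p ^ (m * k)) :: 'a set)" by (rule Fq_mono)
  have two: "(2::'a) \<noteq> 0" by (rule two_nonzero[OF odd])
  \<comment> \<open>\<open>c_A\<close> without its sign.\<close>
  define c where "c = a e / (2 * b 0)"
  have "(2::'a) \<in> Fq (p ^ m)" using Fq_closed(3)[OF Fq_closed(2,2)] by simp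
  then have cF: "c \<in> Fq (p ^ m)" unfolding c_def by (intro Fq_closed aF bF) auto
  have c0: "c \<noteq> 0" using a_e b0 two by (simp add: c_def)
  have form: "Tr p M (x * R x) = Tr p M (c * (L x)\<^sup>2)" if "x \<in> Fq (p ^ M)" for x
  proof -
    have "2 * Tr p M (x * R x) = Tr p M (a e / b 0 * (lin e b x)\<^sup>2)"
      by (rule trace_form[of X]) (use X b M(1) subsetD[OF mM aF] subsetD[OF mM bF] that in auto)
    also have "a e / b 0 * (lin e b x)\<^sup>2 = c * (L x)\<^sup>2 + c * (L x)\<^sup>2"
      using two b0 by (simp add: c_def L_def field_simps)
    also have "Tr p M \<dots> = 2 * Tr p M (c * (L x)\<^sup>2)" by (simp only: Tr_add mult_2)
    finally show ?thesis using two by (simp only: mult_cancel_left) simp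
  qed
  define W where "W n = L ` Fq (p ^ n)" for n
  have W: "Fp_subspace (W n)" if "n \<ge> 1" for n
    unfolding W_def L_def by (rule Fp_subspace_lin_image[OF Fp_subspace_Fq[OF that]])
  have ker: "{x \<in> Fq (p ^ n). L x = 0} = X" if "Fq (p ^ m) \<subseteq> (Fq (p ^ n) :: 'a set)" for n
    using b(3) XF that by (auto simp: L_def)
  have card_W: "card (W n) * p ^ e = p ^ n" if "n \<ge> 1" "Fq (p ^ m) \<subseteq> (Fq (p ^ n) :: 'a set)" for n
    using card_lin_image[OF Fp_subspace_Fq[OF that(1)], of e b] ker[OF that(2)] X(2) card_Fq[OF that(1)]
    by (simp add: W_def L_def)
  have WF: "W n \<subseteq> Fq (p ^ n)" if "Fq (p ^ m) \<subseteq> (Fq (p ^ n) :: 'a set)" for n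
    unfolding W_def L_def using lin_in_Fq[of e b n] subsetD[OF that bF] by auto
  \<comment> \<open>The factor 1 matches the shape of \<open>card_trace_perp\<close>. The size p^e
    of this complement is the same for all fields considered.\<close>
  define P where "P n = {l \<in> Fq (p ^ n). \<forall>w\<in>W n. Tr p n (1 * l * w) = 0}" for n
  have card_P: "card (P n) = p ^ e" if n: "n \<ge> 1" "Fq (p ^ m) \<subseteq> (Fq (p ^ n) :: 'a set)" for n
  proof -
    have "card (P n) * card (W n) = p ^ n"
      unfolding P_def by (rule card_trace_perp[OF n(1) W[OF n(1)] WF[OF n(2)] Fq_closed(2)]) simp
    also have "\<dots> = p ^ e * card (W n)" using card_W[OF n] by (simp add: mult.commute)
    finally show ?thesis using Fp_subspaceD(1,2)[OF W[OF n(1)]] by auto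
  qed
  \<comment> \<open>Inclusion holds by transitivity of the trace. Equal sizes then show that the
    complement over the large field consists of elements of F_q, where \<open>condition_star\<close>
    applies.\<close>
  have "P m \<subseteq> P M"
  proof
    fix l assume l: "l \<in> P m"
    then have lF: "l \<in> Fq (p ^ m)" by (simp add: P_def)
    have "Tr p M (1 * l * L x) = 0" if x: "x \<in> Fq (p ^ M)" for x
    proof -
      have "Tr p M (1 * l * L x) = Tr p m (l * L (Tr (p ^ m) (k * 2) x))"
        unfolding M(2)[symmetric] Tr_comp L_def
        by (simp add: relative_trace_scale[OF lF] relative_trace_lin bF)
      also have "Tr (p ^ m) (k * 2) x \<in> Fq (p ^ m)" using x M(2) by (intro relative_trace_in_Fq) simp
      then have "Tr p m (l * L (Tr (p ^ m) (k * 2) x)) = 0" using l by (auto simp: P_def W_def)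
      finally show ?thesis .
    qed
    then show "l \<in> P M" using lF mM by (auto simp: P_def W_def)
  qed
  then have PM: "P m = P M"
    using card_P[OF m order.refl] card_P[OF M(1) mM] finite_subset[of "P M", OF _ finite_Fq[OF M(1)]]
    by (intro card_subset_eq) (auto simp: P_def)
  have star': "Tr p m (inverse c * l\<^sup>2) = 0" if l: "l \<in> P m" for l
  proof -
    have "c_A e a A = (- 1) ^ e * c" unfolding c_A_def c_def b(2) coeff_lin_poly_1 by simp
    then have cA: "inverse (c_A e a A) * l\<^sup>2 = inverse c * l\<^sup>2 \<or> inverse (c_A e a A) * l\<^sup>2 = - (inverse c * l\<^sup>2)"
      by (cases "even e") simp_all
    have "Tr p m (l * t) = 0" if "poly (a_poly p (p ^ m) A) t = 0" for t
    proof -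
      have "t \<in> W m"
        using that roots_a_poly[of A m b e t] X(1) XF m b by (simp add: X_def W_def L_def)
      then show ?thesis using l by (simp add: P_def)
    qed
    then have "Tr p m (inverse (c_A e a A) * l\<^sup>2) = 0"
      using star l by (simp add: condition_star_def P_def)
    then show ?thesis using cA by (auto simp: Tr_minus)
  qed
  have iso: "Tr p M (c * v\<^sup>2) = 0" if v: "v \<in> Fq (p ^ M)" "\<forall>w\<in>W M. Tr p M (c * v * w) = 0" for v
  proof -
    \<comment> \<open>Orthogonality of \<open>v\<close> to \<open>W M\<close> for Tr(c u v) says
      that \<open>c * v\<close> is in \<open>P M\<close>, and inserting l = c v turns l^2 / c into c
      v^2.\<close>
    have "c * v \<in> P M" using v subsetD[OF mM cF] by (auto simp: P_def intro: Fq_closed)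
    then have cv: "c * v \<in> P m" using PM by simp
    then have "Tr p m (inverse c * (c * v)\<^sup>2) = 0" by (rule star')
    moreover have "inverse c * (c * v)\<^sup>2 = c * v\<^sup>2" using c0 by (simp add: power2_eq_square)
    moreover have "inverse c * (c * v)\<^sup>2 \<in> Fq (p ^ m)"
    proof -
      have "c * v \<in> Fq (p ^ m)" using cv by (simp add: P_def)
      then show ?thesis by (rule Fq_closed(5)[OF Fq_closed(9)[OF cF] Fq_closed(8)])
    qed
    ultimately show ?thesis using Tr_of_subfield[of "c * v\<^sup>2" m "k * 2"] M(2) by simp
  qed
  define N0 where "N0 = card {u \<in> Fq (p ^ M). Tr p M (c * u\<^sup>2) = 0}"
  define N1 where "N1 = card {u \<in> W M. Tr p M (c * u\<^sup>2) = 0}"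
  have main: "p * N0 + card (W M) = p * N1 + r\<^sup>2"
    unfolding N0_def N1_def r2
    by (rule card_isotropic_subspace[OF two M(1) W[OF M(1)] WF[OF mM] subsetD[OF mM cF] c0 iso])
  \<comment> \<open>\<open>L\<close> maps onto \<open>W M\<close> with fibres of size p^e, the
    translates of \<open>X\<close>.\<close>
  have N: "N = p ^ e * N1"
  proof -
    let ?Y = "{x \<in> Fq (p ^ M). Tr p M (c * (L x)\<^sup>2) = 0}"
    have fin: "finite ?Y" by (rule finite_subset[OF _ finite_Fq[OF M(1)]]) auto
    have "N = card ?Y"
      unfolding N_def r2 M_def[symmetric] by (intro arg_cong[where f = card]) (auto simp: form)
    also have "\<dots> = (\<Sum>u\<in>L ` ?Y. card {x \<in> ?Y. L x = u})"
      using sum.image_gen[OF fin, of "\<lambda>_. 1::nat" L] by simp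
    also have "L ` ?Y = {u \<in> W M. Tr p M (c * u\<^sup>2) = 0}" by (auto simp: W_def)
    also have "(\<Sum>u\<in>\<dots>. card {x \<in> ?Y. L x = u}) = (\<Sum>u\<in>{u \<in> W M. Tr p M (c * u\<^sup>2) = 0}. p ^ e)"
    proof (rule sum.cong[OF refl])
      fix u assume "u \<in> {u \<in> W M. Tr p M (c * u\<^sup>2) = 0}"
      then obtain x0 where x0: "x0 \<in> Fq (p ^ M)" "u = L x0" "Tr p M (c * (L x0)\<^sup>2) = 0"
        by (auto simp: W_def)
      have "{x \<in> ?Y. L x = u} = {x \<in> Fq (p ^ M). L x = L x0}" using x0 by auto
      also have "card \<dots> = card {x \<in> Fq (p ^ M). L x = 0}"
        by (rule card_fiber_additive)
           (use x0 Fp_subspaceD[OF Fp_subspace_Fq[OF M(1)]] in \<open>auto simp: L_def lin_add lin_diff\<close>)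
      also have "\<dots> = p ^ e" using ker[OF mM] X(2) by simp
      finally show "card {x \<in> ?Y. L x = u} = p ^ e" .
    qed
    finally show ?thesis by (simp add: N1_def mult.commute)
  qed
  have cW: "p ^ e * card (W M) = r\<^sup>2" using card_W[OF M(1) mM] r2 by (simp add: mult.commute)
  have "p ^ e * (p * N0 + card (W M)) = p ^ e * (p * N1 + r\<^sup>2)" by (simp only: main)
  then have key: "p ^ e * (p * N0) + r\<^sup>2 = p * N + p ^ e * r\<^sup>2"
    unfolding distrib_left cW N by (simp only: mult.left_commute)
  have Q: "(r mod 4 = 1 \<longrightarrow> p * N0 + r * (p - 1) = r\<^sup>2) \<and> (r mod 4 = 3 \<longrightarrow> p * N0 = r\<^sup>2 + r * (p - 1))"
    using card_quadratic_trace_zeros[OF odd M(3) subsetD[OF mr cF] c0] by (simp add: N0_def r_def M_def)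
  show ?thesis
  proof (intro conjI impI)
    assume "r mod 4 = 1"
    then have "p ^ e * (p * N0) + p ^ e * (r * (p - 1)) = p ^ e * r\<^sup>2"
      using Q by (simp only: distrib_left[symmetric] simp_thms)
    then show "p * N + r * (p - 1) * p ^ e = r\<^sup>2"
      using key by (simp add: mult_ac)
  next
    assume "r mod 4 = 3"
    then have "p ^ e * (p * N0) = p ^ e * r\<^sup>2 + p ^ e * (r * (p - 1))"
      using Q by (simp only: distrib_left[symmetric] simp_thms)
    then show "p * N = r\<^sup>2 + r * (p - 1) * p ^ e"
      using key by (simp add: mult_ac)
  qed
qed

end

section \<open>From trace zeros to affine points\<close>

context char_power begin

lemma AS_iterate:
  assumes "(y::'a) ^ p - y = t"
  shows "y ^ (p ^ n) - y = Tr p n t"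
proof -
  have "Tr p n t = (\<Sum>i<n. y ^ (p ^ Suc i) - y ^ (p ^ i))"
    unfolding Tr_def assms[symmetric] frob_diff
    by (intro sum.cong refl) (simp add: mult.commute flip: power_mult)
  also have "\<dots> = y ^ (p ^ n) - y ^ (p ^ 0)" by (rule sum_lessThan_telescope)
  finally show ?thesis by simp
qed

lemma card_AS_roots: "card {y::'a. y ^ p - y = t} = p"
proof -
  define P where "P = monom 1 p - monom 1 1 - [:t:]"
  have deg: "degree P = p" unfolding P_def diff_conv_add_uminus
    by (subst degree_add_eq_left; (subst degree_add_eq_left)?) (use p_gt_1 in \<open>auto simp: degree_monom_eq\<close>)
  have "card {y. poly P y = 0} = degree P"
  proof (rule card_poly_roots_separable)
    show "P \<noteq> 0"
    proof
      assume "P = 0"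
      then show False using deg p_gt_1 by (metis degree_0 not_less_zero)
    qed
    have "pderiv P = [:-1:]"
      by (simp add: P_def pderiv_diff pderiv_monom one_pCons)
    then show "poly (pderiv P) y \<noteq> 0" for y by simp
  qed
  then show ?thesis unfolding deg by (simp add: P_def poly_monom)
qed

text \<open>Additive Hilbert 90: for any root y, y^(p^M) - y is the trace of g(x), so either all
  \<open>p\<close> roots lie in F_(p^M) or none does.\<close>

lemma card_AS_points:
  fixes g :: "'a \<Rightarrow> 'a"
  assumes M: "M \<ge> 1" and g: "\<And>x. x \<in> Fq (p ^ M) \<Longrightarrow> g x \<in> Fq (p ^ M)"
  shows "card {(x, y). x \<in> Fq (p ^ M) \<and> y \<in> Fq (p ^ M) \<and> y ^ p - y = (g x :: 'a)} =
      p * card {x \<in> Fq (p ^ M). Tr p M (g x) = 0}"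
    and "finite {(x, y). x \<in> Fq (p ^ M) \<and> y \<in> Fq (p ^ M) \<and> y ^ p - y = (g x :: 'a)}"
proof -
  let ?F = "Fq (p ^ M) :: 'a set"
  note fin = finite_Fq[OF M]
  have eq: "{(x, y). x \<in> ?F \<and> y \<in> ?F \<and> y ^ p - y = g x} = Sigma ?F (\<lambda>x. {y \<in> ?F. y ^ p - y = g x})" by auto
  show "finite {(x, y). x \<in> ?F \<and> y \<in> ?F \<and> y ^ p - y = g x}" unfolding eq using fin by auto
  have "card (Sigma ?F (\<lambda>x. {y \<in> ?F. y ^ p - y = g x})) = (\<Sum>x\<in>?F. card {y \<in> ?F. y ^ p - y = g x})"
    using fin by (intro card_SigmaI) auto
  also have "\<dots> = (\<Sum>x\<in>?F. if Tr p M (g x) = 0 then p else 0)"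
  proof (intro sum.cong refl)
    fix x assume "x \<in> ?F"
    have "{y \<in> ?F. y ^ p - y = g x} = {y. y ^ p - y = g x \<and> Tr p M (g x) = 0}"
    proof (intro Set.set_eqI)
      fix y
      show "y \<in> {y \<in> ?F. y ^ p - y = g x} \<longleftrightarrow> y \<in> {y. y ^ p - y = g x \<and> Tr p M (g x) = 0}"
        using AS_iterate[of y "g x" M] by (auto simp: Fq_def)
    qed
    then show "card {y \<in> ?F. y ^ p - y = g x} = (if Tr p M (g x) = 0 then p else 0)"
      using card_AS_roots[of "g x"] by simp
  qed
  also have "\<dots> = p * card {x \<in> ?F. Tr p M (g x) = 0}"
    using fin by (simp add: sum.If_cases Collect_conj_eq)
  finally show "card {(x, y). x \<in> ?F \<and> y \<in> ?F \<and> y ^ p - y = g x} = p * card {x \<in> ?F. Tr p M (g x) = 0}"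
    using eq by simp
qed

end

section \<open>Function fields of Artin--Schreier curves\<close>

definition is_hom :: "('a::comm_ring_1 \<Rightarrow> 'b::comm_ring_1) \<Rightarrow> bool" where
  "is_hom h \<longleftrightarrow> h 0 = 0 \<and> h 1 = 1 \<and> (\<forall>x y. h (x + y) = h x + h y) \<and> (\<forall>x y. h (x * y) = h x * h y)"

lemma is_homD:
  assumes "is_hom h"
  shows "h 0 = 0" "h 1 = 1" "h (x + y) = h x + h y" "h (x * y) = h x * h y"
    "h (- x) = - h x" "h (x - y) = h x - h y" "h (x ^ n) = h x ^ n"
proof -
  show m: "h (- x) = - h x" for x
  proof -
    have "h (x + - x) = h x + h (- x)" using assms unfolding is_hom_def by blast
    then have "h x + h (- x) = 0" using assms by (simp add: is_hom_def)
    then show ?thesis by (simp add: eq_neg_iff_add_eq_0 add.commute)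
  qed
  show "h (x - y) = h x - h y"
    using assms m[of y] unfolding is_hom_def by (metis diff_conv_add_uminus)
  show "h (x ^ n) = h x ^ n" using assms by (induction n) (auto simp: is_hom_def)
qed (use assms in \<open>auto simp: is_hom_def\<close>)

definition eval_hom :: "('a::comm_ring_1 \<Rightarrow> 'b::comm_ring_1) \<Rightarrow> 'b \<Rightarrow> 'a poly \<Rightarrow> 'b" where
  "eval_hom h X P = poly (map_poly h P) X"

lemma eval_hom_pCons: "is_hom h \<Longrightarrow> eval_hom h X (pCons c P) = h c + X * eval_hom h X P"
  by (simp add: eval_hom_def map_poly_pCons is_homD)

lemma eval_hom_0 [simp]: "eval_hom h X 0 = 0"
  by (simp add: eval_hom_def)

lemma is_hom_eval_hom:
  assumes h: "is_hom h"
  shows "is_hom (eval_hom h X)"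
proof -
  have add: "eval_hom h X (P + Q) = eval_hom h X P + eval_hom h X Q" for P Q
    by (induction P Q rule: poly_induct2) (simp_all add: eval_hom_pCons[OF h] is_homD[OF h] algebra_simps)
  have smult: "eval_hom h X (smult c Q) = h c * eval_hom h X Q" for c Q
    by (induction Q) (simp_all add: eval_hom_pCons[OF h] is_homD[OF h] algebra_simps)
  have "eval_hom h X (P * Q) = eval_hom h X P * eval_hom h X Q" for P Q
    by (induction P) (simp_all add: eval_hom_pCons[OF h] is_homD[OF h] add smult algebra_simps)
  moreover have "eval_hom h X 1 = 1"
    by (simp add: one_pCons eval_hom_pCons[OF h] is_homD[OF h])
  ultimately show ?thesis using add by (simp add: is_hom_def)
qed

lemma eval_hom_const: "is_hom h \<Longrightarrow> eval_hom h X [:c:] = h c"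
  by (simp add: eval_hom_pCons)

lemma eval_hom_monom: "is_hom h \<Longrightarrow> eval_hom h X (monom c n) = h c * X ^ n"
  by (simp add: eval_hom_def map_poly_monom poly_monom is_homD)

lemma eval_hom_sum_degree:
  assumes h: "is_hom h" and "degree P < n"
  shows "eval_hom h X P = (\<Sum>i<n. h (coeff P i) * X ^ i)"
proof -
  have "eval_hom h X P = (\<Sum>i\<le>degree P. h (coeff P i) * X ^ i)"
  proof -
    have "P = (\<Sum>i\<le>degree P. monom (coeff P i) i)" by (rule poly_as_sum_of_monoms[symmetric])
    moreover have "eval_hom h X (sum f I) = (\<Sum>i\<in>I. eval_hom h X (f i))" for f I
      by (induction I rule: infinite_finite_induct) (simp_all add: is_homD[OF is_hom_eval_hom[OF h]])
    ultimately show ?thesis by (metis (no_types, lifting) eval_hom_monom[OF h] sum.cong)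
  qed
  also have "\<dots> = (\<Sum>i<n. h (coeff P i) * X ^ i)"
    using assms(2) by (intro sum.mono_neutral_left) (auto simp: coeff_eq_0 is_homD[OF h])
  finally show ?thesis .
qed

text \<open>The description is meaningful when \<open>h\<close> kills no nonzero element: then all
  representations of a fraction give the same quotient.\<close>

definition frac_hom :: "('a::idom \<Rightarrow> 'b::field) \<Rightarrow> 'a fract \<Rightarrow> 'b" where
  "frac_hom h z = (THE w. \<exists>a b. b \<noteq> 0 \<and> z = Fract a b \<and> w = h a / h b)"

lemma frac_hom_Fract:
  assumes h: "is_hom h" "\<And>x. x \<noteq> 0 \<Longrightarrow> h x \<noteq> 0" and b: "b \<noteq> 0"
  shows "frac_hom h (Fract a b) = h a / h b"
  unfolding frac_hom_def
proof (rule the_equality)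
  fix w assume "\<exists>a' b'. b' \<noteq> 0 \<and> Fract a b = Fract a' b' \<and> w = h a' / h b'"
  then obtain a' b' where *: "b' \<noteq> 0" "Fract a b = Fract a' b'" "w = h a' / h b'" by blast
  have "h (a * b') = h (a' * b)" using * b by (simp add: eq_fract)
  then have "h a * h b' = h a' * h b" by (simp only: is_homD[OF h(1)])
  then show "w = h a / h b"
    unfolding *(3) using h(2)[OF b] h(2)[OF *(1)] by (simp add: frac_eq_eq)
qed (use b in blast)

lemma is_hom_frac_hom:
  assumes h: "is_hom h" "\<And>x. x \<noteq> 0 \<Longrightarrow> h x \<noteq> 0"
  shows "is_hom (frac_hom h)"
proof -
  note Fr = frac_hom_Fract[OF h]
  have "frac_hom h 0 = 0" "frac_hom h 1 = 1"
    using Fr[of 1 0] Fr[of 1 1] by (simp_all add: fract_collapse is_homD[OF h(1)])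
  moreover have "frac_hom h (x + y) = frac_hom h x + frac_hom h y"
    "frac_hom h (x * y) = frac_hom h x * frac_hom h y" for x y
  proof -
    obtain a b where x: "x = Fract a b" "b \<noteq> 0" by (cases x) auto
    obtain c d where y: "y = Fract c d" "d \<noteq> 0" by (cases y) auto
    show "frac_hom h (x + y) = frac_hom h x + frac_hom h y"
      "frac_hom h (x * y) = frac_hom h x * frac_hom h y"
      using x y h(2)[OF x(2)] h(2)[OF y(2)]
      by (simp_all add: Fr is_homD[OF h(1)] add_frac_eq mult.commute)
  qed
  ultimately show ?thesis by (simp add: is_hom_def)
qed

lemma frac_hom_to_fract: "is_hom h \<Longrightarrow> (\<And>x. x \<noteq> 0 \<Longrightarrow> h x \<noteq> 0) \<Longrightarrow> frac_hom h (to_fract a) = h a"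
  using frac_hom_Fract[of h 1 a] by (simp add: to_fract_def is_homD)

definition is_subfield :: "'a::field set \<Rightarrow> bool" where
  "is_subfield S \<longleftrightarrow> 0 \<in> S \<and> 1 \<in> S \<and> (\<forall>x\<in>S. \<forall>y\<in>S. x + y \<in> S) \<and> (\<forall>x\<in>S. - x \<in> S) \<and>
     (\<forall>x\<in>S. \<forall>y\<in>S. x * y \<in> S) \<and> (\<forall>x\<in>S. inverse x \<in> S)"

lemma is_subfieldD:
  assumes "is_subfield S"
  shows "0 \<in> S" "1 \<in> S" "x \<in> S \<Longrightarrow> y \<in> S \<Longrightarrow> x + y \<in> S" "x \<in> S \<Longrightarrow> - x \<in> S"
    "x \<in> S \<Longrightarrow> y \<in> S \<Longrightarrow> x * y \<in> S" "x \<in> S \<Longrightarrow> inverse x \<in> S"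
    "x \<in> S \<Longrightarrow> y \<in> S \<Longrightarrow> x - y \<in> S" "x \<in> S \<Longrightarrow> y \<in> S \<Longrightarrow> x / y \<in> S" "x \<in> S \<Longrightarrow> x ^ n \<in> S"
proof -
  show 7: "x - y \<in> S" if "x \<in> S" "y \<in> S"
    using assms that unfolding is_subfield_def by (metis diff_conv_add_uminus)
  show "x / y \<in> S" if "x \<in> S" "y \<in> S"
    using assms that unfolding is_subfield_def divide_inverse by blast
  show "x ^ n \<in> S" if "x \<in> S"
    using assms that by (induction n) (auto simp: is_subfield_def)
qed (use assms in \<open>auto simp: is_subfield_def\<close>)

lemma is_subfield_sum: "is_subfield S \<Longrightarrow> (\<And>i. i \<in> I \<Longrightarrow> f i \<in> S) \<Longrightarrow> sum f I \<in> S"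
  by (induction I rule: infinite_finite_induct) (auto simp: is_subfieldD)

definition poly_over :: "'a::field set \<Rightarrow> 'a poly \<Rightarrow> bool" where
  "poly_over S P \<longleftrightarrow> (\<forall>n. coeff P n \<in> S)"

lemma poly_over_intros:
  assumes S: "is_subfield S"
  shows "poly_over S 0" "poly_over S 1" "poly_over S P \<Longrightarrow> poly_over S Q \<Longrightarrow> poly_over S (P + Q)"
    "poly_over S P \<Longrightarrow> poly_over S Q \<Longrightarrow> poly_over S (P - Q)" "poly_over S P \<Longrightarrow> poly_over S (- P)"
    "poly_over S P \<Longrightarrow> poly_over S Q \<Longrightarrow> poly_over S (P * Q)" "c \<in> S \<Longrightarrow> poly_over S P \<Longrightarrow> poly_over S (smult c P)"
    "c \<in> S \<Longrightarrow> poly_over S (monom c n)" "c \<in> S \<Longrightarrow> poly_over S P \<Longrightarrow> poly_over S (pCons c P)"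
    "poly_over S P \<Longrightarrow> coeff P i \<in> S"
  using is_subfieldD[OF S]
  by (auto simp: poly_over_def coeff_mult coeff_pCons coeff_1 split: nat.splits intro!: is_subfield_sum[OF S])

lemma poly_over_pConsD: "poly_over S (pCons c P) \<Longrightarrow> c \<in> S \<and> poly_over S P"
  unfolding poly_over_def by (metis coeff_pCons_0 coeff_pCons_Suc)

text \<open>Long division does not leave the coefficient field, since each step divides by the
  leading coefficient of \<open>G\<close> only.\<close>

lemma poly_over_mod:
  assumes S: "is_subfield S" and G: "poly_over S G" and P: "poly_over S P"
  shows "poly_over S (P mod G)" and "poly_over S (P div G)"
proof -
  note I = poly_over_intros[OF S]
  have "poly_over S (P mod G) \<and> poly_over S (P div G)"
    using P
  \<comment> \<open>The measure ranks the zero polynomial below the nonzero constants, whose degree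
    is 0 as well.\<close>
  proof (induction "if P = 0 then 0 else Suc (degree P)" arbitrary: P rule: less_induct)
    case less
    show ?case
    proof (cases "G = 0 \<or> P = 0 \<or> degree P < degree G")
      case True
      then show ?thesis using less.prems I(1) by (auto simp: mod_poly_less div_poly_less)
    next
      case False
      define c where "c = lead_coeff P / lead_coeff G"
      define T where "T = monom c (degree P - degree G)"
      have "c \<in> S" unfolding c_def using is_subfieldD(8)[OF S] I(10) less.prems G by blast
      then have T: "poly_over S T" unfolding T_def by (rule I(8))
      define P' where "P' = P - T * G"
      have P': "poly_over S P'" unfolding P'_def by (intro I(4) I(6) less.prems T G)
      have "degree T + degree G \<le> degree P"
        using False degree_monom_le[of c "degree P - degree G"] unfolding T_def by linarith
      then have dTG: "degree (T * G) \<le> degree P"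
        by (rule order.trans[OF degree_mult_le])
      have "coeff (T * G) (degree P) = lead_coeff P"
        using False by (simp add: T_def coeff_monom_mult c_def)
      then have "coeff P' (degree P) = 0" by (simp add: P'_def)
      moreover have "degree P' \<le> degree P" unfolding P'_def using dTG by (intro degree_diff_le) auto
      ultimately have "P' = 0 \<or> degree P' < degree P"
        by (metis le_neq_implies_less leading_coeff_0_iff)
      then have IH: "poly_over S (P' mod G) \<and> poly_over S (P' div G)"
        using less.hyps[of P'] P' False by auto
      have "P' + T * G = P" by (simp add: P'_def)
      moreover have "(P' + T * G) mod G = P' mod G" "(P' + T * G) div G = T + P' div G"
        using False by simp_all
      ultimately have "P mod G = P' mod G" "P div G = T + P' div G" by (simp_all only:)
      then show ?thesis using IH T I(3) by simp
    qed
  qed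
  then show "poly_over S (P mod G)" "poly_over S (P div G)" by auto
qed

lemma poly_over_poly: "is_subfield S \<Longrightarrow> poly_over S P \<Longrightarrow> x \<in> S \<Longrightarrow> poly P x \<in> S"
  by (simp add: poly_altdef poly_over_def is_subfield_sum is_subfieldD)

lemma is_subfield_rational_functions:
  assumes k: "is_subfield k"
  shows "is_subfield (rational_functions_over k)"
proof -
  note I = poly_over_intros[OF k]
  have mem: "z \<in> rational_functions_over k \<longleftrightarrow> (\<exists>P Q. Q \<noteq> 0 \<and> poly_over k P \<and> poly_over k Q \<and> z = Fract P Q)" for z
    by (auto simp: rational_functions_over_def poly_over_def)
  show ?thesis
    unfolding is_subfield_def
  proof (intro conjI ballI)
    show "0 \<in> rational_functions_over k" "1 \<in> rational_functions_over k"
      unfolding mem using I(1,2) by (metis one_neq_zero fract_collapse(1), metis one_neq_zero fract_collapse(2))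
  next
    fix x y assume "x \<in> rational_functions_over k" "y \<in> rational_functions_over k"
    then obtain P Q P' Q' where *: "Q \<noteq> 0" "poly_over k P" "poly_over k Q" "x = Fract P Q"
      "Q' \<noteq> 0" "poly_over k P'" "poly_over k Q'" "y = Fract P' Q'" unfolding mem by blast
    have "x + y = Fract (P * Q' + P' * Q) (Q * Q')" "x * y = Fract (P * P') (Q * Q')" "Q * Q' \<noteq> 0"
      using * by simp_all
    moreover have "poly_over k (P * Q' + P' * Q)" "poly_over k (P * P')" "poly_over k (Q * Q')"
      by (intro I(3) I(6) *)+
    ultimately show "x + y \<in> rational_functions_over k" "x * y \<in> rational_functions_over k"
      unfolding mem by blast+
  next
    fix x assume "x \<in> rational_functions_over k"
    then obtain P Q where *: "Q \<noteq> 0" "poly_over k P" "poly_over k Q" "x = Fract P Q" unfolding mem by blast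
    show "- x \<in> rational_functions_over k" unfolding mem using * I(5) by (metis minus_fract)
    show "inverse x \<in> rational_functions_over k"
    proof (cases "P = 0")
      case True
      then have "inverse x = Fract 0 1" using * by (simp add: fract_collapse)
      then show ?thesis unfolding mem using I(1,2) one_neq_zero by blast
    next
      case False
      then show ?thesis unfolding mem using * by (metis inverse_fract)
    qed
  qed
qed

lemma to_fract_in_rational_functions:
  assumes "is_subfield k" "poly_over k P"
  shows "to_fract P \<in> rational_functions_over k"
proof -
  have "to_fract P = Fract P 1" "poly_over k 1" "(1::'a poly) \<noteq> 0"
    using poly_over_intros(2)[OF assms(1)] by (simp_all add: to_fract_def)
  then show ?thesis using assms(2) unfolding rational_functions_over_def poly_over_def by blast
qed

lemma rational_functions_common_denominator:
  assumes k: "is_subfield k" and z: "\<And>i::nat. i < n \<Longrightarrow> z i \<in> rational_functions_over k"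
  shows "\<exists>D P. D \<noteq> 0 \<and> poly_over k D \<and> (\<forall>i<n. poly_over k (P i) \<and> z i * to_fract D = to_fract (P i))"
  using z
proof (induction n)
  case 0
  show ?case using poly_over_intros(2)[OF k] by (intro exI[of _ 1]) auto
next
  case (Suc n)
  note I = poly_over_intros[OF k]
  obtain D P where D: "D \<noteq> 0" "poly_over k D" "\<And>i. i < n \<Longrightarrow> poly_over k (P i) \<and> z i * to_fract D = to_fract (P i)"
    using Suc.IH Suc.prems by (metis less_Suc_eq)
  obtain A B where AB: "B \<noteq> 0" "poly_over k A" "poly_over k B" "z n = Fract A B"
    using Suc.prems[of n] by (auto simp: rational_functions_over_def poly_over_def)
  have "z n * to_fract B = to_fract A" using AB by (simp add: to_fract_def eq_fract)
  then have n: "z n * to_fract (D * B) = to_fract (D * A)" by (simp add: mult_ac)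
  have "z i * to_fract (D * B) = to_fract (P i * B)" if "i < n" for i
    using D(3)[OF that] by (simp add: mult.assoc[symmetric])
  then show ?case
    using D AB n I(6) by (intro exI[of _ "D * B"] exI[of _ "\<lambda>i. if i = n then D * A else P i * B"]) auto
qed

section \<open>The function field as a set of remainders\<close>

locale AS_curve =
  fixes p :: nat and F :: "'a::field poly" and k :: "'a set"
  assumes p_gt_1: "p > 1" and k: "is_subfield k" and F: "poly_over k F"
begin

abbreviation "G \<equiv> AS_poly p F"
abbreviation "K \<equiv> AS_function_field p F k"
abbreviation "kx \<equiv> rational_functions_over k"

definition C :: "'a poly fract poly set" where
  "C = {z. degree z < p \<and> poly_over kx z}"

definition const_K :: "'a \<Rightarrow> 'a poly fract poly" where
  "const_K c = [:to_fract [:c:]:]"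

lemmas kx = is_subfield_rational_functions[OF k]
lemmas over = poly_over_intros[OF kx]

lemma K_simps: "carrier K = C" "x \<otimes>\<^bsub>K\<^esub> y = (x * y) mod G" "\<one>\<^bsub>K\<^esub> = 1" "\<zero>\<^bsub>K\<^esub> = 0" "x \<oplus>\<^bsub>K\<^esub> y = x + y"
  by (simp_all add: AS_function_field_def C_def poly_over_def)

lemma degree_G: "degree G = p"
proof -
  have "degree (monom 1 1 + [:to_fract F:]) < p"
    using p_gt_1 by (intro degree_add_less) (auto simp: degree_monom_eq)
  then have "degree (monom (1 :: 'a poly fract) p + - (monom 1 1 + [:to_fract F:])) = p"
    by (subst degree_add_eq_left) (simp_all only: degree_minus degree_monom_eq one_neq_zero not_False_eq_True)
  moreover have "G = monom 1 p + - (monom 1 1 + [:to_fract F:])" by (simp add: AS_poly_def)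
  ultimately show ?thesis by (simp only:)
qed

lemma over_G: "poly_over kx G"
  unfolding AS_poly_def using to_fract_in_rational_functions[OF k F] is_subfieldD(2)[OF kx] is_subfieldD(1)[OF kx]
  by (intro over(4) over(8) over(9) over(1))

lemma G_nz: "G \<noteq> 0" using degree_G p_gt_1 by auto

lemma degree_mod_G: "degree (z mod G) < p"
  using degree_mod_less'[OF G_nz, of z] degree_G p_gt_1 by (cases "z mod G = 0") auto

lemma mod_in_C: "poly_over kx z \<Longrightarrow> z mod G \<in> C"
  using poly_over_mod(1)[OF kx over_G] degree_mod_G by (simp add: C_def)

lemma mod_C: "z \<in> C \<Longrightarrow> z mod G = z"
  by (simp add: C_def mod_poly_less degree_G)

lemma C_closed: "0 \<in> C" "1 \<in> C" "x \<in> C \<Longrightarrow> y \<in> C \<Longrightarrow> x + y \<in> C" "x \<in> C \<Longrightarrow> - x \<in> C"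
  "x \<in> C \<Longrightarrow> y \<in> C \<Longrightarrow> x - y \<in> C" "x \<in> C \<Longrightarrow> y \<in> C \<Longrightarrow> (x * y) mod G \<in> C"
  using p_gt_1 over by (auto simp: C_def intro: degree_add_less degree_diff_less mod_in_C[unfolded C_def mem_Collect_eq, THEN conjunct2] degree_mod_G)

lemma const_C: "c \<in> kx \<Longrightarrow> [:c:] \<in> C"
  using p_gt_1 over(9)[OF _ over(1)] by (simp add: C_def)

lemma y_C: "[:0, 1:] \<in> C"
  using p_gt_1 over(9)[OF _ over(2)] is_subfieldD(1)[OF kx] by (simp add: C_def one_pCons)

lemma cring_K: "cring K"
proof (rule cringI)
  show "abelian_group K"
    by (rule abelian_groupI) (auto simp: K_simps C_closed intro: bexI[of _ "- _"])
  show "comm_monoid K"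
  proof (rule comm_monoidI)
    show "x \<otimes>\<^bsub>K\<^esub> y \<otimes>\<^bsub>K\<^esub> z = x \<otimes>\<^bsub>K\<^esub> (y \<otimes>\<^bsub>K\<^esub> z)" for x y z
      by (simp add: K_simps mod_mult_left_eq mod_mult_right_eq mult.assoc)
  qed (auto simp: K_simps C_closed mod_C mult.commute)
  show "(x \<oplus>\<^bsub>K\<^esub> y) \<otimes>\<^bsub>K\<^esub> z = x \<otimes>\<^bsub>K\<^esub> z \<oplus>\<^bsub>K\<^esub> y \<otimes>\<^bsub>K\<^esub> z" for x y z
    by (simp add: K_simps distrib_right poly_mod_add_left)
qed

lemma a_inv_K: "x \<in> C \<Longrightarrow> \<ominus>\<^bsub>K\<^esub> x = - x"
  using abelian_group.minus_equality[OF ring.is_abelian_group[OF cring.axioms(1)[OF cring_K]], of "- x" x]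
  by (simp add: K_simps C_closed)

lemma a_minus_K: "x \<in> C \<Longrightarrow> y \<in> C \<Longrightarrow> x \<ominus>\<^bsub>K\<^esub> y = x - y"
  by (simp add: a_minus_def a_inv_K K_simps)

lemma const_K_C: "c \<in> k \<Longrightarrow> const_K c \<in> C"
  unfolding const_K_def
  by (intro const_C to_fract_in_rational_functions[OF k] poly_over_intros(9)[OF k] poly_over_intros(1)[OF k])

definition ev :: "('a poly fract \<Rightarrow> 'b::field) \<Rightarrow> 'b \<Rightarrow> 'a poly fract poly \<Rightarrow> 'b" where
  "ev \<rho> Y = eval_hom \<rho> Y"

text \<open>\<open>Y\<close> is a root of the image of \<open>G\<close>, so evaluation does not see
  the reduction mod \<open>G\<close>; thus \<open>ev\<close> respects the product of the function
  field.\<close>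

lemma ev_AS:
  assumes \<rho>: "is_hom \<rho>" and Y: "Y ^ p - Y = \<rho> (to_fract F)"
  shows "ev \<rho> Y (z mod G) = ev \<rho> Y z"
proof -
  note h = is_homD[OF is_hom_eval_hom[OF \<rho>, of Y]]
  have "ev \<rho> Y G = 0"
    using Y by (simp add: ev_def AS_poly_def h(6) eval_hom_monom[OF \<rho>] eval_hom_const[OF \<rho>] is_homD[OF \<rho>])
  moreover have "ev \<rho> Y z = ev \<rho> Y (z div G) * ev \<rho> Y G + ev \<rho> Y (z mod G)"
    unfolding ev_def h(4)[symmetric] h(3)[symmetric] by (simp only: div_mult_mod_eq)
  ultimately show ?thesis by simp
qed

end

text \<open>Absence of zero divisors stands in for irreducibility of \<open>G\<close>. It is
  supplied by \<open>pole_imp_field\<close> from an embedding at infinity.\<close>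

locale AS_field = AS_curve +
  assumes no_zero_divisors: "z \<in> C \<Longrightarrow> w \<in> C \<Longrightarrow> z \<noteq> 0 \<Longrightarrow> w \<noteq> 0 \<Longrightarrow> (z * w) mod G \<noteq> 0"
begin

text \<open>Euclidean descent: G = q z + r gives z (-q) = r mod \<open>G\<close>, so an inverse of
  the remainder, which has smaller degree, yields one of \<open>z\<close>. The remainder is nonzero,
  as otherwise \<open>q\<close> and \<open>z\<close> would be zero divisors.\<close>

lemma inverse_exists: "z \<in> C \<Longrightarrow> z \<noteq> 0 \<Longrightarrow> \<exists>w\<in>C. (z * w) mod G = 1"
proof (induction "degree z" arbitrary: z rule: less_induct)
  case less
  note z = less.prems
  have 1: "1 mod G = 1" using mod_C[OF C_closed(2)] .
  show ?case
  proof (cases "degree z = 0")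
    case True
    then obtain c where c: "z = [:c:]" by (auto elim: degree_eq_zeroE)
    then have "c \<in> kx" "c \<noteq> 0" using z poly_over_pConsD[of kx c 0] by (auto simp: C_def)
    then have "[:inverse c:] \<in> C" by (intro const_C is_subfieldD(6)[OF kx])
    moreover have "z * [:inverse c:] = 1" using c \<open>c \<noteq> 0\<close> by (simp add: one_pCons)
    then have "(z * [:inverse c:]) mod G = 1" by (simp only: 1)
    ultimately show ?thesis by blast
  next
    case False
    define q where "q = G div z"
    define r where "r = G mod z"
    have zo: "poly_over kx z" "degree z < p" using z by (auto simp: C_def)
    have r: "poly_over kx r" "degree r < degree z \<or> r = 0" and q: "poly_over kx q"
      unfolding r_def q_def
      using poly_over_mod[OF kx zo(1) over_G] degree_mod_less'[of z G] z(2) by auto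
    have Gq: "G = q * z + r" by (simp add: q_def r_def)
    have rC: "r \<in> C" using r zo by (auto simp: C_def)
    have "degree (q * z) = degree (G + - r)" using Gq by simp
    also have "\<dots> = p" using r zo(2) p_gt_1 degree_G
      by (subst degree_add_eq_left) auto
    finally have "degree (q * z) = p" .
    moreover from this have "q \<noteq> 0" using p_gt_1 by auto
    ultimately have "degree q + degree z = p" using z(2) by (simp add: degree_mult_eq)
    then have qC: "q \<in> C" using q False p_gt_1 by (simp add: C_def)
    have "r \<noteq> 0"
    proof
      assume "r = 0"
      then have "G = q * z" using Gq by simp
      then have "(q * z) mod G = 0" "q \<noteq> 0" using G_nz by auto
      then show False using no_zero_divisors[OF qC z(1) _ z(2)] by simp
    qed
    then obtain w where w: "w \<in> C" "(r * w) mod G = 1"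
      using less.hyps[of r] r rC by auto
    have "z * (- q * w) = r * w - G * w" by (subst Gq) (simp add: algebra_simps)
    then have "(z * (- q * w)) mod G = (r * w) mod G"
      by (simp add: poly_mod_diff_left)
    then have "(z * ((- q * w) mod G)) mod G = 1" using w by (simp add: mod_mult_right_eq)
    then show ?thesis using C_closed(6)[OF C_closed(4)[OF qC] w(1)] by blast
  qed
qed

lemma inv_K:
  assumes "z \<in> C" "z \<noteq> 0"
  shows "inv\<^bsub>K\<^esub> z \<in> C" "(z * inv\<^bsub>K\<^esub> z) mod G = 1"
proof -
  obtain w where w: "w \<in> C" "(z * w) mod G = 1" using inverse_exists[OF assms] by blast
  have "inv\<^bsub>K\<^esub> z = w"
    by (rule comm_monoid.comm_inv_char[OF cring.axioms(2)[OF cring_K]]) (use assms w in \<open>auto simp: K_simps\<close>)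
  then show "inv\<^bsub>K\<^esub> z \<in> C" "(z * inv\<^bsub>K\<^esub> z) mod G = 1" using w by auto
qed

end

text \<open>The image in a field of a valuation ring of a degree one place; \<open>S\<close> is the image of the
  function field and \<open>c\<close> that of the constants.\<close>

definition deg1_ring :: "'b::field set \<Rightarrow> 'b set \<Rightarrow> 'b set \<Rightarrow> bool" where
  "deg1_ring S c V \<longleftrightarrow> V \<subseteq> S \<and> V \<noteq> S \<and> 1 \<in> V \<and> (\<forall>x\<in>V. \<forall>y\<in>V. x - y \<in> V) \<and> (\<forall>x\<in>V. \<forall>y\<in>V. x * y \<in> V) \<and>
     c \<subseteq> V \<and> (\<forall>z\<in>S. z \<in> V \<or> inverse z \<in> V) \<and> (\<forall>z\<in>V. \<exists>u\<in>c. z = u \<or> inverse (z - u) \<notin> V)"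

lemma deg1_ringD:
  assumes "deg1_ring S c V"
  shows "V \<subseteq> S" "V \<noteq> S" "1 \<in> V" "x \<in> V \<Longrightarrow> y \<in> V \<Longrightarrow> x - y \<in> V" "x \<in> V \<Longrightarrow> y \<in> V \<Longrightarrow> x * y \<in> V"
    "c \<subseteq> V" "z \<in> S \<Longrightarrow> z \<in> V \<or> inverse z \<in> V" "z \<in> V \<Longrightarrow> \<exists>u\<in>c. z = u \<or> inverse (z - u) \<notin> V"
  using assms by (auto simp: deg1_ring_def)

text \<open>An embedding \<open>h\<close> of the function field, which is a record, into a type with
  field operations. Places are transported along it and studied there.\<close>

locale AS_evaluation = AS_field p F k for p and F :: "'a::field poly" and k +
  fixes \<rho> :: "'a poly fract \<Rightarrow> 'b::field" and Y :: 'b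
  assumes \<rho>: "is_hom \<rho>" and Y_AS: "Y ^ p - Y = \<rho> (to_fract F)"
begin

abbreviation "h \<equiv> ev \<rho> Y"

lemmas h_hom = is_homD[OF is_hom_eval_hom[OF \<rho>, of Y], folded ev_def]

lemma h_mult: "h ((z * w) mod G) = h z * h w"
  by (simp add: ev_AS[OF \<rho> Y_AS] h_hom)

lemma h_nz: "z \<in> C \<Longrightarrow> z \<noteq> 0 \<Longrightarrow> h z \<noteq> 0"
  using h_mult[of z "inv\<^bsub>K\<^esub> z"] inv_K(2)[of z] h_hom(2) by auto

lemma h_inj: "inj_on h C"
proof (rule inj_onI)
  fix x y assume "x \<in> C" "y \<in> C" "h x = h y"
  then show "x = y" using h_nz[of "x - y"] C_closed(5)[of x y] by (auto simp: h_hom)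
qed

lemma h_inv: "z \<in> C \<Longrightarrow> z \<noteq> 0 \<Longrightarrow> h (inv\<^bsub>K\<^esub> z) = inverse (h z)"
  using h_mult[of z "inv\<^bsub>K\<^esub> z"] inv_K(2)[of z] h_hom(2) by (simp add: inverse_unique)

lemma h_mem: "V \<subseteq> C \<Longrightarrow> z \<in> C \<Longrightarrow> h z \<in> h ` V \<longleftrightarrow> z \<in> V"
  using h_inj by (rule inj_on_image_mem_iff)

lemma h_const: "h (const_K c) = \<rho> (to_fract [:c:])"
  by (simp add: ev_def const_K_def eval_hom_const[OF \<rho>])

lemma is_subfield_image: "is_subfield (h ` C)"
  unfolding is_subfield_def
proof (intro conjI ballI)
  show "0 \<in> h ` C" "1 \<in> h ` C"
    using C_closed(1,2) h_hom(1,2) by (metis imageI)+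
  fix x assume "x \<in> h ` C"
  then obtain z where z: "z \<in> C" "x = h z" by blast
  show "- x \<in> h ` C" using C_closed(4)[OF z(1)] z h_hom(5) by (metis imageI)
  show "inverse x \<in> h ` C"
    using z h_inv inv_K(1) C_closed(1) h_hom(1) by (metis imageI inverse_zero)
  fix y assume "y \<in> h ` C"
  then obtain w where w: "w \<in> C" "y = h w" by blast
  show "x + y \<in> h ` C" using C_closed(3)[OF z(1) w(1)] z w h_hom(3) by (metis imageI)
  show "x * y \<in> h ` C" using C_closed(6)[OF z(1) w(1)] z w h_mult by (metis imageI)
qed

lemma maximal_ideal_iff:
  assumes V: "subring V K" and z: "z \<in> V"
  shows "z \<in> maximal_ideal_of K V \<longleftrightarrow> h z = 0 \<or> inverse (h z) \<notin> h ` V"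
proof -
  have VC: "V \<subseteq> C" using subringE(1)[OF V] by (simp add: K_simps)
  have "z \<in> Units (K\<lparr>carrier := V\<rparr>) \<longleftrightarrow> (\<exists>x\<in>V. (x * z) mod G = 1)"
    using z by (auto simp: Units_def K_simps mult.commute)
  also have "\<dots> \<longleftrightarrow> (\<exists>x\<in>V. h x * h z = 1)"
  proof -
    have "(x * z) mod G = 1 \<longleftrightarrow> h x * h z = 1" if "x \<in> V" for x
    proof -
      have "(x * z) mod G \<in> C" using that z VC C_closed(6) by blast
      then have "(x * z) mod G = 1 \<longleftrightarrow> h ((x * z) mod G) = h 1"
        using h_inj C_closed(2) by (auto dest: inj_onD)
      then show ?thesis by (simp add: h_mult h_hom)
    qed
    then show ?thesis by blast
  qed
  also have "\<dots> \<longleftrightarrow> h z \<noteq> 0 \<and> inverse (h z) \<in> h ` V"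
  proof
    assume "\<exists>x\<in>V. h x * h z = 1"
    then obtain x where x: "x \<in> V" "h x * h z = 1" by blast
    then have "h z \<noteq> 0" "inverse (h z) = h x" by (auto simp: inverse_unique mult.commute)
    then show "h z \<noteq> 0 \<and> inverse (h z) \<in> h ` V" using x(1) by simp
  next
    assume A: "h z \<noteq> 0 \<and> inverse (h z) \<in> h ` V"
    then obtain x where "x \<in> V" "inverse (h z) = h x" by blast
    then show "\<exists>x\<in>V. h x * h z = 1" using A by (metis left_inverse)
  qed
  finally show ?thesis using z by (auto simp: maximal_ideal_of_def)
qed

lemma degree_one_place_iff:
  "V \<in> degree_one_places K (const_K ` k) \<longleftrightarrow> V \<subseteq> C \<and> deg1_ring (h ` C) (h ` const_K ` k) (h ` V)"
proof
  assume "V \<in> degree_one_places K (const_K ` k)"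
  then have R: "valuation_ring_over K (const_K ` k) V \<and>
    (\<forall>z\<in>V. \<exists>c\<in>const_K ` k. z \<ominus>\<^bsub>K\<^esub> c \<in> maximal_ideal_of K V)"
    unfolding degree_one_places_def by (rule CollectD)
  from conjunct1[OF R] have V: "subring V K" "const_K ` k \<subset> V" "V \<subset> C"
    and val: "\<And>z. z \<in> C \<Longrightarrow> z \<noteq> 0 \<Longrightarrow> z \<in> V \<or> inv\<^bsub>K\<^esub> z \<in> V"
    unfolding valuation_ring_over_def K_simps by blast+
  note res = bspec[OF conjunct2[OF R]]
  note VE = subringE[OF V(1), unfolded K_simps]
  have minus: "x - y \<in> V" if "x \<in> V" "y \<in> V" for x y
    using VE(7)[OF that(1) VE(5)[OF that(2)]] a_inv_K[of y] that V(3) by auto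
  have "deg1_ring (h ` C) (h ` const_K ` k) (h ` V)"
    unfolding deg1_ring_def
  proof (intro conjI ballI)
    show "h ` V \<subseteq> h ` C" "h ` const_K ` k \<subseteq> h ` V" using V by auto
    show "h ` V \<noteq> h ` C" using V(3) h_inj by (metis inj_on_image_eq_iff order.refl psubset_eq)
    show "1 \<in> h ` V" using VE(3) h_hom(2) by (metis imageI)
  next
    fix x y assume "x \<in> h ` V" "y \<in> h ` V"
    then obtain a b where ab: "a \<in> V" "b \<in> V" "x = h a" "y = h b" by blast
    show "x - y \<in> h ` V" using minus[OF ab(1,2)] h_hom(6) ab by (metis imageI)
    show "x * y \<in> h ` V" using VE(6)[OF ab(1,2)] h_mult ab by (metis imageI)
  next
    fix x assume "x \<in> h ` C"
    then obtain z where z: "z \<in> C" "x = h z" by blast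
    show "x \<in> h ` V \<or> inverse x \<in> h ` V"
    proof (cases "z = 0")
      case True
      then show ?thesis using VE(2) z by blast
    next
      case False
      then show ?thesis using val[OF z(1)] h_inv[OF z(1)] z(2) by (metis imageI)
    qed
  next
    fix x assume "x \<in> h ` V"
    then obtain z where z: "z \<in> V" "x = h z" by blast
    then obtain c where c: "c \<in> const_K ` k" "z \<ominus>\<^bsub>K\<^esub> c \<in> maximal_ideal_of K V" using res by blast
    have cV: "c \<in> V" using c V(2) by auto
    then have "z \<ominus>\<^bsub>K\<^esub> c = z - c" using z V(3) by (intro a_minus_K) auto
    then have "h (z - c) = 0 \<or> inverse (h (z - c)) \<notin> h ` V"
      using maximal_ideal_iff[OF V(1) minus[OF z(1) cV]] c(2) by simp
    then show "\<exists>u\<in>h ` const_K ` k. x = u \<or> inverse (x - u) \<notin> h ` V"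
      using c(1) by (auto simp: h_hom z(2))
  qed
  then show "V \<subseteq> C \<and> deg1_ring (h ` C) (h ` const_K ` k) (h ` V)" using V(3) by auto
next
  assume R: "V \<subseteq> C \<and> deg1_ring (h ` C) (h ` const_K ` k) (h ` V)"
  then have VC: "V \<subseteq> C" by blast
  note D = deg1_ringD[OF conjunct2[OF R]]
  note ne = D(2) and one = D(3) and minus = D(4) and mult = D(5) and const = D(6) and val = D(7) and res = D(8)
  note mem = h_mem[OF VC]
  have oneV: "1 \<in> V" using one mem[OF C_closed(2)] h_hom(2) by simp
  have minusV: "x - y \<in> V" if "x \<in> V" "y \<in> V" for x y
    using minus[of "h x" "h y"] that mem[of "x - y"] C_closed(5) VC by (auto simp: h_hom)
  have multV: "(x * y) mod G \<in> V" if "x \<in> V" "y \<in> V" for x y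
    using mult[of "h x" "h y"] that mem[of "(x * y) mod G"] C_closed(6) VC by (auto simp: h_mult)
  have uminusV: "- x \<in> V" if "x \<in> V" for x
    using minusV[OF minusV[OF that that] that] by simp
  have cV: "const_K ` k \<subseteq> V"
    using const mem const_K_C by blast
  have sub: "subring V K"
  proof (rule ring.subringI[OF cring.axioms(1)[OF cring_K]])
    show "\<ominus>\<^bsub>K\<^esub> x \<in> V" if "x \<in> V" for x using uminusV[OF that] a_inv_K[of x] that VC by auto
    show "x \<oplus>\<^bsub>K\<^esub> y \<in> V" if "x \<in> V" "y \<in> V" for x y
      unfolding K_simps using minusV[OF that(1) uminusV[OF that(2)]] by simp
  qed (use VC oneV multV in \<open>auto simp: K_simps\<close>)
  have valV: "z \<in> V \<or> inv\<^bsub>K\<^esub> z \<in> V" if "z \<in> C" "z \<noteq> 0" for z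
    using val[of "h z"] that h_inv[OF that] mem[OF that(1)] mem[OF inv_K(1)[OF that]] by auto
  have VC': "V \<subset> C" using VC ne by auto
  \<comment> \<open>A valuation ring has to contain the constants properly. If \<open>V\<close> were
    the constants alone, every nonzero function would be a constant or the inverse of one, and
    \<open>V\<close> would be the whole field.\<close>
  have "const_K ` k \<noteq> V"
  proof
    assume eq: "const_K ` k = V"
    have kinv: "z \<in> V" if z: "z \<in> C" "z \<noteq> 0" and iz: "inv\<^bsub>K\<^esub> z \<in> V" for z
    proof -
      obtain c where c: "c \<in> k" "inv\<^bsub>K\<^esub> z = const_K c" using iz eq by blast
      have "h z = inverse (h (const_K c))" unfolding c(2)[symmetric] h_inv[OF z] by simp
      also have "\<dots> = h (const_K (inverse c))"
      proof (cases "c = 0")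
        case True
        then show ?thesis by (simp add: h_const is_homD[OF \<rho>])
      next
        case False
        have "h (const_K (inverse c)) * h (const_K c) = \<rho> (to_fract ([:inverse c:] * [:c:]))"
          unfolding h_const is_homD(4)[OF \<rho>, symmetric] to_fract_mult[symmetric] ..
        also have "[:inverse c:] * [:c:] = 1" using False by (simp add: one_pCons)
        finally show ?thesis using is_homD(2)[OF \<rho>] by (metis inverse_unique mult.commute to_fract_1)
      qed
      finally have "z = const_K (inverse c)"
        using h_inj z(1) const_K_C[OF is_subfieldD(6)[OF AS_curve.k[OF AS_curve_axioms] c(1)]] by (auto dest: inj_onD)
      then show ?thesis using eq is_subfieldD(6)[OF AS_curve.k[OF AS_curve_axioms] c(1)] by blast
    qed
    have "C \<subseteq> V"
    proof
      fix z assume z: "z \<in> C"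
      show "z \<in> V"
      proof (cases "z = 0")
        case True
        then show ?thesis using minusV[OF oneV oneV] by simp
      next
        case False
        then show ?thesis using valV[OF z] kinv[OF z] by blast
      qed
    qed
    then show False using VC' by blast
  qed
  then have "valuation_ring_over K (const_K ` k) V"
    using sub cV VC' valV by (auto simp: valuation_ring_over_def K_simps)
  moreover have "\<exists>c\<in>const_K ` k. z \<ominus>\<^bsub>K\<^esub> c \<in> maximal_ideal_of K V" if z: "z \<in> V" for z
  proof -
    obtain c where c: "c \<in> const_K ` k" "h z = h c \<or> inverse (h z - h c) \<notin> h ` V"
      using res[of "h z"] z by blast
    then have "h (z - c) = 0 \<or> inverse (h (z - c)) \<notin> h ` V" by (auto simp: h_hom)
    moreover have "c \<in> V" using c cV by blast
    ultimately have "z - c \<in> maximal_ideal_of K V"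
      using maximal_ideal_iff[OF sub minusV[OF z]] by blast
    moreover have "z \<ominus>\<^bsub>K\<^esub> c = z - c" using z \<open>c \<in> V\<close> VC by (intro a_minus_K) auto
    ultimately have "z \<ominus>\<^bsub>K\<^esub> c \<in> maximal_ideal_of K V" by (simp only:)
    then show ?thesis using c(1) by blast
  qed
  ultimately show "V \<in> degree_one_places K (const_K ` k)"
    by (simp add: degree_one_places_def)
qed

end

section \<open>Places in a field of Laurent series\<close>

locale place_in =
  fixes S c V :: "'b::field set"
  assumes S: "is_subfield S" and c: "is_subfield c" and V: "deg1_ring S c V"
begin

text \<open>\<open>M\<close> is the maximal ideal and \<open>U\<close> the unit group of
  \<open>V\<close>. Zero is treated explicitly because \<open>inverse 0 = 0\<close>.\<close>

definition M :: "'b set" where "M = {z \<in> V. z = 0 \<or> inverse z \<notin> V}"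
definition U :: "'b set" where "U = {z \<in> V. z \<noteq> 0 \<and> inverse z \<in> V}"

lemmas VD = deg1_ringD[OF V]

lemma V_closed: "0 \<in> V" "1 \<in> V" "x \<in> V \<Longrightarrow> - x \<in> V" "x \<in> V \<Longrightarrow> y \<in> V \<Longrightarrow> x + y \<in> V"
  "x \<in> V \<Longrightarrow> y \<in> V \<Longrightarrow> x - y \<in> V" "x \<in> V \<Longrightarrow> y \<in> V \<Longrightarrow> x * y \<in> V" "x \<in> V \<Longrightarrow> x ^ n \<in> V"
proof -
  show 0: "0 \<in> V" using VD(4)[OF VD(3) VD(3)] by simp
  show m: "- x \<in> V" if "x \<in> V" for x using VD(4)[OF 0 that] by simp
  show "x + y \<in> V" if "x \<in> V" "y \<in> V" using VD(4)[OF that(1) m[OF that(2)]] by simp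
  show "x ^ n \<in> V" if "x \<in> V" using that VD(3,5) by (induction n) auto
qed (use VD in auto)

lemma V_cases: "x \<in> V \<Longrightarrow> x \<in> M \<or> x \<in> U"
  and M_U_disjoint: "x \<in> M \<Longrightarrow> x \<notin> U" and M_V: "x \<in> M \<Longrightarrow> x \<in> V" and U_V: "x \<in> U \<Longrightarrow> x \<in> V"
  and V_S: "x \<in> V \<Longrightarrow> x \<in> S"
  using VD(1) by (auto simp: M_def U_def)

lemma U_closed: "1 \<in> U" "x \<in> U \<Longrightarrow> y \<in> U \<Longrightarrow> x * y \<in> U" "x \<in> U \<Longrightarrow> inverse x \<in> U" "x \<in> U \<Longrightarrow> x ^ n \<in> U"
  "x \<in> U \<Longrightarrow> - x \<in> U"
  unfolding U_def using V_closed(2,3,6,7) by (auto simp: power_inverse[symmetric] simp del: power_inverse)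

lemma M_mult: "v \<in> V \<Longrightarrow> m \<in> M \<Longrightarrow> v * m \<in> M"
proof -
  assume v: "v \<in> V" and m: "m \<in> M"
  show "v * m \<in> M"
  proof (cases "v * m = 0")
    case False
    then have "v * inverse (v * m) = inverse m" by (simp add: field_simps)
    then have "inverse (v * m) \<in> V \<Longrightarrow> inverse m \<in> V" using V_closed(6)[OF v, of "inverse (v * m)"] by metis
    then have "inverse (v * m) \<notin> V" using m False by (auto simp: M_def simp del: inverse_mult_distrib)
    then show ?thesis using V_closed(6)[OF v, of m] m by (auto simp: M_def)
  next
    case True
    then show ?thesis by (simp only: M_def mem_Collect_eq V_closed(1) simp_thms)
  qed
qed

lemma M_minus: "m \<in> M \<Longrightarrow> - m \<in> M"
  using M_mult[OF V_closed(3)[OF V_closed(2)], of m] by simp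

text \<open>One of x/y and y/x lies in \<open>V\<close>; in the first case x + y = (x/y + 1) y, and
  the other is symmetric.\<close>

lemma M_add: "x \<in> M \<Longrightarrow> y \<in> M \<Longrightarrow> x + y \<in> M"
proof -
  have *: "x + y \<in> M" if x: "x \<in> M" and y: "y \<in> M" and q: "y \<noteq> 0" "x / y \<in> V" for x y
  proof -
    have "x + y = (x / y + 1) * y" using q by (simp add: field_simps)
    then show ?thesis using M_mult[OF V_closed(4)[OF q(2) V_closed(2)] y] by simp
  qed
  assume x: "x \<in> M" and y: "y \<in> M"
  show "x + y \<in> M"
  proof (cases "x = 0 \<or> y = 0")
    case True
    then show ?thesis using x y by auto
  next
    case False
    have "x / y \<in> S" using x y M_V V_S is_subfieldD(8)[OF S] by blast
    then have "x / y \<in> V \<or> y / x \<in> V" using VD(7)[of "x / y"] by simp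
    then show ?thesis using *[OF x y] *[OF y x] False by (auto simp: add.commute)
  qed
qed

lemma U_plus_M: "u \<in> U \<Longrightarrow> m \<in> M \<Longrightarrow> u + m \<in> U"
proof (rule ccontr)
  assume u: "u \<in> U" and m: "m \<in> M" and n: "u + m \<notin> U"
  then have "u + m \<in> M" using V_cases[OF V_closed(4)[OF U_V[OF u] M_V[OF m]]] by blast
  then have "(u + m) + - m \<in> M" using M_add M_minus[OF m] by blast
  then show False using u M_U_disjoint by simp
qed

lemma const_U: "x \<in> c \<Longrightarrow> x \<noteq> 0 \<Longrightarrow> x \<in> U"
  using VD(6) is_subfieldD(6)[OF c] by (auto simp: U_def)

lemma inverse_M: "z \<in> S \<Longrightarrow> z \<notin> V \<Longrightarrow> inverse z \<in> M"
  using VD(7)[of z] by (auto simp: M_def)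

text \<open>If \<open>z\<close> were outside \<open>V\<close>, its inverse would be inside, and so
  would z = z^n (1/z)^(n-1).\<close>

lemma power_V_D: "z \<in> S \<Longrightarrow> n \<ge> 1 \<Longrightarrow> z ^ n \<in> V \<Longrightarrow> z \<in> V"
proof (rule ccontr)
  assume z: "z \<in> S" "n \<ge> 1" "z ^ n \<in> V" "z \<notin> V"
  then have iz: "inverse z \<in> V" "z \<noteq> 0" using inverse_M M_V V_closed(1) by auto
  obtain j where j: "n = Suc j" using z(2) by (cases n) auto
  have "z ^ n * inverse z ^ j = z" using iz(2) by (simp add: j power_inverse)
  then show False using V_closed(6)[OF z(3) V_closed(7)[OF iz(1), of j]] z(4) by simp
qed

lemma power_M_D: "z \<in> S \<Longrightarrow> n \<ge> 1 \<Longrightarrow> z ^ n \<in> M \<Longrightarrow> z \<in> M"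
proof -
  assume z: "z \<in> S" "n \<ge> 1" "z ^ n \<in> M"
  then have "z \<in> V" using power_V_D M_V by blast
  then show ?thesis using V_cases U_closed(4)[of z n] z(3) M_U_disjoint by blast
qed

lemma power_U_D: "z \<in> S \<Longrightarrow> n \<ge> 1 \<Longrightarrow> z ^ n \<in> U \<Longrightarrow> z \<in> U"
proof -
  assume z: "z \<in> S" "n \<ge> 1" "z ^ n \<in> U"
  then have "z \<in> V" using power_V_D U_V by blast
  moreover have "z \<notin> M"
  proof
    assume m: "z \<in> M"
    obtain j where j: "n = Suc j" using z(2) by (cases n) auto
    have "z ^ n \<in> M" using M_mult[OF V_closed(7)[OF \<open>z \<in> V\<close>, of j] m] by (simp add: j mult.commute)
    then show False using z(3) M_U_disjoint by blast
  qed
  ultimately show ?thesis using V_cases by blast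
qed

lemma M_power: "m \<in> M \<Longrightarrow> n \<ge> 1 \<Longrightarrow> m ^ n \<in> M"
  by (cases n) (auto intro: M_mult V_closed M_V simp: mult.commute[of m])

lemma residue_exists: "z \<in> V \<Longrightarrow> \<exists>u\<in>c. z - u \<in> M"
proof -
  assume z: "z \<in> V"
  then obtain u where u: "u \<in> c" "z = u \<or> inverse (z - u) \<notin> V" using VD(8) by blast
  then have "z - u \<in> M" using V_closed(5)[OF z] VD(6) by (auto simp: M_def)
  then show ?thesis using u(1) by blast
qed

lemma one_notin_M: "1 \<notin> M"
  using U_closed(1) M_U_disjoint by blast

end

text \<open>The orders are -iN mod \<open>p\<close>, pairwise distinct for i < n <= p since
  \<open>N\<close> is prime to \<open>p\<close>, and a sum of terms of different orders has the
  least of them. \<open>T\<close> stays abstract for two uses: all nonzero series, to exclude zero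
  divisors; and series whose \<open>p\<close>-th power is a power of \<open>X\<close> times a unit,
  for uniqueness at infinity.\<close>

lemma sum_distinct_subdegrees:
  fixes f :: "nat \<Rightarrow> 'a::field fls" and N p :: nat
  assumes T: "\<And>z w. z \<in> T \<Longrightarrow> w \<in> T \<Longrightarrow> fls_subdegree z < fls_subdegree w \<Longrightarrow> z + w \<in> T" and T0: "0 \<notin> T"
    and cop: "coprime N p" and n: "n \<le> p"
    and f: "\<And>i. i < n \<Longrightarrow> f i = 0 \<or> f i \<in> T \<and> int p dvd fls_subdegree (f i) + int (i * N)"
  shows "(\<forall>i<n. f i = 0) \<or> (\<Sum>i<n. f i) \<in> T \<and> (\<exists>i<n. int p dvd fls_subdegree (\<Sum>i<n. f i) + int (i * N))"
  using n f
proof (induction n)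
  case (Suc n)
  let ?s = "\<Sum>i<n. f i"
  have IH: "(\<forall>i<n. f i = 0) \<or> ?s \<in> T \<and> (\<exists>i<n. int p dvd fls_subdegree ?s + int (i * N))"
    using Suc by simp
  show ?case
  proof (cases "f n = 0")
    case True
    then show ?thesis using IH by (auto simp: less_Suc_eq)
  next
    case False
    then have fn: "f n \<in> T" "int p dvd fls_subdegree (f n) + int (n * N)" using Suc.prems(2)[of n] by auto
    show ?thesis
    proof (cases "\<forall>i<n. f i = 0")
      case True
      then show ?thesis using fn by auto
    next
      case ne: False
      then obtain i where s: "?s \<in> T" and i: "i < n" "int p dvd fls_subdegree ?s + int (i * N)" using IH by blast
      have "fls_subdegree ?s \<noteq> fls_subdegree (f n)"
      proof
        assume eq: "fls_subdegree ?s = fls_subdegree (f n)"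
        have "int p dvd (fls_subdegree (f n) + int (n * N)) - (fls_subdegree ?s + int (i * N))"
          using fn(2) i(2) by (rule dvd_diff)
        also have "\<dots> = int ((n - i) * N)" using eq i(1) by (simp add: of_nat_diff algebra_simps)
        finally have "p dvd (n - i) * N" by (simp only: of_nat_dvd_iff)
        then have "p dvd n - i" using cop by (simp add: coprime_dvd_mult_left_iff coprime_commute)
        then show False using i(1) Suc.prems(1) by (auto dest!: dvd_imp_le)
      qed
      then consider "fls_subdegree ?s < fls_subdegree (f n)" | "fls_subdegree (f n) < fls_subdegree ?s" by linarith
      then show ?thesis
      proof cases
        case 1
        then have "?s + f n \<in> T" "fls_subdegree (?s + f n) = fls_subdegree ?s"
          using T[OF s fn(1)] fls_subdegree_add_eq1[of ?s "f n"] s T0 by metis+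
        then show ?thesis using i by (auto intro!: exI[of _ i])
      next
        case 2
        then have "f n + ?s \<in> T" "fls_subdegree (f n + ?s) = fls_subdegree (f n)"
          using T[OF fn(1) s] fls_subdegree_add_eq1[of "f n" ?s] fn(1) T0 by metis+
        then show ?thesis using fn(2) by (auto simp: add.commute intro!: exI[of _ n])
      qed
    qed
  qed
qed auto

lemma is_hom_fls_const: "is_hom (fls_const :: 'a::comm_ring_1 \<Rightarrow> 'a fls)"
  by (simp add: is_hom_def fls_plus_const)

text \<open>A branch of the curve: both coordinates are Laurent series with coefficients in
  \<open>k\<close>. Transcendence of \<open>X\<close> makes evaluation injective on polynomials, so
  that it extends to rational functions.\<close>

locale fls_point = AS_curve p F k for p and F :: "'a::field poly" and k +
  fixes X Y :: "'a fls"
  assumes transcendental: "P \<noteq> 0 \<Longrightarrow> eval_hom fls_const X P \<noteq> 0"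
    and Y_AS: "Y ^ p - Y = eval_hom fls_const X F"
    and coeffs: "fls_nth X n \<in> k" "fls_nth Y n \<in> k"
begin

definition ell :: "'a poly \<Rightarrow> 'a fls" where "ell = eval_hom fls_const X"
definition \<rho> :: "'a poly fract \<Rightarrow> 'a fls" where "\<rho> = frac_hom ell"

lemma is_hom_ell: "is_hom ell"
  unfolding ell_def by (rule is_hom_eval_hom[OF is_hom_fls_const])

lemmas ell_hom = is_homD[OF is_hom_ell]

lemma ell_nz: "P \<noteq> 0 \<Longrightarrow> ell P \<noteq> 0"
  using transcendental by (simp add: ell_def)

lemma ell_pCons: "ell (pCons u P) = fls_const u + X * ell P"
  unfolding ell_def by (rule eval_hom_pCons[OF is_hom_fls_const])

lemma ell_const: "ell [:u:] = fls_const u"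
  by (simp add: ell_pCons ell_hom)

lemma ell_X: "ell [:0, 1:] = X"
  unfolding ell_pCons ell_hom by simp

lemma is_hom_\<rho>: "is_hom \<rho>"
  unfolding \<rho>_def by (rule is_hom_frac_hom[OF is_hom_ell ell_nz])

lemma \<rho>_to_fract: "\<rho> (to_fract P) = ell P"
  unfolding \<rho>_def by (rule frac_hom_to_fract[OF is_hom_ell ell_nz])

abbreviation "hx \<equiv> ev \<rho> Y"

lemma h_const_K: "hx (const_K u) = fls_const u"
  by (simp add: ev_def const_K_def eval_hom_const[OF is_hom_\<rho>] \<rho>_to_fract ell_const)

lemma h_consts: "hx ` const_K ` k = fls_const ` k"
  by (simp add: image_image h_const_K)

lemma h_y: "hx [:0, 1:] = Y"
  using eval_hom_pCons[OF is_hom_\<rho>, of Y 0 "[:1:]"] eval_hom_const[OF is_hom_\<rho>, of Y 1]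
  by (simp add: ev_def is_homD[OF is_hom_\<rho>])

lemma h_poly: "hx [:to_fract P:] = ell P"
  by (simp add: ev_def eval_hom_const[OF is_hom_\<rho>] \<rho>_to_fract)

lemma to_fract_C: "poly_over k P \<Longrightarrow> [:to_fract P:] \<in> C"
  by (rule const_C[OF to_fract_in_rational_functions[OF k]])

lemma clear_denominators:
  assumes "z \<in> C"
  obtains D P where "D \<noteq> 0" "poly_over k D" "\<And>i. i < p \<Longrightarrow> poly_over k (P i)"
    "\<And>i. i < p \<Longrightarrow> coeff z i * to_fract D = to_fract (P i)"
    "hx z * ell D = (\<Sum>i<p. ell (P i) * Y ^ i)"
proof -
  have z: "degree z < p" "\<And>i. coeff z i \<in> kx" using assms by (auto simp: C_def poly_over_def)
  obtain D P where D: "D \<noteq> 0" "poly_over k D" "\<And>i. i < p \<Longrightarrow> poly_over k (P i) \<and> coeff z i * to_fract D = to_fract (P i)"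
    using rational_functions_common_denominator[OF k, of p "coeff z"] z(2) by blast
  have "hx z * ell D = (\<Sum>i<p. \<rho> (coeff z i) * Y ^ i * ell D)"
    unfolding ev_def eval_hom_sum_degree[OF is_hom_\<rho> z(1)] sum_distrib_right ..
  also have "\<dots> = (\<Sum>i<p. ell (P i) * Y ^ i)"
  proof (intro sum.cong refl)
    fix i assume "i \<in> {..<p}"
    then have "\<rho> (coeff z i * to_fract D) = \<rho> (to_fract (P i))" using D(3) by simp
    then have "\<rho> (coeff z i) * ell D = ell (P i)" by (simp only: is_homD(4)[OF is_hom_\<rho>] \<rho>_to_fract)
    then show "\<rho> (coeff z i) * Y ^ i * ell D = ell (P i) * Y ^ i" by (metis mult.assoc mult.commute)
  qed
  finally show ?thesis using D that by blast
qed

definition over_k :: "'a fls set" where "over_k = {w. \<forall>n. fls_nth w n \<in> k}"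

lemma over_k_closed: "fls_const u \<in> over_k \<longleftrightarrow> u \<in> k" "x \<in> over_k \<Longrightarrow> y \<in> over_k \<Longrightarrow> x + y \<in> over_k"
  "x \<in> over_k \<Longrightarrow> y \<in> over_k \<Longrightarrow> x * y \<in> over_k" "0 \<in> over_k" "1 \<in> over_k" "x \<in> over_k \<Longrightarrow> x ^ n \<in> over_k"
proof -
  show m: "x * y \<in> over_k" if "x \<in> over_k" "y \<in> over_k" for x y
    using that unfolding over_k_def
    by (auto simp: fls_times_nth(2) intro!: is_subfield_sum[OF k] is_subfieldD(5)[OF k])
  show one: "1 \<in> over_k" using is_subfieldD(1,2)[OF k] by (auto simp: over_k_def)
  show "x ^ n \<in> over_k" if "x \<in> over_k" using that m one by (induction n) auto
  show "fls_const u \<in> over_k \<longleftrightarrow> u \<in> k" using is_subfieldD(1)[OF k] by (auto simp: over_k_def)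
qed (use is_subfieldD[OF k] in \<open>auto simp: over_k_def\<close>)

lemma ell_over_k: "poly_over k P \<Longrightarrow> ell P \<in> over_k"
proof (induction P)
  case (pCons u P)
  then have "u \<in> k" "poly_over k P" using poly_over_pConsD by auto
  moreover have "X \<in> over_k" using coeffs by (simp add: over_k_def)
  ultimately show ?case using pCons.IH by (simp add: ell_pCons over_k_closed)
qed (simp add: ell_hom over_k_closed)

text \<open>Residues at the place have to lie in \<open>k\<close>. After clearing denominators all
  coefficients do, and leading coefficients are multiplicative, which avoids inverting
  series.\<close>

lemma leading_coeff_in_k:
  assumes z: "z \<in> C"
  shows "fls_nth (hx z) (fls_subdegree (hx z)) \<in> k"
proof -
  obtain D P where D: "D \<noteq> 0" "poly_over k D" "\<And>i. i < p \<Longrightarrow> poly_over k (P i)"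
    "hx z * ell D = (\<Sum>i<p. ell (P i) * Y ^ i)"
    using clear_denominators[OF z] by metis
  have "Y \<in> over_k" using coeffs by (simp add: over_k_def)
  then have "(\<Sum>i<n. ell (P i) * Y ^ i) \<in> over_k" if "n \<le> p" for n
    using that D(3) ell_over_k by (induction n) (auto intro!: over_k_closed)
  then have "hx z * ell D \<in> over_k" using D(4) by simp
  then have "fls_nth (hx z) (fls_subdegree (hx z)) * fls_nth (ell D) (fls_subdegree (ell D)) \<in> k"
    unfolding fls_times_base[symmetric] unfolding over_k_def by blast
  moreover have "fls_nth (ell D) (fls_subdegree (ell D)) \<in> k" using ell_over_k[OF D(2)] by (simp add: over_k_def)
  moreover have "fls_nth (ell D) (fls_subdegree (ell D)) \<noteq> 0" using ell_nz[OF D(1)] by simp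
  ultimately show ?thesis using is_subfieldD(8)[OF k] by (metis nonzero_mult_div_cancel_right)
qed

text \<open>The zero function is included because \<open>fls_subdegree 0 = 0\<close>.\<close>

definition place :: "'a poly fract poly set" where
  "place = {z \<in> C. fls_subdegree (hx z) \<ge> 0}"

end

locale fls_place = fls_point p F k X Y + AS_field p F k for p and F :: "'a::field poly" and k X Y
begin

sublocale AS_evaluation p F k \<rho> Y
  by unfold_locales (use is_hom_\<rho> Y_AS in \<open>auto simp: \<rho>_to_fract ell_def\<close>)

text \<open>A function of positive order shows that the ring is proper, its inverse having a pole.
  The residue of a function in the ring is its coefficient at exponent 0.\<close>

lemma place_is_degree_one:
  assumes pos: "w \<in> C" "h w \<noteq> 0" "fls_subdegree (h w) > 0"
  shows "place \<in> degree_one_places K (const_K ` k)"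
  unfolding degree_one_place_iff h_consts
proof
  show "place \<subseteq> C" by (auto simp: place_def)
  define S where "S = h ` C"
  have S: "is_subfield S" unfolding S_def by (rule is_subfield_image)
  have eq: "h ` place = {s \<in> S. fls_subdegree s \<ge> 0}" by (auto simp: place_def S_def)
  have sub: "fls_subdegree (x - y) \<ge> 0" if "fls_subdegree x \<ge> 0" "fls_subdegree y \<ge> 0" for x y :: "'a fls"
    using that by (intro fls_subdegree_ge0I) auto
  have cS: "fls_const ` k \<subseteq> S" unfolding h_consts[symmetric] S_def using const_K_C by blast
  show "deg1_ring (h ` C) (fls_const ` k) (h ` place)"
    unfolding deg1_ring_def eq S_def[symmetric]
  proof (intro conjI ballI)
    have "inverse (h w) \<in> S" using pos(1) is_subfieldD(6)[OF S] by (auto simp: S_def)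
    moreover have "fls_subdegree (inverse (h w)) < 0" using pos by simp
    ultimately have "inverse (h w) \<in> S - {s \<in> S. fls_subdegree s \<ge> 0}" by (simp del: fls_inverse_subdegree)
    then show "{s \<in> S. fls_subdegree s \<ge> 0} \<noteq> S" by blast
    show "1 \<in> {s \<in> S. fls_subdegree s \<ge> 0}" using is_subfieldD(2)[OF S] by simp
    show "fls_const ` k \<subseteq> {s \<in> S. fls_subdegree s \<ge> 0}" using cS by auto
  next
    fix x y assume "x \<in> {s \<in> S. fls_subdegree s \<ge> 0}" "y \<in> {s \<in> S. fls_subdegree s \<ge> 0}"
    then show "x - y \<in> {s \<in> S. fls_subdegree s \<ge> 0}" "x * y \<in> {s \<in> S. fls_subdegree s \<ge> 0}"
      using sub is_subfieldD(5,7)[OF S] by (auto simp: fls_mult_subdegree_ge_0)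
  next
    fix x assume "x \<in> S"
    then show "x \<in> {s \<in> S. fls_subdegree s \<ge> 0} \<or> inverse x \<in> {s \<in> S. fls_subdegree s \<ge> 0}"
      using is_subfieldD(6)[OF S] by (cases "x = 0") auto
  next
    fix s assume s: "s \<in> {s \<in> S. fls_subdegree s \<ge> 0}"
    then obtain z where z: "z \<in> C" "s = h z" by (auto simp: S_def)
    define u where "u = fls_nth s 0"
    have "u \<in> k"
    proof (cases "fls_subdegree s = 0")
      case True
      then show ?thesis using leading_coeff_in_k[OF z(1)] z(2) by (simp add: u_def)
    next
      case False
      then show ?thesis using s is_subfieldD(1)[OF k] by (simp add: u_def)
    qed
    have "s = fls_const u \<or> fls_subdegree (s - fls_const u) > 0"
    proof (cases "s - fls_const u = 0")
      case False
      have "fls_nth (s - fls_const u) n = 0" if "n < 1" for n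
        using s that by (cases "n = 0") (auto simp: u_def)
      then have "fls_subdegree (s - fls_const u) \<ge> 1" using False by (intro fls_subdegree_geI)
      then show ?thesis by simp
    qed simp
    then have "s = fls_const u \<or> inverse (s - fls_const u) \<notin> {s \<in> S. fls_subdegree s \<ge> 0}"
      by auto
    then show "\<exists>u\<in>fls_const ` k. s = u \<or> inverse (s - u) \<notin> {s \<in> S. fls_subdegree s \<ge> 0}"
      using \<open>u \<in> k\<close> by blast
  qed auto
qed

lemma place_in_image:
  assumes "V \<in> degree_one_places K (const_K ` k)"
  shows "place_in (h ` C) (fls_const ` k) (h ` V)"
proof
  show "is_subfield (h ` C)" by (rule is_subfield_image)
  show "deg1_ring (h ` C) (fls_const ` k) (h ` V)" using assms unfolding degree_one_place_iff h_consts by blast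
  have inv: "inverse (fls_const u) = fls_const (inverse u)" for u :: 'a by (simp add: fls_inverse_const)
  show "is_subfield (fls_const ` k :: 'a fls set)"
    unfolding is_subfield_def
  proof (intro conjI ballI)
    show "0 \<in> fls_const ` k" "1 \<in> fls_const ` k"
      using is_subfieldD(1,2)[OF k] fls_const_0 fls_const_1 by (metis imageI)+
    fix x assume "x \<in> fls_const ` k"
    then obtain u where u: "u \<in> k" "x = fls_const u" by blast
    have "- x = fls_const (- u)" unfolding u(2) by (intro fls_eqI) simp
    then show "- x \<in> fls_const ` k" using is_subfieldD(4)[OF k u(1)] by blast
    show "inverse x \<in> fls_const ` k" using is_subfieldD(6)[OF k u(1)] u(2) inv by blast
    fix y assume "y \<in> fls_const ` k"
    then obtain v where v: "v \<in> k" "y = fls_const v" by blast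
    show "x + y \<in> fls_const ` k" "x * y \<in> fls_const ` k"
      using is_subfieldD(3,5)[OF k u(1) v(1)] u(2) v(2) by (auto simp: fls_plus_const)
  qed
qed

lemma place_eqI:
  assumes "V \<in> degree_one_places K (const_K ` k)" "\<And>s. s \<in> h ` C \<Longrightarrow> s \<in> h ` V \<longleftrightarrow> fls_subdegree s \<ge> 0"
  shows "V = place"
proof -
  have VC: "V \<subseteq> C" using assms(1) degree_one_place_iff by blast
  have "z \<in> V \<longleftrightarrow> fls_subdegree (h z) \<ge> 0" if "z \<in> C" for z
    using assms(2)[of "h z"] h_mem[OF VC that] that by simp
  then show ?thesis using VC by (auto simp: place_def)
qed

end

section \<open>Uniqueness of the place over an affine point and at infinity\<close>

inductive_set ring_generated :: "'b::comm_ring_1 set \<Rightarrow> 'b \<Rightarrow> 'b \<Rightarrow> 'b set" for c X Y where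
  const: "u \<in> c \<Longrightarrow> u \<in> ring_generated c X Y"
| X: "X \<in> ring_generated c X Y"
| Y: "Y \<in> ring_generated c X Y"
| add: "x \<in> ring_generated c X Y \<Longrightarrow> y \<in> ring_generated c X Y \<Longrightarrow> x + y \<in> ring_generated c X Y"
| mult: "x \<in> ring_generated c X Y \<Longrightarrow> y \<in> ring_generated c X Y \<Longrightarrow> x * y \<in> ring_generated c X Y"

text \<open>Expansion to first order at (x0, y0), with the cofactors kept inside the ring.\<close>

lemma ring_generated_expand:
  assumes c: "is_subfield c" "x0 \<in> c" "y0 \<in> c" and z: "z \<in> ring_generated c X Y"
  shows "\<exists>u\<in>c. \<exists>z1\<in>ring_generated c X Y. \<exists>z2\<in>ring_generated c X Y. z = u + (X - x0) * z1 + (Y - y0) * z2"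
  using z
proof induction
  case (const u)
  moreover have "0 \<in> ring_generated c X Y" by (rule ring_generated.const[OF is_subfieldD(1)[OF c(1)]])
  ultimately show ?case by (intro bexI[of _ u] bexI[of _ 0]) auto
next
  case X
  have "0 \<in> ring_generated c X Y" "1 \<in> ring_generated c X Y"
    by (rule ring_generated.const[OF is_subfieldD(1)[OF c(1)]], rule ring_generated.const[OF is_subfieldD(2)[OF c(1)]])
  then show ?case using c(2) by (intro bexI[of _ x0] bexI[of _ 1] bexI[of _ 0]) auto
next
  case Y
  have "0 \<in> ring_generated c X Y" "1 \<in> ring_generated c X Y"
    by (rule ring_generated.const[OF is_subfieldD(1)[OF c(1)]], rule ring_generated.const[OF is_subfieldD(2)[OF c(1)]])
  then show ?case using c(3) by (intro bexI[of _ y0] bexI[of _ 0] bexI[of _ 1]) auto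
next
  case (add x y)
  then obtain u z1 z2 v w1 w2 where *: "u \<in> c" "z1 \<in> ring_generated c X Y" "z2 \<in> ring_generated c X Y"
    "x = u + (X - x0) * z1 + (Y - y0) * z2" "v \<in> c" "w1 \<in> ring_generated c X Y" "w2 \<in> ring_generated c X Y"
    "y = v + (X - x0) * w1 + (Y - y0) * w2" by blast
  have "x + y = (u + v) + (X - x0) * (z1 + w1) + (Y - y0) * (z2 + w2)"
    unfolding *(4,8) by (simp add: algebra_simps)
  then show ?case
    using is_subfieldD(3)[OF c(1) *(1,5)] ring_generated.add[OF *(2,6)] ring_generated.add[OF *(3,7)] by blast
next
  case (mult x y)
  then obtain u z1 z2 v w1 w2 where *: "u \<in> c" "z1 \<in> ring_generated c X Y" "z2 \<in> ring_generated c X Y"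
    "x = u + (X - x0) * z1 + (Y - y0) * z2" "v \<in> c" "w1 \<in> ring_generated c X Y" "w2 \<in> ring_generated c X Y"
    "y = v + (X - x0) * w1 + (Y - y0) * w2" by blast
  have "x * y = u * y + (X - x0) * (z1 * y) + (Y - y0) * (z2 * y)"
    unfolding *(4) by (simp add: algebra_simps)
  also have "u * y = u * v + (X - x0) * (u * w1) + (Y - y0) * (u * w2)"
    unfolding *(8) by (simp add: algebra_simps)
  finally have "x * y = u * v + (X - x0) * (u * w1 + z1 * y) + (Y - y0) * (u * w2 + z2 * y)"
    by (simp add: algebra_simps)
  moreover have "u * w1 + z1 * y \<in> ring_generated c X Y" "u * w2 + z2 * y \<in> ring_generated c X Y"
    using ring_generated.const[OF *(1)] mult(2) * by (auto intro!: ring_generated.add ring_generated.mult)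
  ultimately show ?case using is_subfieldD(5)[OF c(1) *(1,5)] by blast
qed

lemma ring_generated_power: "z \<in> ring_generated c X Y \<Longrightarrow> 1 \<in> c \<Longrightarrow> z ^ n \<in> ring_generated c X Y"
  by (induction n) (auto intro: ring_generated.intros)

text \<open>As \<open>X\<close> has a pole, the term of highest degree dominates; in particular
  \<open>X\<close> is transcendental.\<close>

lemma eval_fls_pole:
  assumes X: "fls_subdegree X < 0" and P: "P \<noteq> (0 :: 'a::field poly)"
  shows "eval_hom fls_const X P \<noteq> 0 \<and> fls_subdegree (eval_hom fls_const X P) = int (degree P) * fls_subdegree X"
  using P
proof (induction P)
  case (pCons u P)
  show ?case
  proof (cases "P = 0")
    case True
    then show ?thesis using pCons.hyps fls_const_nonzero
      by (simp add: eval_hom_pCons[OF is_hom_fls_const])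
  next
    case False
    then have IH: "eval_hom fls_const X P \<noteq> 0"
      "fls_subdegree (eval_hom fls_const X P) = int (degree P) * fls_subdegree X" using pCons by auto
    have X0: "X \<noteq> 0" using X by auto
    let ?Q = "X * eval_hom fls_const X P"
    have Q: "?Q \<noteq> 0" "fls_subdegree ?Q = int (degree P + 1) * fls_subdegree X"
      using IH X0 by (simp_all add: algebra_simps)
    have "int (degree P + 1) * fls_subdegree X < 0" using X by (intro mult_pos_neg) auto
    then have lt: "fls_subdegree ?Q < fls_subdegree (fls_const u)" using Q by simp
    have "?Q + fls_const u \<noteq> 0"
    proof
      assume "?Q + fls_const u = 0"
      then have "?Q = - fls_const u" by (simp add: eq_neg_iff_add_eq_0)
      then show False using lt by simp
    qed
    moreover have "fls_subdegree (?Q + fls_const u) = fls_subdegree ?Q"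
      by (rule fls_subdegree_add_eq1[OF Q(1) lt])
    ultimately show ?thesis using Q False
      by (simp add: eval_hom_pCons[OF is_hom_fls_const] add.commute)
  qed
qed simp

context fls_point begin

lemma ell_pole:
  "fls_subdegree X < 0 \<Longrightarrow> P \<noteq> 0 \<Longrightarrow> fls_subdegree (ell P) = int (degree P) * fls_subdegree X"
  using eval_fls_pole[of X P] by (simp add: ell_def)

lemma pole_imp_field:
  assumes X: "fls_subdegree X = - int p" and Y: "fls_subdegree Y = - int N" and N: "coprime N p" "N > 0"
  shows "AS_field p F k"
proof -
  have Y0: "Y \<noteq> 0" using Y N by auto
  have nz: "hx z \<noteq> 0" if z: "z \<in> C" "z \<noteq> 0" for z
  proof -
    obtain D P where D: "D \<noteq> 0" "poly_over k D" "\<And>i. i < p \<Longrightarrow> poly_over k (P i)"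
      "\<And>i. i < p \<Longrightarrow> coeff z i * to_fract D = to_fract (P i)"
      "hx z * ell D = (\<Sum>i<p. ell (P i) * Y ^ i)"
      by (rule clear_denominators[OF z(1)], rule that) auto
    define f where "f i = ell (P i) * Y ^ i" for i
    have f: "f i = 0 \<or> f i \<in> UNIV - {0} \<and> int p dvd fls_subdegree (f i) + int (i * N)" for i
    proof (cases "P i = 0")
      case False
      have "fls_subdegree (f i) = int (degree (P i)) * (- int p) + int i * (- int N)"
        using Y0 ell_nz[OF False] ell_pole[OF _ False] X p_gt_1
        by (simp add: f_def fls_subdegree_pow Y)
      then have "fls_subdegree (f i) + int (i * N) = int p * (- int (degree (P i)))" by simp
      moreover have "f i \<noteq> 0" using Y0 ell_nz[OF False] by (simp add: f_def)
      ultimately show ?thesis by (metis DiffI UNIV_I dvd_triv_left singletonD)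
    qed (simp add: f_def ell_hom)
    have "(\<forall>i<p. f i = 0) \<or> (\<Sum>i<p. f i) \<in> UNIV - {0} \<and> (\<exists>i<p. int p dvd fls_subdegree (\<Sum>i<p. f i) + int (i * N))"
    proof (rule sum_distinct_subdegrees[OF _ _ N(1) order.refl f])
      fix z w :: "'a fls" assume "z \<in> UNIV - {0}" "w \<in> UNIV - {0}" "fls_subdegree z < fls_subdegree w"
      then show "z + w \<in> UNIV - {0}" by (auto simp: add_eq_0_iff)
    qed auto
    \<comment> \<open>The leading coefficient of \<open>z\<close> excludes the alternative that all
      terms vanish.\<close>
    moreover have "f (degree z) \<noteq> 0"
    proof -
      have dz: "degree z < p" using z by (simp add: C_def)
      have "coeff z (degree z) * to_fract D \<noteq> 0" using z D(1) by simp
      then have "P (degree z) \<noteq> 0" using D(4)[OF dz] by auto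
      then show ?thesis using Y0 ell_nz by (simp add: f_def)
    qed
    moreover have "degree z < p" using z by (simp add: C_def)
    ultimately have "(\<Sum>i<p. f i) \<noteq> 0" by blast
    then show ?thesis using D(5) by (auto simp: f_def)
  qed
  show ?thesis
  proof
    fix z w assume zw: "z \<in> C" "w \<in> C" "z \<noteq> 0" "w \<noteq> 0"
    have "hx ((z * w) mod G) = hx z * hx w"
      using ev_AS[OF is_hom_\<rho>, of Y "z * w"] Y_AS
      by (simp add: \<rho>_to_fract ell_def) (simp add: ev_def is_homD[OF is_hom_eval_hom[OF is_hom_\<rho>]])
    then have "hx ((z * w) mod G) \<noteq> 0" using nz zw by simp
    moreover have "hx 0 = 0" by (simp add: ev_def)
    ultimately show "(z * w) mod G \<noteq> 0" by metis
  qed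
qed

end

context fls_place begin

lemma image_quotient:
  assumes "s \<in> h ` C"
  obtains P Q where "P \<in> ring_generated (fls_const ` k) X Y" "Q \<in> ring_generated (fls_const ` k) X Y" "Q \<noteq> 0" "s * Q = P"
proof -
  let ?A = "ring_generated (fls_const ` k) X Y"
  obtain z where z: "z \<in> C" "s = h z" using assms by blast
  obtain D P where D: "D \<noteq> 0" "poly_over k D" "\<And>i. i < p \<Longrightarrow> poly_over k (P i)"
    "h z * ell D = (\<Sum>i<p. ell (P i) * Y ^ i)"
    using clear_denominators[OF z(1)] by metis
  have c01: "0 \<in> fls_const ` k" "1 \<in> fls_const ` k"
    using is_subfieldD(1,2)[OF k] fls_const_0 fls_const_1 by (metis imageI)+
  have ell: "ell P \<in> ?A" if "poly_over k P" for P
    using that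
  proof (induction P)
    case (pCons u P)
    then have "u \<in> k" "ell P \<in> ?A" using poly_over_pConsD by auto
    then show ?case
      unfolding ell_pCons by (intro ring_generated.add[OF ring_generated.const ring_generated.mult[OF ring_generated.X]]) auto
  qed (use c01 in \<open>simp add: ell_hom ring_generated.const\<close>)
  have "(\<Sum>i<n. ell (P i) * Y ^ i) \<in> ?A" if "n \<le> p" for n
    using that
  proof (induction n)
    case (Suc n)
    then show ?case using ell[OF D(3)[of n]] ring_generated_power[OF ring_generated.Y c01(2)]
      by (auto intro!: ring_generated.add ring_generated.mult)
  qed (use c01 in \<open>simp add: ring_generated.const\<close>)
  then show ?thesis using that[of "\<Sum>i<p. ell (P i) * Y ^ i" "ell D"] D ell ell_nz z(2) by simp
qed

text \<open>At an affine point the ideal of the point is generated in the local ring by the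
  uniformizer \<open>X - x0\<close>, because \<open>Y - y0\<close> times a unit is a multiple of it. Hence every
  polynomial is a power of the uniformizer times an element that is a unit at every place
  over the point.\<close>

lemma affine_place_unique:
  assumes X: "X = fls_const x0 + fls_X" and Y: "Y - fls_const y0 = 0 \<or> fls_subdegree (Y - fls_const y0) > 0"
    and xy: "x0 \<in> k" "y0 \<in> k" "y0 ^ p - y0 = poly F x0"
    and frob: "(Y - fls_const y0) ^ p = Y ^ p - fls_const y0 ^ p"
    and W: "place \<in> degree_one_places K (const_K ` k)"
    and V: "V \<in> degree_one_places K (const_K ` k)"
    and M: "X - fls_const x0 \<in> place_in.M (h ` V)" "Y - fls_const y0 \<in> place_in.M (h ` V)"
  shows "V = place"
proof -
  define S where "S = h ` C"
  define c where "c = (fls_const ` k :: 'a fls set)"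
  interpret v: place_in S c "h ` V" unfolding S_def c_def by (rule place_in_image[OF V])
  interpret w: place_in S c "h ` place" unfolding S_def c_def by (rule place_in_image[OF W])
  have hW: "s \<in> h ` place \<longleftrightarrow> s \<in> S \<and> fls_subdegree s \<ge> 0" for s by (auto simp: place_def S_def)
  have wM: "s \<in> w.M \<longleftrightarrow> s \<in> S \<and> (s = 0 \<or> fls_subdegree s > 0)" for s
    using is_subfieldD(6)[OF v.S, of s] by (auto simp: w.M_def hW)
  have wU: "s \<in> w.U \<Longrightarrow> fls_subdegree s = 0" for s by (auto simp: w.U_def hW)
  let ?A = "ring_generated c X Y"
  let ?t = "X - fls_const x0" and ?y = "Y - fls_const y0"
  have t: "?t = fls_X" by (simp add: X)
  have xyc: "fls_const x0 \<in> c" "fls_const y0 \<in> c" using xy by (auto simp: c_def)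
  have vM: "?t \<in> v.M" "?y \<in> v.M" using M by (auto simp: v.M_def place_in.M_def[OF v.place_in_axioms])
  have wMt: "?t \<in> w.M" "?y \<in> w.M" using vM[THEN v.M_V, THEN v.V_S] Y by (auto simp: wM t)
  have AV: "z \<in> h ` V \<and> z \<in> h ` place" if "z \<in> ?A" for z
    using that
  proof induction
    case (const u)
    then show ?case using v.VD(6) w.VD(6) by blast
  next
    case X
    have "?t + fls_const x0 \<in> h ` V" "?t + fls_const x0 \<in> h ` place"
      by (intro v.V_closed(4) v.M_V vM subsetD[OF v.VD(6)] xyc) (intro w.V_closed(4) w.M_V wMt subsetD[OF w.VD(6)] xyc)
    then show ?case by simp
  next
    case Y
    have "?y + fls_const y0 \<in> h ` V" "?y + fls_const y0 \<in> h ` place"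
      by (intro v.V_closed(4) v.M_V vM subsetD[OF v.VD(6)] xyc) (intro w.V_closed(4) w.M_V wMt subsetD[OF w.VD(6)] xyc)
    then show ?case by simp
  qed (auto intro: v.V_closed w.V_closed)
  \<comment> \<open>\<open>g\<close> is -1 plus an element of the maximal ideal, hence a unit at
    both places, and \<open>?y * g = ?y ^ p - ?y\<close> is a multiple of \<open>?t\<close> by the
    equation of the curve.\<close>
  define g where "g = ?y ^ (p - 1) - 1"
  have p1: "p - 1 \<ge> 1" using p_gt_1 by simp
  have "- 1 + ?y ^ (p - 1) \<in> v.U" "- 1 + ?y ^ (p - 1) \<in> w.U"
    by (intro v.U_plus_M v.U_closed v.M_power vM p1) (intro w.U_plus_M w.U_closed w.M_power wMt p1)
  then have g: "g \<in> v.U" "g \<in> w.U" by (simp_all add: g_def)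
  have c1: "1 \<in> c" "- 1 \<in> c" using is_subfieldD(2,4)[OF v.c] by auto
  have yA: "?y \<in> ?A"
    using ring_generated.add[where X = X and Y = Y, OF ring_generated.Y ring_generated.const[OF is_subfieldD(4)[OF v.c xyc(2)]]] by simp
  have gA: "g \<in> ?A"
    using ring_generated.add[OF ring_generated_power[OF yA c1(1), of "p - 1"] ring_generated.const[OF c1(2)]]
    by (simp add: g_def)
  obtain f where f: "f \<in> ?A" "?y * g = ?t * f"
  proof -
    have "\<exists>f\<in>?A. ell P = fls_const (poly P x0) + ?t * f" if "poly_over k P" for P
      using that
    proof (induction P)
      case 0
      show ?case using ring_generated.const[OF is_subfieldD(1)[OF v.c]] by (intro bexI[of _ 0]) (simp_all add: ell_hom)
    next
      case (pCons u P)
      then have u: "u \<in> k" "poly_over k P" using poly_over_pConsD by auto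
      then obtain f where f: "f \<in> ?A" "ell P = fls_const (poly P x0) + ?t * f" using pCons.IH by blast
      have "ell (pCons u P) = fls_const u + (?t + fls_const x0) * ell P" by (simp add: ell_pCons)
      also have "\<dots> = (fls_const u + fls_const x0 * fls_const (poly P x0)) + ?t * (ell P + fls_const x0 * f)"
        by (subst (1) f(2)) (simp add: f(2) algebra_simps)
      finally have eq: "ell (pCons u P) = fls_const (poly (pCons u P) x0) + ?t * (ell P + fls_const x0 * f)"
        by (simp add: fls_plus_const)
      have "fls_const (poly P x0) \<in> c" using poly_over_poly[OF k u(2) xy(1)] by (simp add: c_def)
      moreover have "?t \<in> ?A"
        using ring_generated.add[where X = X and Y = Y, OF ring_generated.X ring_generated.const[OF is_subfieldD(4)[OF v.c xyc(1)]]] by simp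
      ultimately have "ell P \<in> ?A" unfolding f(2) using f(1)
        by (intro ring_generated.add[OF ring_generated.const ring_generated.mult])
      then have "ell P + fls_const x0 * f \<in> ?A"
        using f(1) xyc by (intro ring_generated.add[OF _ ring_generated.mult[OF ring_generated.const]])
      then show ?case using eq by blast
    qed
    then obtain f where f: "f \<in> ?A" "ell F = fls_const (poly F x0) + ?t * f" using F by blast
    have "?y * g = ?y ^ p - ?y"
    proof -
      have "?y ^ p = ?y * ?y ^ (p - 1)" using p_gt_1 by (simp flip: power_Suc)
      then show ?thesis by (simp add: g_def algebra_simps)
    qed
    \<comment> \<open>The locale does not tie \<open>p\<close> to the characteristic, so additivity
      of the power enters through \<open>frob\<close>.\<close>
    also have "\<dots> = (Y ^ p - Y) - (fls_const y0 ^ p - fls_const y0)" by (simp add: frob)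
    also have "fls_const y0 ^ p - fls_const y0 = fls_const (poly F x0)"
    proof -
      have "fls_const (y0 ^ p - y0) = fls_const y0 ^ p - fls_const y0"
        unfolding fls_const_power[symmetric] by (intro fls_eqI) simp
      then show ?thesis using xy(3) by simp
    qed
    also have "Y ^ p - Y = ell F" using Y_AS by (simp add: \<rho>_to_fract)
    finally show ?thesis using f that by simp
  qed
  \<comment> \<open>Induction on the order. With a nonzero constant term \<open>z\<close> is a unit;
    otherwise \<open>g * z\<close> is \<open>?t\<close> times an element of order one less. The
    factor \<open>u\<close> is a unit for \<open>V\<close> and for \<open>place\<close> at once,
    which ties membership in \<open>V\<close> to the order.\<close>
  have main: "\<exists>u. u \<in> v.U \<and> u \<in> w.U \<and> z = ?t ^ n * u" if "z \<in> ?A" "z \<noteq> 0" "fls_subdegree z = int n" for z n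
    using that
  proof (induction n arbitrary: z rule: less_induct)
    case (less n)
    obtain u z1 z2 where z: "u \<in> c" "z1 \<in> ?A" "z2 \<in> ?A" "z = u + ?t * z1 + ?y * z2"
      using ring_generated_expand[OF v.c xyc less.prems(1)] by blast
    show ?case
    proof (cases "u = 0")
      case False
      have "u + (z1 * ?t + z2 * ?y) \<in> v.U" "u + (z1 * ?t + z2 * ?y) \<in> w.U"
        using AV[OF z(2)] AV[OF z(3)]
          v.U_plus_M[OF v.const_U[OF z(1) False] v.M_add[OF v.M_mult[OF _ vM(1), of z1] v.M_mult[OF _ vM(2), of z2]]]
          w.U_plus_M[OF w.const_U[OF z(1) False] w.M_add[OF w.M_mult[OF _ wMt(1), of z1] w.M_mult[OF _ wMt(2), of z2]]]
        by blast+
      moreover have "z = u + (z1 * ?t + z2 * ?y)" using z(4) by (simp add: algebra_simps)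
      ultimately have "z \<in> v.U" "z \<in> w.U" by (simp_all only:)
      moreover have "n = 0" using wU[OF \<open>z \<in> w.U\<close>] less.prems(3) by simp
      ultimately show ?thesis by auto
    next
      case True
      define z' where "z' = g * z1 + f * z2"
      have z': "z' \<in> ?A" unfolding z'_def using gA f(1) z by (intro ring_generated.add ring_generated.mult)
      have gz: "g * z = ?t * z'"
      proof -
        have "z = ?t * z1 + ?y * z2" using True z(4) by simp
        then have "g * z = g * (?t * z1 + ?y * z2)" by (rule arg_cong)
        also have "\<dots> = ?t * (g * z1) + (?y * g) * z2" by (simp only: distrib_left mult_ac)
        finally have "g * z = ?t * (g * z1) + (?y * g) * z2" .
        then show ?thesis by (simp only: f(2)) (simp add: z'_def algebra_simps)
      qed
      have g0: "g \<noteq> 0" using g(1) by (simp add: v.U_def)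
      have z'0: "z' \<noteq> 0" using gz g0 less.prems(2) by auto
      have "fls_subdegree (g * z) = fls_subdegree (?t * z')" by (simp only: gz)
      then have sd: "int n = 1 + fls_subdegree z'"
        using g0 less.prems z'0 wU[OF g(2)] unfolding t by simp
      have "fls_subdegree z' \<ge> 0" using AV[OF z'] hW by blast
      then have n: "n = Suc (nat (fls_subdegree z'))" "fls_subdegree z' = int (n - 1)" "n - 1 < n" using sd by auto
      obtain u' where u': "u' \<in> v.U" "u' \<in> w.U" "z' = ?t ^ (n - 1) * u'"
        using less.IH[OF n(3) z' z'0 n(2)] by blast
      have "z = ?t * z' * inverse g" using gz g0 by (simp add: field_simps)
      also have "\<dots> = ?t ^ n * (u' * inverse g)" using n(1) by (simp add: u'(3) flip: power_Suc)
      finally have "z = ?t ^ n * (u' * inverse g)" .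
      moreover have "u' * inverse g \<in> v.U" "u' * inverse g \<in> w.U"
        using u' g by (auto intro: v.U_closed w.U_closed)
      ultimately show ?thesis by blast
    qed
  qed
  show ?thesis
  proof (rule place_eqI[OF V])
    fix s assume s: "s \<in> h ` C"
    show "s \<in> h ` V \<longleftrightarrow> fls_subdegree s \<ge> 0"
    proof (cases "s = 0")
      case True
      then show ?thesis using v.V_closed(1) by simp
    next
      case False
      obtain P Q where PQ: "P \<in> ?A" "Q \<in> ?A" "Q \<noteq> 0" "s * Q = P" using image_quotient[OF s] unfolding c_def by metis
      have P0: "P \<noteq> 0" using PQ False by auto
      have "fls_subdegree P \<ge> 0" "fls_subdegree Q \<ge> 0" using AV PQ hW by blast+
      then obtain n m where nm: "fls_subdegree P = int n" "fls_subdegree Q = int m" by (metis nonneg_int_cases)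
      obtain u where u: "u \<in> v.U" "P = ?t ^ n * u" using main[OF PQ(1) P0 nm(1)] by blast
      obtain u' where u': "u' \<in> v.U" "Q = ?t ^ m * u'" using main[OF PQ(2,3) nm(2)] by blast
      have sd: "fls_subdegree s = int n - int m" using PQ(4) nm False PQ(3) by (metis add_diff_cancel_right' fls_subdegree_mult)
      have t0: "?t \<noteq> 0" unfolding t by simp
      have s_eq: "s = (?t ^ n * u) / (?t ^ m * u')" using PQ(3,4) u(2) u'(2) by (metis nonzero_mult_div_cancel_right)
      show ?thesis
      proof (cases "m \<le> n")
        case True
        have "s = ?t ^ (n - m) * (u * inverse u')" using t0 True by (simp add: s_eq power_diff field_simps)
        moreover have "?t ^ (n - m) * (u * inverse u') \<in> h ` V"
          using u(1) u'(1) by (intro v.V_closed v.U_V[OF v.U_closed(2)] v.U_closed(3) v.M_V vM)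
        ultimately show ?thesis using sd True by simp
      next
        case lt: False
        have u0: "u \<noteq> 0" "u' \<noteq> 0" using u(1) u'(1) by (auto simp: v.U_def)
        have "inverse s = (u' * inverse u) * ?t ^ (m - n)" using t0 lt u0 by (simp add: s_eq power_diff field_simps)
        moreover have "(u' * inverse u) * ?t ^ (m - n) \<in> v.M"
          using u(1) u'(1) lt by (intro v.M_mult v.M_power vM v.U_V v.U_closed) auto
        ultimately have "inverse s \<in> v.M" by (simp only:)
        then have "inverse s = 0 \<or> inverse (inverse s) \<notin> h ` V" unfolding v.M_def by blast
        then have "s \<notin> h ` V" using False by simp
        then show ?thesis using sd lt by simp
      qed
    qed
  qed
qed

lemma Y_in_image: "Y \<in> h ` C" using y_C h_y by (metis imageI)
lemma ell_in_image: "poly_over k P \<Longrightarrow> ell P \<in> h ` C" using to_fract_C h_poly by (metis imageI)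

lemma X_in_image: "X \<in> h ` C"
proof -
  have "poly_over k [:0, 1:]"
    using poly_over_intros(9)[OF k is_subfieldD(1)[OF k] poly_over_intros(2)[OF k]] by (simp add: one_pCons)
  then show ?thesis using ell_in_image ell_X by metis
qed

text \<open>At a pole of \<open>X\<close> every function is determined up to a unit by its degree: its \<open>p\<close>-th power
  is a power of \<open>X\<close> times a unit. This is inherited by sums whose terms have different degrees.\<close>

lemma infinite_place_unique:
  assumes X: "fls_subdegree X = - int p" and Y: "fls_subdegree Y = - int N" and N: "coprime N p" "degree F = N" "N > 0"
    and V: "V \<in> degree_one_places K (const_K ` k)" and XV: "X \<notin> h ` V"
  shows "V = place"
proof -
  define S where "S = h ` C"
  define c where "c = (fls_const ` k :: 'a fls set)"
  interpret v: place_in S c "h ` V" unfolding S_def c_def by (rule place_in_image[OF V])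
  note SD = is_subfieldD[OF v.S]
  have XS: "X \<in> S" and YS: "Y \<in> S" using X_in_image Y_in_image by (simp_all add: S_def)
  have p1: "p \<ge> 1" using p_gt_1 by simp
  have X0: "X \<noteq> 0" using X p1 by auto
  have Y0: "Y \<noteq> 0" using Y N by auto
  have F0: "F \<noteq> 0" using N by auto
  have iX: "inverse X \<in> v.M" using v.inverse_M[OF XS] XV by simp
  have powi_S: "X powi i \<in> S" for i using SD(6,9) XS by (auto simp: power_int_def)
  \<comment> \<open>Since \<open>X\<close> has order -p, z^p X^(ord z) has order 0; \<open>T\<close>
    asks it to be a unit of \<open>V\<close>. The exponent needs \<open>powi\<close> because orders
    may be negative.\<close>
  define T where "T = {z \<in> S. z \<noteq> 0 \<and> z ^ p * X powi fls_subdegree z \<in> v.U}"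
  have T_mult: "z * w \<in> T" if "z \<in> T" "w \<in> T" for z w
  proof -
    have "(z * w) ^ p * X powi fls_subdegree (z * w) =
        (z ^ p * X powi fls_subdegree z) * (w ^ p * X powi fls_subdegree w)"
      using that X0 by (simp add: T_def power_mult_distrib power_int_add mult_ac)
    then show ?thesis using that v.U_closed(2) SD(5) by (simp add: T_def)
  qed
  have T_inv: "inverse z \<in> T" if "z \<in> T" for z
  proof -
    have "(inverse z) ^ p * X powi fls_subdegree (inverse z) = inverse (z ^ p * X powi fls_subdegree z)"
      using that by (simp add: T_def power_inverse power_int_minus)
    then show ?thesis using that v.U_closed(3)[of "z ^ p * X powi fls_subdegree z"] SD(6)
      by (simp add: T_def del: inverse_mult_distrib)
  qed
  have T_pos: "z \<in> v.M" if z: "z \<in> T" "fls_subdegree z > 0" for z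
  proof -
    obtain n where n: "fls_subdegree z = int n" "n \<ge> 1"
      using z(2) by (metis One_nat_def Suc_leI of_nat_0_less_iff zero_less_imp_eq_int)
    have "(z ^ p * X ^ n) * inverse X ^ n = z ^ p" using X0 by (simp add: power_inverse)
    moreover have "(z ^ p * X ^ n) * inverse X ^ n \<in> v.M"
      using z(1) n by (intro v.M_mult v.M_power iX v.U_V) (auto simp: T_def)
    ultimately have "z ^ p \<in> v.M" by (simp only:)
    then show ?thesis using v.power_M_D[OF _ p1] z(1) by (simp add: T_def)
  qed
  have T_sd0: "z \<in> T" if "z \<in> v.U" "fls_subdegree z = 0" for z
    using that v.U_closed(4) v.U_V[THEN v.V_S] by (auto simp: T_def v.U_def)
  have T_add: "z + w \<in> T" if z: "z \<in> T" and w: "w \<in> T" and lt: "fls_subdegree z < fls_subdegree w" for z w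
  proof -
    have z0: "z \<noteq> 0" and w0: "w \<noteq> 0" using z w by (auto simp: T_def)
    have sd: "fls_subdegree (w * inverse z) > 0" using z0 w0 lt by simp
    have "1 + w * inverse z \<in> v.U"
      by (intro v.U_plus_M v.U_closed(1) T_pos T_mult w T_inv z sd)
    moreover have "fls_subdegree (1 + w * inverse z) = 0"
      using fls_subdegree_add_eq1[of 1 "w * inverse z"] sd by simp
    ultimately have "1 + w * inverse z \<in> T" by (rule T_sd0)
    then have "z * (1 + w * inverse z) \<in> T" using z by (intro T_mult)
    moreover have "z * (1 + w * inverse z) = z + w" using z0 by (simp add: field_simps)
    ultimately show ?thesis by simp
  qed
  have T_X: "X \<in> T" using X0 XS v.U_closed(1) by (simp add: T_def X power_int_minus)
  have T_const: "fls_const u \<in> T" if "u \<in> k" "u \<noteq> 0" for u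
    using that by (intro T_sd0 v.const_U) (auto simp: c_def fls_const_nonzero)
  have T_ell: "ell P \<in> T" if "poly_over k P" "P \<noteq> 0" for P
    using that
  proof (induction P)
    case (pCons u P)
    then have uP: "u \<in> k" "poly_over k P" using poly_over_pConsD by auto
    show ?case
    proof (cases "P = 0")
      case True
      then show ?thesis using pCons.hyps T_const[OF uP(1)] by (simp add: ell_const)
    next
      case False
      then have P: "X * ell P \<in> T" using T_mult[OF T_X pCons.IH[OF uP(2)]] by simp
      show ?thesis
      proof (cases "u = 0")
        case True
        then show ?thesis using P by (simp add: ell_pCons)
      next
        case u0: False
        have "fls_subdegree (X * ell P) = - int p + int (degree P) * (- int p)"
          using ell_pole[OF _ False] ell_nz[OF False] X0 X p1 by simp
        also have "\<dots> < 0" using p1 mult_nonneg_nonneg[of "int (degree P)" "int p"] unfolding mult_minus_right by linarith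
        finally have "X * ell P + fls_const u \<in> T" by (intro T_add P T_const uP u0) simp
        then show ?thesis by (simp add: ell_pCons add.commute)
      qed
    qed
  qed simp
  have T_V: "z \<in> h ` V \<longleftrightarrow> fls_subdegree z \<ge> 0" if z: "z \<in> T" for z
  proof (cases "fls_subdegree z < 0")
    case True
    have z0: "z \<noteq> 0" using z by (simp add: T_def)
    have "inverse z \<in> v.M" using True z0 by (intro T_pos T_inv z) simp
    then have "inverse z = 0 \<or> inverse (inverse z) \<notin> h ` V" unfolding v.M_def by blast
    then show ?thesis using z0 True by simp
  next
    case False
    show ?thesis
    proof (cases "fls_subdegree z = 0")
      case True
      then have "z ^ p \<in> v.U" using z by (simp add: T_def)
      then have "z \<in> h ` V" using v.power_U_D[OF _ p1] v.U_V z by (auto simp: T_def)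
      then show ?thesis using True by simp
    next
      case ne: False
      then have "z \<in> h ` V" using T_pos[OF z] v.M_V False by simp
      then show ?thesis using False by simp
    qed
  qed
  have eF: "ell F = Y ^ p - Y" using Y_AS by (simp add: \<rho>_to_fract)
  have sdF: "fls_subdegree (ell F) = - int (N * p)"
    using ell_pole[OF _ F0] X p1 N by simp
  have FT: "ell F \<in> T" using T_ell[OF F F0] .
  \<comment> \<open>F(X) lies in \<open>T\<close> and has a pole, so it is not in \<open>V\<close>;
    being Y^p - Y, it would be if \<open>Y\<close> were.\<close>
  have YV: "Y \<notin> h ` V"
  proof
    assume "Y \<in> h ` V"
    then have "ell F \<in> h ` V" unfolding eF by (intro v.V_closed)
    then have "int (N * p) \<le> 0" using T_V[OF FT] sdF by simp
    moreover have "N * p > 0" using N(3) p1 by simp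
    ultimately show False by linarith
  qed
  have iY: "inverse Y \<in> v.M" using v.inverse_M[OF YS YV] .
  \<comment> \<open>From Y^p - Y = Y^p (1 - Y^(-(p-1))), where the second factor is a unit.\<close>
  define g where "g = 1 + - (inverse Y ^ (p - 1))"
  have g: "g \<in> v.U"
    unfolding g_def using p_gt_1 by (intro v.U_plus_M v.U_closed v.M_minus v.M_power iY) auto
  have Fg: "ell F = Y ^ p * g"
  proof -
    have "Y ^ p = Y * Y ^ (p - 1)" using p1 by (simp flip: power_Suc)
    then have "Y ^ p * inverse Y ^ (p - 1) = Y" using Y0 by (simp add: power_inverse)
    then show ?thesis by (simp add: eF g_def algebra_simps)
  qed
  \<comment> \<open>Membership of F(X) in \<open>T\<close> says that the \<open>p\<close>-th power
    F(X)^p X^(-Np) is a unit, and an element with a unit power is a unit. Dividing by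
    \<open>g\<close> puts \<open>Y\<close> into \<open>T\<close>.\<close>
  have "ell F * X powi (- int N) \<in> v.U"
  proof (rule v.power_U_D[OF _ p1])
    show "ell F * X powi (- int N) \<in> S" using SD(5) powi_S FT by (auto simp: T_def)
    have "(ell F * X powi (- int N)) ^ p = ell F ^ p * X powi fls_subdegree (ell F)"
      unfolding sdF power_mult_distrib using power_int_mult[of X "- int N" "int p"] by simp
    then show "(ell F * X powi (- int N)) ^ p \<in> v.U" using FT by (simp add: T_def)
  qed
  then have "(ell F * X powi (- int N)) * inverse g \<in> v.U" by (rule v.U_closed(2)[OF _ v.U_closed(3)[OF g]])
  moreover have "(ell F * X powi (- int N)) * inverse g = Y ^ p * X powi (- int N)"
    using g by (simp add: Fg v.U_def)
  ultimately have YT: "Y \<in> T" using Y0 YS by (simp add: T_def Y)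
  have T0: "0 \<notin> T" and T1: "1 \<in> T" using T_const[OF is_subfieldD(2)[OF k]] by (simp_all add: T_def)
  have YnT: "Y ^ i \<in> T" for i using T_mult YT T1 by (induction i) auto
  show ?thesis
  proof (rule place_eqI[OF V])
    fix s assume s: "s \<in> h ` C"
    show "s \<in> h ` V \<longleftrightarrow> fls_subdegree s \<ge> 0"
    proof (cases "s = 0")
      case True
      then show ?thesis using v.V_closed(1) by simp
    next
      case False
      obtain z where z: "z \<in> C" "s = h z" using s by blast
      obtain D P where D: "D \<noteq> 0" "poly_over k D" "\<And>i. i < p \<Longrightarrow> poly_over k (P i)"
        "h z * ell D = (\<Sum>i<p. ell (P i) * Y ^ i)"
        using clear_denominators[OF z(1)] by metis
      define f where "f i = ell (P i) * Y ^ i" for i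
      have f: "f i = 0 \<or> f i \<in> T \<and> int p dvd fls_subdegree (f i) + int (i * N)" if "i < p" for i
      proof (cases "P i = 0")
        case False
        have "fls_subdegree (f i) = int (degree (P i)) * (- int p) + int i * (- int N)"
          using Y0 ell_nz[OF False] ell_pole[OF _ False] X p_gt_1
          by (simp add: f_def fls_subdegree_pow Y)
        then have "fls_subdegree (f i) + int (i * N) = int p * (- int (degree (P i)))" by simp
        moreover have "f i \<in> T" unfolding f_def by (intro T_mult T_ell D(3) that False YnT)
        ultimately show ?thesis by (metis dvd_triv_left)
      qed (simp add: f_def ell_hom)
      have "(\<forall>i<p. f i = 0) \<or> (\<Sum>i<p. f i) \<in> T \<and> (\<exists>i<p. int p dvd fls_subdegree (\<Sum>i<p. f i) + int (i * N))"
        by (rule sum_distinct_subdegrees[OF T_add T0 N(1) order.refl f])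
      moreover have "(\<Sum>i<p. f i) \<noteq> 0" using D(4) ell_nz[OF D(1)] False z(2) by (auto simp: f_def)
      ultimately have "(\<Sum>i<p. f i) \<in> T" by auto
      then have "h z * ell D \<in> T" using D(4) by (simp add: f_def)
      then have "h z * ell D * inverse (ell D) \<in> T" by (rule T_mult[OF _ T_inv[OF T_ell[OF D(2,1)]]])
      then have "s \<in> T" using ell_nz[OF D(1)] z(2) by (simp add: mult.assoc)
      then show ?thesis by (rule T_V)
    qed
  qed
qed

end

section \<open>Existence of places\<close>

text \<open>Each iteration settles one more coefficient, and the diagonal series is the fixed point.
  Contraction is required only among series with constant term \<open>u0\<close>, so this term
  selects the solution.\<close>

lemma fps_contraction_fixed_point:
  fixes \<Phi> :: "'a::zero fps \<Rightarrow> 'a fps"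
  assumes const: "\<And>u. fps_nth u 0 = u0 \<Longrightarrow> fps_nth (\<Phi> u) 0 = u0"
    and contr: "\<And>n u v. fps_nth u 0 = u0 \<Longrightarrow> fps_nth v 0 = u0 \<Longrightarrow>
      (\<And>i. i \<le> n \<Longrightarrow> fps_nth u i = fps_nth v i) \<Longrightarrow> fps_nth (\<Phi> u) (Suc n) = fps_nth (\<Phi> v) (Suc n)"
    and k: "\<And>u m. (\<And>n. fps_nth u n \<in> k) \<Longrightarrow> fps_nth (\<Phi> u) m \<in> k" "0 \<in> k" "u0 \<in> k"
  shows "\<exists>u. fps_nth u 0 = u0 \<and> \<Phi> u = u \<and> (\<forall>n. fps_nth u n \<in> k)"
proof -
  define w where "w n = (\<Phi> ^^ n) (Abs_fps (\<lambda>i. if i = 0 then u0 else 0))" for n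
  define u where "u = Abs_fps (\<lambda>n. fps_nth (w n) n)"
  have w0: "fps_nth (w n) 0 = u0" for n
    by (induction n) (simp_all add: w_def const)
  have wk: "fps_nth (w n) i \<in> k" for n i
  proof (induction n arbitrary: i)
    case (Suc n)
    have "w (Suc n) = \<Phi> (w n)" by (simp add: w_def)
    then show ?case using k(1)[OF Suc.IH] by simp
  qed (simp add: w_def k)
  have step: "fps_nth (w (Suc n)) i = fps_nth (w n) i" if "i \<le> n" for n i
    using that
  proof (induction n arbitrary: i)
    case 0
    then show ?case by (simp add: w0)
  next
    case (Suc n)
    show ?case
    proof (cases i)
      case (Suc j)
      have "fps_nth (\<Phi> (w (Suc n))) (Suc j) = fps_nth (\<Phi> (w n)) (Suc j)"
        by (rule contr[OF w0 w0]) (use Suc.IH Suc.prems Suc in auto)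
      then show ?thesis by (simp add: Suc w_def)
    qed (simp add: w0)
  qed
  have stab: "fps_nth (w n) i = fps_nth u i" if "i \<le> n" for n i
    using that by (induction n rule: dec_induct) (simp_all add: u_def step)
  have u0: "fps_nth u 0 = u0" by (simp add: u_def w0)
  have "fps_nth (\<Phi> u) i = fps_nth u i" for i
  proof (cases i)
    case 0
    then show ?thesis using const u0 by simp
  next
    case (Suc n)
    have "fps_nth (\<Phi> u) (Suc n) = fps_nth (\<Phi> (w n)) (Suc n)"
      by (rule contr[OF u0 w0]) (simp add: stab)
    also have "\<dots> = fps_nth (w (Suc n)) (Suc n)" by (simp add: w_def)
    finally show ?thesis using stab[of "Suc n" "Suc n"] Suc by simp
  qed
  then show ?thesis using u0 wk by (intro exI[of _ u]) (simp add: fps_eq_iff u_def)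
qed

definition fps_agree :: "nat \<Rightarrow> 'a::comm_ring_1 fps \<Rightarrow> 'a fps \<Rightarrow> bool" where
  "fps_agree n u v \<longleftrightarrow> (\<forall>i<n. fps_nth u i = fps_nth v i)"

lemma fps_agree_refl: "fps_agree n u u"
  and fps_agree_add: "fps_agree n u v \<Longrightarrow> fps_agree n u' v' \<Longrightarrow> fps_agree n (u + u') (v + v')"
  and fps_agree_diff: "fps_agree n u v \<Longrightarrow> fps_agree n u' v' \<Longrightarrow> fps_agree n (u - u') (v - v')"
  and fps_agree_mult: "fps_agree n u v \<Longrightarrow> fps_agree n u' v' \<Longrightarrow> fps_agree n (u * u') (v * v')"
  by (auto simp: fps_agree_def fps_mult_nth intro!: sum.cong)

lemma fps_agree_power: "fps_agree n u v \<Longrightarrow> fps_agree n (u ^ m) (v ^ m)"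
  by (induction m) (auto intro: fps_agree_mult fps_agree_refl)

lemma fps_agree_sum: "(\<And>i. i \<in> I \<Longrightarrow> fps_agree n (f i) (g i)) \<Longrightarrow> fps_agree n (sum f I) (sum g I)"
  by (induction I rule: infinite_finite_induct) (auto intro: fps_agree_add fps_agree_refl)

text \<open>A factor without constant term shifts the other one and so gains one order of
  agreement.\<close>

lemma fps_agree_mult_Suc:
  assumes "fps_agree (Suc n) s s'" "fps_nth s 0 = 0" "fps_agree n u v"
  shows "fps_agree (Suc n) (s * u) (s' * v)"
  unfolding fps_agree_def fps_mult_nth
proof (intro allI impI sum.cong refl)
  fix i j assume i: "i < Suc n" and j: "j \<in> {0..i}"
  show "fps_nth s j * fps_nth u (i - j) = fps_nth s' j * fps_nth v (i - j)"
  proof (cases "j = 0")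
    case True
    have "fps_nth s' 0 = 0" using assms(1,2) by (simp add: fps_agree_def)
    then show ?thesis using True assms(2) by simp
  next
    case False
    then show ?thesis using assms(1,3) i j by (simp add: fps_agree_def)
  qed
qed

definition fps_over :: "'a::field set \<Rightarrow> 'a fps \<Rightarrow> bool" where
  "fps_over k u \<longleftrightarrow> (\<forall>n. fps_nth u n \<in> k)"

lemma fps_over_intros:
  assumes k: "is_subfield k"
  shows "x \<in> k \<Longrightarrow> fps_over k (fps_const x)" "fps_over k fps_X" "fps_over k 0"
    "fps_over k u \<Longrightarrow> fps_over k v \<Longrightarrow> fps_over k (u + v)" "fps_over k u \<Longrightarrow> fps_over k v \<Longrightarrow> fps_over k (u - v)"
    "fps_over k u \<Longrightarrow> fps_over k v \<Longrightarrow> fps_over k (u * v)" "fps_over k u \<Longrightarrow> fps_over k (u ^ n)" "fps_over k 1"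
proof -
  show m: "fps_over k (u * v)" if "fps_over k u" "fps_over k v" for u v
    using that by (auto simp: fps_over_def fps_mult_nth intro!: is_subfield_sum[OF k] is_subfieldD(5)[OF k])
  show one: "fps_over k 1" using is_subfieldD(1,2)[OF k] by (simp add: fps_over_def)
  show "fps_over k (u ^ n)" if "fps_over k u" using that m one by (induction n) auto
qed (use is_subfieldD[OF k] in \<open>auto simp: fps_over_def fps_X_def\<close>)

lemma fps_over_sum: "is_subfield k \<Longrightarrow> (\<And>i. i \<in> I \<Longrightarrow> fps_over k (f i)) \<Longrightarrow> fps_over k (sum f I)"
  by (induction I rule: infinite_finite_induct) (auto intro: fps_over_intros)

lemma is_hom_fps_const: "is_hom (fps_const :: 'a::comm_ring_1 \<Rightarrow> 'a fps)"
  by (simp add: is_hom_def)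

lemma fps_to_fls_eval:
  "fps_to_fls (eval_hom fps_const u P) = eval_hom fls_const (fps_to_fls u) (P :: 'a::field poly)"
  by (induction P)
     (simp_all add: eval_hom_pCons[OF is_hom_fps_const] eval_hom_pCons[OF is_hom_fls_const] fls_times_fps_to_fls)

lemma fps_over_eval: "is_subfield k \<Longrightarrow> poly_over k P \<Longrightarrow> fps_over k u \<Longrightarrow> fps_over k (eval_hom fps_const u P)"
proof (induction P)
  case (pCons c P)
  then show ?case using poly_over_pConsD[of k c P]
    by (auto simp: eval_hom_pCons[OF is_hom_fps_const] intro!: fps_over_intros)
qed (auto intro: fps_over_intros)

lemma eval_fps_nth_0: "fps_nth (eval_hom fps_const u P) 0 = poly P (fps_nth u 0)"
  by (induction P) (simp_all add: eval_hom_pCons[OF is_hom_fps_const])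

text \<open>Factors x - x0 evaluate to \<open>fls_X\<close> and are split off until the value at
  \<open>x0\<close>, which is the constant coefficient, is nonzero.\<close>

lemma eval_fls_shift_transcendental:
  fixes P :: "'a::field poly"
  assumes "P \<noteq> 0"
  shows "eval_hom fls_const (fls_const x0 + fls_X) P \<noteq> 0"
  using assms
proof (induction "degree P" arbitrary: P rule: less_induct)
  case less
  let ?X = "fls_const x0 + fls_X :: 'a fls"
  have X: "?X = fps_to_fls (fps_const x0 + fps_X)" by simp
  show ?case
  proof (cases "poly P x0 = 0")
    case False
    have "fls_nth (eval_hom fls_const ?X P) 0 = poly P x0"
      unfolding X fps_to_fls_eval[symmetric] by (simp add: eval_fps_nth_0)
    then show ?thesis using False by auto
  next
    case True
    then have "[:- x0, 1:] dvd P" by (simp only: poly_eq_0_iff_dvd)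
    then obtain Q where Q: "P = [:- x0, 1:] * Q" by (rule dvdE)
    then have Q0: "Q \<noteq> 0" using less.prems by auto
    then have "degree Q < degree P" unfolding Q by (subst degree_mult_eq) auto
    then have IH: "eval_hom fls_const ?X Q \<noteq> 0" using less.hyps Q0 by blast
    have "eval_hom fls_const ?X [:- x0, 1:] = fls_const (- x0) + ?X"
      by (simp add: eval_hom_pCons[OF is_hom_fls_const])
    also have "\<dots> = (fls_const (- x0) + fls_const x0) + fls_X" by (simp only: add.assoc)
    also have "\<dots> = fls_X" unfolding fls_plus_const by simp
    finally have "eval_hom fls_const ?X P = fls_X * eval_hom fls_const ?X Q"
      unfolding Q is_homD(4)[OF is_hom_eval_hom[OF is_hom_fls_const]] by simp
    then show ?thesis using IH by simp
  qed
qed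

context char_power begin

lemma fps_frob_diff: "(x - y :: 'a fps) ^ (p ^ n) = x ^ (p ^ n) - y ^ (p ^ n)"
proof -
  have "((x - y) + y) ^ (p ^ n) = (x - y) ^ (p ^ n) + y ^ (p ^ n)"
    by (rule freshmans_dream'[where n = "s * n"]) (simp_all add: char_p0 prime_p0 p_eq power_mult)
  then show ?thesis by simp
qed

lemma fls_frob_diff: "(x - y :: 'a fls) ^ p = x ^ p - y ^ p"
proof -
  have "((x - y) + y) ^ p = (x - y) ^ p + y ^ p"
    by (rule freshmans_dream'[where n = s]) (simp_all add: char_p0 prime_p0 p_eq)
  then show ?thesis by simp
qed

text \<open>A difference of order at least \<open>n\<close> gets order at least p^j n >= 2n >= n + 1
  under Frobenius.\<close>

lemma fps_agree_frob:
  assumes "fps_agree n u v" "n \<ge> 1" "j \<ge> 1"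
  shows "fps_agree (Suc n) (u ^ (p ^ j)) (v ^ (p ^ j) :: 'a fps)"
proof (cases "u = v")
  case False
  have "fps_nth ((u - v) ^ (p ^ j)) i = 0" if "i < Suc n" for i
  proof -
    have "subdegree (u - v) \<ge> n"
      using assms(1) False by (intro subdegree_geI) (auto simp: fps_agree_def)
    moreover have "p ^ j \<ge> 2"
      using p_gt_1 assms(3) by (metis Suc_leI Suc_1 one_less_power zero_less_one order_less_le_trans)
    ultimately have "2 * n \<le> p ^ j * subdegree (u - v)" by (intro mult_le_mono)
    then have "Suc n \<le> subdegree ((u - v) ^ (p ^ j))" using assms(2) by (simp add: subdegree_power)
    then show ?thesis using that by (intro nth_less_subdegree_zero) simp
  qed
  then show ?thesis by (simp add: fps_frob_diff fps_agree_def)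
qed (simp add: fps_agree_refl)

text \<open>y^p - y = H(t) is read as the fixed-point equation y = y^p - H, in which the
  \<open>p\<close>-th power contracts. The constant term \<open>y0\<close> picks out one of the
  solutions.\<close>

lemma affine_point_exists:
  assumes k: "is_subfield k" and F: "poly_over k F" and x0: "x0 \<in> k" and y0: "(y0::'a) \<in> k" "y0 ^ p - y0 = poly F x0"
  shows "\<exists>Y. fls_point p F k (fls_const x0 + fls_X) Y \<and> (Y - fls_const y0 = 0 \<or> fls_subdegree (Y - fls_const y0) > 0)"
proof -
  define H where "H = eval_hom fps_const (fps_const x0 + fps_X) F"
  have H0: "fps_nth H 0 = poly F x0" by (simp add: H_def eval_fps_nth_0)
  have Hk: "fps_over k H" unfolding H_def by (intro fps_over_eval k F fps_over_intros x0)
  define \<Phi> where "\<Phi> u = u ^ p - H" for u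
  have "\<exists>u. fps_nth u 0 = y0 \<and> \<Phi> u = u \<and> (\<forall>n. fps_nth u n \<in> k)"
  proof (rule fps_contraction_fixed_point)
    show "fps_nth (\<Phi> u) 0 = y0" if "fps_nth u 0 = y0" for u
      using that y0(2) by (simp add: \<Phi>_def H0 fps_power_zeroth algebra_simps)
    show "fps_nth (\<Phi> u) (Suc n) = fps_nth (\<Phi> v) (Suc n)"
      if "\<And>i. i \<le> n \<Longrightarrow> fps_nth u i = fps_nth v i" for n u v
    proof -
      have "fps_agree (Suc n) u v" using that by (auto simp: fps_agree_def)
      then have "fps_agree (Suc (Suc n)) (u ^ p) (v ^ p)" using fps_agree_frob[of "Suc n" u v 1] by simp
      then show ?thesis by (simp add: \<Phi>_def fps_agree_def)
    qed
    show "fps_nth (\<Phi> u) n \<in> k" if "\<And>n. fps_nth u n \<in> k" for u n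
      using fps_over_intros(5)[OF k fps_over_intros(7)[OF k, of u p] Hk] that by (simp add: \<Phi>_def fps_over_def)
  qed (use is_subfieldD(1)[OF k] y0 in auto)
  then obtain u where u: "fps_nth u 0 = y0" "\<Phi> u = u" "\<And>n. fps_nth u n \<in> k" by blast
  have X: "fls_const x0 + fls_X = fps_to_fls (fps_const x0 + fps_X)" by simp
  have pt: "fls_point p F k (fls_const x0 + fls_X) (fps_to_fls u)"
  proof
    have "u ^ p - u = H" using u(2) by (simp add: \<Phi>_def algebra_simps)
    then have "fps_to_fls (u ^ p - u) = fps_to_fls H" by simp
    then show "fps_to_fls u ^ p - fps_to_fls u = eval_hom fls_const (fls_const x0 + fls_X) F"
      unfolding X H_def fps_to_fls_eval by (simp add: fps_to_fls_power)
    show "fls_nth (fps_to_fls u) n \<in> k" for n using u(3) is_subfieldD(1)[OF k] by simp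
    show "fls_nth (fls_const x0 + fls_X) n \<in> k" for n
      using x0 is_subfieldD(1-3)[OF k] by (simp add: fls_X_def)
  qed (use k F p_gt_1 eval_fls_shift_transcendental in auto)
  have "fps_to_fls u - fls_const y0 = 0 \<or> fls_subdegree (fps_to_fls u - fls_const y0) \<ge> 1"
  proof (rule disjCI)
    assume "\<not> fls_subdegree (fps_to_fls u - fls_const y0) \<ge> 1"
    moreover have "fls_nth (fps_to_fls u - fls_const y0) n = 0" if "n < 1" for n
      using u(1) that by (cases "n = 0") auto
    ultimately show "fps_to_fls u - fls_const y0 = 0" using fls_subdegree_geI by blast
  qed
  then show ?thesis using pt by (intro exI[of _ "fps_to_fls u"]) auto
qed

end

context heisenberg begin

definition curve_poly :: "'a poly" where "curve_poly = monom 1 1 * R_poly p e a"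

lemma curve_poly_eq: "curve_poly = (\<Sum>i\<le>e. monom (a i) (p ^ i + 1))"
  by (simp add: curve_poly_def R_poly_def sum_distrib_left mult_monom)

lemma poly_curve_poly: "poly curve_poly x = x * R x"
  by (simp add: curve_poly_def poly_monom)

lemma degree_curve_poly: "degree curve_poly = p ^ e + 1"
proof -
  have "degree (R_poly p e a) = p ^ e" unfolding R_poly_eq using a_e by (rule degree_lin_poly)
  moreover from this have "degree (R_poly p e a) > 0" by (simp only: zero_less_power p_pos)
  then have "R_poly p e a \<noteq> 0" by (metis degree_0 less_numeral_extra(3))
  ultimately show ?thesis by (simp add: curve_poly_def degree_mult_eq degree_monom_eq monom_eq_0_iff)
qed

text \<open>At infinity \<open>x = t ^ (- p) * u\<close> and \<open>y = \<eta> * t ^ (- (p ^ e + 1))\<close>. The constant coefficient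
  \<open>u0\<close> of \<open>u\<close> has to satisfy \<open>a e * u0 ^ (p ^ e + 1) = \<eta> ^ p\<close>, which is solved over \<open>k\<close> by powers
  of \<open>a e\<close>.\<close>

lemma infinite_point_exists:
  assumes k: "is_subfield k" and ak: "\<And>i. i \<le> e \<Longrightarrow> a i \<in> k"
  shows "\<exists>X Y. fls_point p curve_poly k X Y \<and> fls_subdegree X = - int p \<and> fls_subdegree Y = - int (p ^ e + 1)"
proof -
  define N where "N = p ^ e + 1"
  \<comment> \<open>The exponents come from 1 + (p^e - 1)(p^e + 1) = p^(2e): both leading terms
    become a_e^(p^(2e)). The exponent 2e - 1 leaves room for the outer \<open>p\<close>-th
    power.\<close>
  define \<eta> where "\<eta> = a e ^ (p ^ (2 * e - 1))"
  define u0 where "u0 = a e ^ (p ^ e - 1)"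
  have \<eta>k: "\<eta> \<in> k" "u0 \<in> k" unfolding \<eta>_def u0_def using ak is_subfieldD(9)[OF k] by auto
  have \<eta>0: "\<eta> \<noteq> 0" "u0 \<noteq> 0" using a_e by (simp_all add: \<eta>_def u0_def)
  have pe: "p ^ e \<ge> 1" using p_pos by (simp add: Suc_le_eq)
  have eq0: "a e * u0 ^ N = \<eta> ^ p"
  proof -
    have "\<eta> ^ p = a e ^ (p ^ (2 * e))"
    proof -
      have "p ^ (2 * e) = p ^ (2 * e - 1) * p" using e_pos by (simp add: power_eq_if[of p "2 * e"])
      then show ?thesis by (simp only: \<eta>_def power_mult)
    qed
    moreover have "1 + (p ^ e - 1) * N = p ^ (2 * e)"
    proof -
      obtain r where r: "p ^ e = Suc r" using pe by (cases "p ^ e") auto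
      have "p ^ (2 * e) = p ^ e * p ^ e" by (simp add: mult_2 power_add)
      then show ?thesis by (simp add: N_def r)
    qed
    moreover have "a e * u0 ^ N = a e ^ (1 + (p ^ e - 1) * N)" by (simp add: u0_def power_mult power_add)
    ultimately show ?thesis by simp
  qed
  \<comment> \<open>The derivative of a_e u^N at \<open>u0\<close>, since \<open>N\<close> is 1 in
    characteristic \<open>p0\<close>.\<close>
  define c where "c = a e * u0 ^ (p ^ e)"
  have c0: "c \<noteq> 0" using a_e \<eta>0 by (simp add: c_def)
  have c_inv: "inverse c * a e * u0 ^ (p ^ e) = 1"
    using left_inverse[OF c0] by (simp only: c_def mult.assoc)
  have ck: "inverse c \<in> k" unfolding c_def using ak \<eta>k is_subfieldD(5,6,9)[OF k] by auto
  have Np: "N * (p - 1) \<ge> 1" using p_gt_1 by (simp add: N_def)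
  have ex: "p * (p ^ e - p ^ i) \<ge> 1" if "i < e" for i
    using that p_gt_1 by (simp add: Suc_le_eq power_strict_increasing)
  \<comment> \<open>Multiplying the curve equation by t^(pN) clears all poles and gives a_e u^N +
    L(u) = 0.\<close>
  define L :: "'a fps \<Rightarrow> 'a fps" where "L u = (\<Sum>i<e. fps_const (a i) * fps_X ^ (p * (p ^ e - p ^ i)) * u ^ (p ^ i + 1)) +
    fps_const \<eta> * fps_X ^ (N * (p - 1)) - fps_const (\<eta> ^ p)" for u
  \<comment> \<open>A Newton step with the derivative frozen at \<open>u0\<close>: u - (a_e u^N +
    L(u)) / c. The factor in parentheses has no constant term and involves \<open>u\<close> through
    u^(p^e) only, which makes the map contract.\<close>
  define \<Phi> :: "'a fps \<Rightarrow> 'a fps" where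
    "\<Phi> u = (1 - fps_const (inverse c * a e) * u ^ (p ^ e)) * u - fps_const (inverse c) * L u" for u
  have X0: "fps_nth (fps_X ^ m) 0 = (0::'a)" if "m \<ge> 1" for m using that by simp
  have L0: "fps_nth (L u) 0 = - (\<eta> ^ p)" for u
  proof -
    have "fps_nth (\<Sum>i<e. fps_const (a i) * fps_X ^ (p * (p ^ e - p ^ i)) * u ^ (p ^ i + 1)) 0 = 0"
      unfolding fps_sum_nth
    proof (intro sum.neutral ballI)
      fix i assume "i \<in> {..<e}"
      then have "fps_nth (fps_X ^ (p * (p ^ e - p ^ i)) :: 'a fps) 0 = 0" by (intro X0 ex) simp
      then show "fps_nth (fps_const (a i) * fps_X ^ (p * (p ^ e - p ^ i)) * u ^ (p ^ i + 1)) 0 = 0"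
        by (simp only: fps_mult_nth_0 mult_zero_right mult_zero_left)
    qed
    moreover have "fps_nth (fps_X ^ (N * (p - 1)) :: 'a fps) 0 = 0" by (rule X0[OF Np])
    ultimately show ?thesis unfolding L_def fps_sub_nth fps_add_nth fps_mult_nth_0 by simp
  qed
  have "\<exists>u. fps_nth u 0 = u0 \<and> \<Phi> u = u \<and> (\<forall>n. fps_nth u n \<in> k)"
  proof (rule fps_contraction_fixed_point)
    show "fps_nth (\<Phi> u) 0 = u0" if "fps_nth u 0 = u0" for u
    proof -
      have "(1 - inverse c * a e * u0 ^ (p ^ e)) = 0" using c_inv by simp
      moreover have "inverse c * \<eta> ^ p = u0"
      proof -
        have "\<eta> ^ p = c * u0" unfolding eq0[symmetric] by (simp add: c_def N_def)
        then show ?thesis using c0 by simp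
      qed
      ultimately show ?thesis using that by (simp add: \<Phi>_def L0 fps_power_zeroth)
    qed
    show "fps_nth (\<Phi> u) (Suc n) = fps_nth (\<Phi> v) (Suc n)"
      if uv: "fps_nth u 0 = u0" "fps_nth v 0 = u0" "\<And>i. i \<le> n \<Longrightarrow> fps_nth u i = fps_nth v i" for n u v
    proof -
      have ag: "fps_agree (Suc n) u v" using uv(3) by (auto simp: fps_agree_def)
      have "fps_agree (Suc (Suc n)) (u ^ (p ^ e)) (v ^ (p ^ e))"
        by (rule fps_agree_frob[OF ag _ e_pos]) simp
      then have 1: "fps_agree (Suc (Suc n)) (1 - fps_const (inverse c * a e) * u ^ (p ^ e)) (1 - fps_const (inverse c * a e) * v ^ (p ^ e))"
        by (intro fps_agree_diff fps_agree_mult fps_agree_refl)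
      have "fps_nth (1 - fps_const (inverse c * a e) * u ^ (p ^ e)) 0 = 0"
        using c_inv uv(1) by (simp add: fps_power_zeroth)
      then have 2: "fps_agree (Suc (Suc n)) ((1 - fps_const (inverse c * a e) * u ^ (p ^ e)) * u) ((1 - fps_const (inverse c * a e) * v ^ (p ^ e)) * v)"
        by (rule fps_agree_mult_Suc[OF 1 _ ag])
      have "fps_agree (Suc (Suc n)) (fps_const (a i) * fps_X ^ (p * (p ^ e - p ^ i)) * u ^ (p ^ i + 1))
          (fps_const (a i) * fps_X ^ (p * (p ^ e - p ^ i)) * v ^ (p ^ i + 1))" if "i < e" for i
        by (rule fps_agree_mult_Suc[OF fps_agree_refl _ fps_agree_power[OF ag]])
           (simp only: fps_mult_nth_0 X0[OF ex[OF that]] mult_zero_right)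
      then have "fps_agree (Suc (Suc n)) (L u) (L v)"
        unfolding L_def by (intro fps_agree_diff fps_agree_add fps_agree_sum fps_agree_refl) auto
      then have "fps_agree (Suc (Suc n)) (\<Phi> u) (\<Phi> v)"
        unfolding \<Phi>_def using 2 by (intro fps_agree_diff fps_agree_mult[OF fps_agree_refl])
      then show ?thesis by (simp add: fps_agree_def)
    qed
    show "fps_nth (\<Phi> u) n \<in> k" if "\<And>n. fps_nth u n \<in> k" for u n
    proof -
      have u: "fps_over k u" using that by (simp add: fps_over_def)
      have ck': "inverse c * a e \<in> k" using ck ak is_subfieldD(5)[OF k] by auto
      have \<eta>p: "\<eta> ^ p \<in> k" using is_subfieldD(9)[OF k \<eta>k(1)] .
      have "fps_over k (\<Sum>i<e. fps_const (a i) * fps_X ^ (p * (p ^ e - p ^ i)) * u ^ (p ^ i + 1))"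
        using ak by (intro fps_over_sum k fps_over_intros(6)[OF k] fps_over_intros(7)[OF k] u fps_over_intros(1,2)[OF k]) auto
      then have "fps_over k (L u)"
        unfolding L_def by (intro fps_over_intros(4)[OF k] fps_over_intros(5)[OF k] fps_over_intros(6)[OF k]
          fps_over_intros(7)[OF k] fps_over_intros(1,2)[OF k] \<eta>k \<eta>p)
      then have "fps_over k (\<Phi> u)"
        unfolding \<Phi>_def by (intro fps_over_intros(5)[OF k] fps_over_intros(6)[OF k]
          fps_over_intros(7)[OF k] fps_over_intros(1,8)[OF k] u ck ck')
      then show ?thesis by (simp add: fps_over_def)
    qed
  qed (use is_subfieldD(1)[OF k] \<eta>k in auto)
  then obtain u where u: "fps_nth u 0 = u0" "\<Phi> u = u" "\<And>n. fps_nth u n \<in> k" by blast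
  have "fps_const c * u = fps_const c * \<Phi> u" by (simp only: u(2))
  also have "\<dots> = fps_const c * u - fps_const (a e) * u ^ N - L u"
  proof -
    have 1: "fps_const c * fps_const (inverse c * a e) = fps_const (a e)" "fps_const c * fps_const (inverse c) = 1"
      using c0 by (simp_all add: mult.assoc[symmetric])
    have "fps_const c * \<Phi> u = fps_const c * u - (fps_const c * fps_const (inverse c * a e)) * (u ^ (p ^ e) * u)
        - (fps_const c * fps_const (inverse c)) * L u"
      unfolding \<Phi>_def by (simp only: left_diff_distrib right_diff_distrib mult.assoc mult_1_left mult.left_commute)
    then show ?thesis unfolding 1 by (simp add: N_def mult.commute)
  qed
  finally have eq: "fps_const (a e) * u ^ N + L u = 0" by (simp add: algebra_simps)
  define U where "U = fps_to_fls u"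
  define X where "X = fls_X_inv ^ p * U"
  define Y where "Y = fls_const \<eta> * fls_X_inv ^ N"
  have un: "u \<noteq> 0" using u(1) \<eta>0 by auto
  have sdU: "fls_subdegree U = 0" "U \<noteq> 0"
    using u(1) \<eta>0 un by (simp_all add: U_def fls_subdegree_fls_to_fps subdegree_eq_0)
  have sdX: "fls_subdegree X = - int p" unfolding X_def using sdU by (simp add: fls_subdegree_pow)
  have sdY: "fls_subdegree Y = - int N" unfolding Y_def using \<eta>0 fls_const_nonzero[of \<eta>] by (simp add: fls_subdegree_pow)
  let ?t = "fls_X :: 'a fls" and ?s = "fls_X_inv :: 'a fls"
  have ts: "?t ^ n * ?s ^ m = ?t ^ (n - m)" if "m \<le> n" for n m
  proof -
    have "?t ^ n = ?t ^ (n - m) * ?t ^ m" using that by (simp flip: power_add)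
    moreover have "?t ^ m * ?s ^ m = 1" by (simp add: fls_X_inv_times_conv_shift flip: power_mult_distrib)
    ultimately show ?thesis by (simp add: mult.assoc)
  qed
  have key: "?t ^ (p * N) * (Y ^ p - Y) = ?t ^ (p * N) * eval_hom fls_const X curve_poly"
  proof -
    have Y1: "?t ^ (p * N) * (Y ^ p - Y) = fls_const (\<eta> ^ p) - fls_const \<eta> * ?t ^ (N * (p - 1))"
    proof -
      have "?t ^ (p * N) * (Y ^ p - Y) = fls_const (\<eta> ^ p) * (?t ^ (p * N) * ?s ^ (p * N)) - fls_const \<eta> * (?t ^ (p * N) * ?s ^ N)"
        by (simp add: Y_def power_mult_distrib fls_const_power right_diff_distrib mult_ac flip: power_mult)
      also have "?t ^ (p * N) * ?s ^ (p * N) = 1" using ts[of "p * N" "p * N"] by simp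
      also have "?t ^ (p * N) * ?s ^ N = ?t ^ (N * (p - 1))"
      proof -
        have "p * N - N = N * (p - 1)" by (simp add: diff_mult_distrib2 mult.commute)
        then show ?thesis using ts[of N "p * N"] p_gt_1 by simp
      qed
      finally show ?thesis by simp
    qed
    have "eval_hom fls_const X (sum f I) = (\<Sum>i\<in>I. eval_hom fls_const X (f i))" for f :: "nat \<Rightarrow> 'a poly" and I
      by (induction I rule: infinite_finite_induct) (simp_all add: is_homD[OF is_hom_eval_hom[OF is_hom_fls_const]])
    then have "?t ^ (p * N) * eval_hom fls_const X curve_poly = (\<Sum>i\<le>e. ?t ^ (p * N) * (fls_const (a i) * X ^ (p ^ i + 1)))"
      unfolding curve_poly_eq by (simp only: eval_hom_monom[OF is_hom_fls_const] sum_distrib_left)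
    also have "\<dots> = (\<Sum>i\<le>e. fls_const (a i) * ?t ^ (p * (p ^ e - p ^ i)) * U ^ (p ^ i + 1))"
    proof (intro sum.cong refl)
      fix i assume "i \<in> {..e}"
      then have "p ^ i \<le> p ^ e" using p_gt_1 by (simp add: power_increasing)
      then have le: "p * (p ^ i + 1) \<le> p * N" by (simp add: N_def)
      have "p * N - p * (p ^ i + 1) = p * (p ^ e - p ^ i)" unfolding N_def by (simp flip: diff_mult_distrib2)
      then have 1: "?t ^ (p * N) * ?s ^ (p * (p ^ i + 1)) = ?t ^ (p * (p ^ e - p ^ i))" using ts[OF le] by simp
      have 2: "X ^ (p ^ i + 1) = ?s ^ (p * (p ^ i + 1)) * U ^ (p ^ i + 1)"
        unfolding X_def power_mult_distrib power_mult ..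
      have "?t ^ (p * N) * (fls_const (a i) * (?s ^ (p * (p ^ i + 1)) * U ^ (p ^ i + 1))) =
          fls_const (a i) * (?t ^ (p * N) * ?s ^ (p * (p ^ i + 1))) * U ^ (p ^ i + 1)"
        by (simp only: mult_ac)
      then show "?t ^ (p * N) * (fls_const (a i) * X ^ (p ^ i + 1)) =
          fls_const (a i) * ?t ^ (p * (p ^ e - p ^ i)) * U ^ (p ^ i + 1)"
        unfolding 2 by (simp only: 1)
    qed
    also have "\<dots> = (\<Sum>i<e. fls_const (a i) * ?t ^ (p * (p ^ e - p ^ i)) * U ^ (p ^ i + 1)) + fls_const (a e) * U ^ N"
      by (simp add: N_def flip: lessThan_Suc_atMost)
    also have "\<dots> = fps_to_fls (fps_const (a e) * u ^ N + L u) + fls_const (\<eta> ^ p) - fls_const \<eta> * ?t ^ (N * (p - 1))"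
    proof -
      have "fps_to_fls (sum g I) = (\<Sum>i\<in>I. fps_to_fls (g i))" for g :: "nat \<Rightarrow> 'a fps" and I
        by (induction I rule: infinite_finite_induct) simp_all
      then show ?thesis
        unfolding L_def by (simp add: fls_times_fps_to_fls fps_to_fls_power U_def)
    qed
    also have "\<dots> = fls_const (\<eta> ^ p) - fls_const \<eta> * ?t ^ (N * (p - 1))" unfolding eq by simp
    finally show ?thesis using Y1 by simp
  qed
  have "fls_point p curve_poly k X Y"
  proof
    show "p > 1" by (rule p_gt_1)
    show "is_subfield k" by (rule k)
    show "poly_over k curve_poly"
      unfolding poly_over_def curve_poly_eq coeff_sum using ak is_subfieldD(1)[OF k]
      by (auto intro!: is_subfield_sum[OF k])
    show "eval_hom fls_const X P \<noteq> 0" if "P \<noteq> 0" for P using eval_fls_pole[OF _ that, of X] sdX p_pos by simp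
    show "Y ^ p - Y = eval_hom fls_const X curve_poly" using key by simp
    have kz: "0 \<in> k" by (rule is_subfieldD(1)[OF k])
    show "fls_nth X n \<in> k" for n
      using u(3) kz by (simp add: X_def U_def fls_X_inv_power_times_conv_shift)
    show "fls_nth Y n \<in> k" for n
      using \<eta>k kz by (simp add: Y_def mult.commute[of "fls_const \<eta>"] fls_X_inv_power_times_conv_shift)
  qed
  then show ?thesis using sdX sdY unfolding N_def by blast
qed

end

section \<open>Places over affine points\<close>

context place_in begin

lemma cong_mult: "x \<in> V \<Longrightarrow> y' \<in> V \<Longrightarrow> x - x' \<in> M \<Longrightarrow> y - y' \<in> M \<Longrightarrow> x * y - x' * y' \<in> M"
proof -
  assume *: "x \<in> V" "y' \<in> V" "x - x' \<in> M" "y - y' \<in> M"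
  have "x * (y - y') + y' * (x - x') \<in> M" by (intro M_add M_mult *)
  then show ?thesis by (simp add: algebra_simps)
qed

lemma cong_power: "x \<in> V \<Longrightarrow> x' \<in> V \<Longrightarrow> x - x' \<in> M \<Longrightarrow> x ^ n - x' ^ n \<in> M"
proof (induction n)
  case (Suc n)
  then show ?case using cong_mult[OF Suc.prems(1) V_closed(7)[OF Suc.prems(2), of n]] by simp
qed (simp add: M_def V_closed)

lemma cong_const_unique:
  assumes "x \<in> c" "y \<in> c" "z - x \<in> M" "z - y \<in> M"
  shows "x = y"
proof (rule ccontr)
  assume "x \<noteq> y"
  then have "x - y \<in> U" using is_subfieldD(7)[OF c assms(1,2)] by (intro const_U) auto
  moreover have "(z - y) + - (z - x) \<in> M" by (intro M_add M_minus assms)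
  ultimately show False using M_U_disjoint by simp
qed

end

context AS_curve begin

text \<open>Formulated in the function field itself, so that places seen through the series at
  infinity and through the series at an affine point can be compared.\<close>

definition lies_over :: "'a poly fract poly set \<Rightarrow> 'a \<Rightarrow> 'a \<Rightarrow> bool" where
  "lies_over V x0 y0 \<longleftrightarrow> [:to_fract [:- x0, 1:]:] \<in> maximal_ideal_of K V \<and>
     [:0, 1:] - const_K y0 \<in> maximal_ideal_of K V"

end

context fls_place begin

lemma maximal_ideal_iff_M:
  assumes V: "V \<in> degree_one_places K (const_K ` k)" and z: "z \<in> C"
  shows "z \<in> maximal_ideal_of K V \<longleftrightarrow> h z \<in> place_in.M (h ` V)"
proof -
  interpret v: place_in "h ` C" "fls_const ` k" "h ` V" by (rule place_in_image[OF V])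
  have VC: "V \<subseteq> C" using V degree_one_place_iff by blast
  have sub: "subring V K"
    using V by (simp add: degree_one_places_def valuation_ring_over_def)
  show ?thesis
  proof (cases "z \<in> V")
    case True
    then show ?thesis using maximal_ideal_iff[OF sub True] by (auto simp: v.M_def)
  next
    case False
    then have "h z \<notin> h ` V" using h_mem[OF VC z] by simp
    then show ?thesis using False v.M_V by (auto simp: maximal_ideal_of_def)
  qed
qed

lemma lies_over_iff:
  assumes V: "V \<in> degree_one_places K (const_K ` k)" and xy: "x0 \<in> k" "y0 \<in> k"
  shows "lies_over V x0 y0 \<longleftrightarrow> X - fls_const x0 \<in> place_in.M (h ` V) \<and> Y - fls_const y0 \<in> place_in.M (h ` V)"
proof -
  have "poly_over k [:- x0, 1:]"
    using poly_over_intros(9)[OF k is_subfieldD(4)[OF k xy(1)] poly_over_intros(2)[OF k]] by (simp add: one_pCons)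
  then have 1: "[:to_fract [:- x0, 1:]:] \<in> C" by (rule to_fract_C)
  have 2: "[:0, 1:] - const_K y0 \<in> C" by (rule C_closed(5)[OF y_C const_K_C[OF xy(2)]])
  have m: "fls_const (- u) = - fls_const u" for u :: 'a by (intro fls_eqI) simp
  have h1: "h [:to_fract [:- x0, 1:]:] = X - fls_const x0"
    using ell_X ell_pCons[of "- x0" "[:1:]"] ell_const[of 1] unfolding h_poly by (simp add: m)
  have h2: "h ([:0, 1:] - const_K y0) = Y - fls_const y0"
    by (simp only: h_hom(6) h_y h_const_K)
  show ?thesis
    unfolding lies_over_def maximal_ideal_iff_M[OF V 1] maximal_ideal_iff_M[OF V 2] h1 h2 ..
qed

lemma lies_over_unique:
  assumes V: "V \<in> degree_one_places K (const_K ` k)" and k4: "x0 \<in> k" "y0 \<in> k" "x1 \<in> k" "y1 \<in> k"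
    and lo: "lies_over V x0 y0" "lies_over V x1 y1"
  shows "x0 = x1 \<and> y0 = y1"
proof -
  interpret v: place_in "h ` C" "fls_const ` k" "h ` V" by (rule place_in_image[OF V])
  have "fls_const x0 = fls_const x1" "fls_const y0 = fls_const y1"
    using v.cong_const_unique[of "fls_const x0" "fls_const x1" X] v.cong_const_unique[of "fls_const y0" "fls_const y1" Y]
      lo k4 by (auto simp: lies_over_iff[OF V])
  then show ?thesis by (metis fls_const_nth)
qed

lemma lies_over_imp_X:
  assumes "V \<in> degree_one_places K (const_K ` k)" "x0 \<in> k" "y0 \<in> k" "lies_over V x0 y0"
  shows "X \<in> h ` V"
proof -
  interpret v: place_in "h ` C" "fls_const ` k" "h ` V" by (rule place_in_image[OF assms(1)])
  have "X - fls_const x0 \<in> v.M" using assms(4) by (simp add: lies_over_iff[OF assms(1-3)])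
  then have "(X - fls_const x0) + fls_const x0 \<in> h ` V"
    using assms(2) v.VD(6) by (intro v.V_closed(4)[OF v.M_V]) auto
  then show ?thesis by simp
qed

text \<open>If \<open>X\<close> is in the ring then so is \<open>Y\<close>, which is integral over
  it; the residues of both are constants, and they satisfy the equation because ring operations
  respect congruence mod the maximal ideal.\<close>

lemma lies_over_exists:
  assumes V: "V \<in> degree_one_places K (const_K ` k)" and XV: "X \<in> h ` V"
  shows "\<exists>x0\<in>k. \<exists>y0\<in>k. y0 ^ p - y0 = poly F x0 \<and> lies_over V x0 y0"
proof -
  interpret v: place_in "h ` C" "fls_const ` k" "h ` V" by (rule place_in_image[OF V])
  have cV: "fls_const u \<in> h ` V" if "u \<in> k" for u using v.VD(6) that by blast
  obtain x0 where x0: "x0 \<in> k" "X - fls_const x0 \<in> v.M" using v.residue_exists[OF XV] by blast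
  have ell: "ell P \<in> h ` V \<and> ell P - fls_const (poly P x0) \<in> v.M" if "poly_over k P" for P
    using that
  proof (induction P)
    case 0
    show ?case by (simp add: ell_hom v.M_def v.V_closed)
  next
    case (pCons u P)
    then have u: "u \<in> k" "poly_over k P" using poly_over_pConsD by auto
    then have IH: "ell P \<in> h ` V" "ell P - fls_const (poly P x0) \<in> v.M" using pCons.IH by auto
    have "X * ell P - fls_const x0 * fls_const (poly P x0) \<in> v.M"
      by (rule v.cong_mult[OF XV cV[OF poly_over_poly[OF k u(2) x0(1)]] x0(2) IH(2)])
    moreover have "ell (pCons u P) - fls_const (poly (pCons u P) x0) = X * ell P - fls_const x0 * fls_const (poly P x0)"
      by (simp add: ell_pCons flip: fls_plus_const)
    ultimately show ?case
      using v.V_closed(4)[OF cV[OF u(1)] v.V_closed(6)[OF XV IH(1)]] by (simp only: ell_pCons)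
  qed
  have eF: "ell F = Y ^ p - Y" using Y_AS by (simp add: \<rho>_to_fract)
  have YS: "Y \<in> h ` C" by (rule Y_in_image)
  have YV: "Y \<in> h ` V"
  proof (rule ccontr)
    assume n: "Y \<notin> h ` V"
    then have i: "inverse Y \<in> v.M" "Y \<noteq> 0" using v.inverse_M[OF YS] v.V_closed(1) by auto
    have p1: "p - 1 \<ge> 1" "p \<ge> 1" using p_gt_1 by auto
    \<comment> \<open>Dividing F(X) = Y^p - Y by Y^p would write 1 as an element of the maximal
      ideal.\<close>
    have "ell F * inverse Y ^ p + inverse Y ^ (p - 1) \<in> v.M"
      using ell[OF F] by (intro v.M_add v.M_mult v.M_power i p1) auto
    moreover have "ell F * inverse Y ^ p + inverse Y ^ (p - 1) = 1"
    proof -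
      have "inverse Y ^ p = inverse Y * inverse Y ^ (p - 1)" using p1 by (simp flip: power_Suc)
      then have "Y * inverse Y ^ p = inverse Y ^ (p - 1)" using i(2) by simp
      moreover have "Y ^ p * inverse Y ^ p = 1" using i(2) by (simp add: power_inverse)
      ultimately show ?thesis by (simp add: eF left_diff_distrib)
    qed
    ultimately show False using v.one_notin_M by simp
  qed
  obtain y0 where y0: "y0 \<in> k" "Y - fls_const y0 \<in> v.M" using v.residue_exists[OF YV] by blast
  have "Y ^ p - fls_const y0 ^ p \<in> v.M" by (rule v.cong_power[OF YV cV[OF y0(1)] y0(2)])
  then have "(Y ^ p - fls_const y0 ^ p) + - (Y - fls_const y0) \<in> v.M" by (intro v.M_add v.M_minus y0)
  moreover have "fls_const (y0 ^ p - y0) = fls_const y0 ^ p - fls_const y0"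
    unfolding fls_const_power[symmetric] by (intro fls_eqI) simp
  then have "ell F - fls_const (y0 ^ p - y0) = (Y ^ p - fls_const y0 ^ p) + - (Y - fls_const y0)"
    unfolding eF by simp
  ultimately have 1: "ell F - fls_const (y0 ^ p - y0) \<in> v.M" by (simp only:)
  have "fls_const (y0 ^ p - y0) = fls_const (poly F x0)"
  proof (rule v.cong_const_unique[OF _ _ 1])
    show "ell F - fls_const (poly F x0) \<in> v.M" using ell[OF F] by blast
    show "fls_const (y0 ^ p - y0) \<in> fls_const ` k" using is_subfieldD(7,9)[OF k] y0(1) by blast
    show "fls_const (poly F x0) \<in> fls_const ` k" using poly_over_poly[OF k F x0(1)] by blast
  qed
  then have "y0 ^ p - y0 = poly F x0" by (metis fls_const_nth)
  then show ?thesis using x0 y0 lies_over_iff[OF V x0(1) y0(1)] by blast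
qed

end

context char_power begin

lemma is_subfield_Fq: "is_subfield (Fq (p ^ M) :: 'a set)"
  unfolding is_subfield_def
  by (intro conjI ballI Fq_closed(1,2)) (simp_all add: Fq_closed(3,5,7,9)[where n = M])

end

section \<open>The point count\<close>

context heisenberg begin

text \<open>The embedding at infinity provides the field property on which the embeddings at affine
  points rely. It also separates the places: \<open>X\<close> is in the ring at every place except
  the one at infinity.\<close>

theorem card_places:
  assumes k: "is_subfield k" and ak: "\<And>i. i \<le> e \<Longrightarrow> a i \<in> k"
    and fin: "finite {(x, y). x \<in> k \<and> y \<in> k \<and> y ^ p - y = x * R x}"
  shows "finite (AS_curve_points p curve_poly k) \<and>
    card (AS_curve_points p curve_poly k) = Suc (card {(x, y). x \<in> k \<and> y \<in> k \<and> y ^ p - y = x * R x})"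
proof -
  define Pts where "Pts = {(x, y). x \<in> k \<and> y \<in> k \<and> y ^ p - y = x * R x}"
  obtain X Y where XY: "fls_point p curve_poly k X Y" "fls_subdegree X = - int p" "fls_subdegree Y = - int (p ^ e + 1)"
    using infinite_point_exists[OF k ak] by blast
  interpret inf: fls_point p curve_poly k X Y by (rule XY(1))
  have cop: "coprime (p ^ e + 1) p"
  proof -
    have "p dvd p ^ e" using e_pos by (simp add: dvd_power)
    then have "coprime p (p ^ e + 1)" by (metis coprime_add_one_right coprime_divisors dvd_refl)
    then show ?thesis by (simp add: coprime_commute)
  qed
  have field: "AS_field p curve_poly k"
    by (rule inf.pole_imp_field[OF XY(2,3) cop]) simp
  interpret fld: AS_field p curve_poly k by (rule field)
  interpret inf: fls_place p curve_poly k X Y by unfold_locales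
  define Pl where "Pl = degree_one_places inf.K (inf.const_K ` k)"
  have Pl_eq: "AS_curve_points p curve_poly k = Pl"
    unfolding AS_curve_points_def Pl_def inf.const_K_def[abs_def] ..
  have Y0: "X \<noteq> 0" using XY(2) p_gt_1 by auto
  have infPl: "inf.place \<in> Pl"
  proof -
    have S: "is_subfield (inf.h ` inf.C)" by (rule inf.is_subfield_image)
    have "inverse X \<in> inf.h ` inf.C" using is_subfieldD(6)[OF S inf.X_in_image] .
    then obtain w where w: "w \<in> inf.C" "inf.h w = inverse X" by force
    then show ?thesis unfolding Pl_def using Y0 XY(2) p_gt_1 by (intro inf.place_is_degree_one[OF w(1)]) auto
  qed
  have X_inf: "X \<notin> inf.h ` inf.place" using XY(2) p_gt_1 by (auto simp: inf.place_def)
  have inf_unique: "V = inf.place" if "V \<in> Pl" "X \<notin> inf.h ` V" for V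
    using inf.infinite_place_unique[OF XY(2,3) cop degree_curve_poly _ that(1)[unfolded Pl_def] that(2)] by simp
  have affine: "\<exists>!V. V \<in> Pl \<and> inf.lies_over V x0 y0" if pt: "(x0, y0) \<in> Pts" for x0 y0
  proof -
    have xy: "x0 \<in> k" "y0 \<in> k" "y0 ^ p - y0 = poly curve_poly x0"
      using pt by (auto simp: Pts_def poly_curve_poly)
    obtain Z where Z: "fls_point p curve_poly k (fls_const x0 + fls_X) Z"
      "Z - fls_const y0 = 0 \<or> fls_subdegree (Z - fls_const y0) > 0"
      using affine_point_exists[OF k inf.F xy] by blast
    \<comment> \<open>Each affine point has its own embedding; the function field and
      \<open>lies_over\<close> are what it shares with the one at infinity.\<close>
    interpret A: fls_point p curve_poly k "fls_const x0 + fls_X" Z by (rule Z(1))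
    interpret A: fls_place p curve_poly k "fls_const x0 + fls_X" Z by unfold_locales
    have S: "is_subfield (A.h ` inf.C)" by (rule A.is_subfield_image)
    have c: "fls_const u \<in> A.h ` inf.C" if "u \<in> k" for u
      using inf.const_K_C[OF that] A.h_const_K by (metis imageI)
    have t: "(fls_const x0 + fls_X) - fls_const x0 = fls_X" by simp
    have tS: "fls_X \<in> A.h ` inf.C" using is_subfieldD(7)[OF S A.X_in_image c[OF xy(1)]] by simp
    have zS: "Z - fls_const y0 \<in> A.h ` inf.C" by (rule is_subfieldD(7)[OF S A.Y_in_image c[OF xy(2)]])
    obtain w where w: "w \<in> inf.C" "A.h w = fls_X" using tS by force
    have pl: "A.place \<in> degree_one_places inf.K (inf.const_K ` k)"
      by (rule A.place_is_degree_one[OF w(1)]) (simp_all add: w(2))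
    interpret v: place_in "A.h ` inf.C" "fls_const ` k" "A.h ` A.place" by (rule A.place_in_image[OF pl])
    have hp: "s \<in> A.h ` A.place \<longleftrightarrow> s \<in> A.h ` inf.C \<and> fls_subdegree s \<ge> 0" for s by (auto simp: A.place_def)
    have Mi: "s \<in> v.M" if "s \<in> A.h ` inf.C" "s = 0 \<or> fls_subdegree s > 0" for s
      using that by (auto simp: v.M_def hp)
    have "inf.lies_over A.place x0 y0"
      unfolding A.lies_over_iff[OF pl xy(1,2)] t using Mi[OF tS] Mi[OF zS Z(2)] by simp
    moreover have "V = A.place" if V: "V \<in> Pl" "inf.lies_over V x0 y0" for V
      using V A.lies_over_iff[of V x0 y0] xy
      by (intro A.affine_place_unique[OF refl Z(2) xy fls_frob_diff pl]) (simp_all add: Pl_def)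
    ultimately show ?thesis using pl unfolding Pl_def by blast
  qed
  \<comment> \<open>Injective because residues determine the point; onto the places other than
    infinity because there \<open>X\<close> has a residue, so \<open>lies_over_exists\<close>
    applies.\<close>
  define \<phi> where "\<phi> pt = (THE V. V \<in> Pl \<and> inf.lies_over V (fst pt) (snd pt))" for pt
  have \<phi>: "\<phi> pt \<in> Pl \<and> inf.lies_over (\<phi> pt) (fst pt) (snd pt)" if "pt \<in> Pts" for pt
    unfolding \<phi>_def by (rule theI') (use affine[of "fst pt" "snd pt"] that in simp)
  have Pts_k: "fst pt \<in> k" "snd pt \<in> k" if "pt \<in> Pts" for pt using that by (auto simp: Pts_def)
  have bij: "bij_betw \<phi> Pts (Pl - {inf.place})"
    unfolding bij_betw_def
  proof (intro conjI inj_onI equalityI subsetI)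
    fix s t assume st: "s \<in> Pts" "t \<in> Pts" "\<phi> s = \<phi> t"
    have "inf.lies_over (\<phi> s) (fst t) (snd t)" using \<phi>[OF st(2)] st(3) by simp
    then show "s = t"
      using inf.lies_over_unique[of "\<phi> s" "fst s" "snd s" "fst t" "snd t"] \<phi>[OF st(1)] Pts_k[OF st(1)] Pts_k[OF st(2)]
      by (simp add: Pl_def prod_eq_iff)
  next
    fix V assume "V \<in> \<phi> ` Pts"
    then obtain pt where pt: "pt \<in> Pts" "V = \<phi> pt" by blast
    then have "X \<in> inf.h ` V"
      using inf.lies_over_imp_X[of V "fst pt" "snd pt"] \<phi>[OF pt(1)] Pts_k[OF pt(1)] by (simp add: Pl_def)
    then show "V \<in> Pl - {inf.place}" using \<phi>[OF pt(1)] pt(2) X_inf by auto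
  next
    fix V assume V: "V \<in> Pl - {inf.place}"
    then have "X \<in> inf.h ` V" using inf_unique by blast
    then obtain x0 y0 where xy: "x0 \<in> k" "y0 \<in> k" "y0 ^ p - y0 = poly curve_poly x0" "inf.lies_over V x0 y0"
      using inf.lies_over_exists[of V] V unfolding Pl_def by blast
    then have pt: "(x0, y0) \<in> Pts" by (simp add: Pts_def poly_curve_poly)
    then have "\<phi> (x0, y0) = V"
      using affine[OF pt] \<phi>[OF pt] V xy(4) by auto
    then show "V \<in> \<phi> ` Pts" using pt by blast
  qed
  have finP: "finite Pl"
    using bij_betw_finite[OF bij] fin unfolding Pts_def[symmetric] by (simp only: finite_Diff2 finite.intros)
  have "card Pl = Suc (card (Pl - {inf.place}))" by (rule card.remove[OF finP infPl])
  also have "card (Pl - {inf.place}) = card Pts" by (rule bij_betw_same_card[OF bij, symmetric])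
  finally show ?thesis unfolding Pl_eq Pts_def[symmetric] using finP by blast
qed

text \<open>There are \<open>p\<close> affine points over each zero of the trace, and the place at
  infinity adds 1. The minimal case is stated additively to avoid subtraction of naturals.\<close>

theorem card_C_R_points:
  assumes odd: "odd p" and m: "m \<ge> 1" and aF: "\<And>i. i \<le> e \<Longrightarrow> a i \<in> Fq (p ^ m)"
    and maxA: "maximal_abelian_subgroup H A" and AF: "A \<subseteq> Fq (p ^ m) \<times> Fq (p ^ m)"
    and star: "condition_star p m e a A" and j: "j \<ge> 1"
  defines "r \<equiv> p ^ (m * j)"
  shows "finite (C_R_points p e a (r\<^sup>2)) \<and>
    (r mod 4 = 1 \<longrightarrow> card (C_R_points p e a (r\<^sup>2)) + r * (p - 1) * p ^ e = r\<^sup>2 + 1) \<and>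
    (r mod 4 = 3 \<longrightarrow> card (C_R_points p e a (r\<^sup>2)) = r\<^sup>2 + 1 + r * (p - 1) * p ^ e)"
proof -
  have r2: "r\<^sup>2 = p ^ (m * j * 2)" by (simp add: r_def power_mult)
  have M: "m * j * 2 \<ge> 1" using m j by simp
  define k where "k = (Fq (r\<^sup>2) :: 'a set)"
  have k: "is_subfield k" unfolding k_def r2 by (rule is_subfield_Fq)
  have ak: "a i \<in> k" if "i \<le> e" for i
    using subsetD[OF Fq_mono[of m "j * 2"] aF[OF that]] by (simp add: k_def r2 mult.assoc)
  have gk: "x * R x \<in> Fq (p ^ (m * j * 2))" if "x \<in> Fq (p ^ (m * j * 2))" for x
    using that ak unfolding R_def k_def r2 by (intro Fq_closed(5) lin_in_Fq)
  note pts = card_AS_points[of "m * j * 2" "\<lambda>x. x * R x", OF M gk, folded r2 k_def]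
  note pl = card_places[OF k ak pts(2)]
  have C: "C_R_points p e a (r\<^sup>2) = AS_curve_points p curve_poly k"
    by (simp add: C_R_points_def curve_poly_def k_def)
  show ?thesis
    using card_trace_zeros[OF odd m aF maxA AF star j, folded r_def] pl pts(1)
    by (simp add: C k_def)
qed

end

theorem theorem4p10:
  fixes p0 p q s m e :: nat
    and a :: "nat \<Rightarrow> 'a::alg_closed_field"
    and A :: "('a \<times> 'a) set"
  assumes "prime p0" and "odd p0"
    and "is_alg_closure_of_Fp p0 TYPE('a)"
    and "s \<ge> 1" and "p = p0 ^ s"
    and "m \<ge> 1" and "q = p ^ m"
    and "e \<ge> 1"
    and "\<forall>i\<le>e. a i \<in> Fq q" and "a e \<noteq> 0"
    and "maximal_abelian_subgroup (H_R p e a) A"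
    and "A \<subseteq> Fq q \<times> Fq q"
    and "condition_star p m e a A"
  shows "C_R_minimal p e a (q ^ 4)
       \<and> (q mod 4 = 1 \<longrightarrow> C_R_minimal p e a (q ^ 2))
       \<and> (q mod 4 = 3 \<longrightarrow> C_R_maximal p e a (q ^ 2))"
  proof -
  have char: "CHAR('a) = p0" using assms(3) by (simp add: is_alg_closure_of_Fp_def)
  interpret heisenberg "TYPE('a)" p0 s p e a
    by unfold_locales (use assms char in auto)
  have odd: "odd p" using assms(2,5) by simp
  have aF: "\<And>i. i \<le> e \<Longrightarrow> a i \<in> Fq (p ^ m)" using assms(7,9) by simp
  note count = card_C_R_points[OF odd assms(6) aF assms(11) assms(12)[unfolded assms(7)] assms(13)]
  \<comment> \<open>For Q = r^2 the Hasse-Weil term 2 g sqrt(Q) is the integer r (p - 1)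
    p^e.\<close>
  have genus: "2 * C_R_genus p e * sqrt (real (r\<^sup>2)) = real (r * (p - 1) * p ^ e)" for r
    by (simp add: C_R_genus_def real_sqrt_abs)
  have minimal: "C_R_minimal p e a (r\<^sup>2)"
    if "finite (C_R_points p e a (r\<^sup>2))" "card (C_R_points p e a (r\<^sup>2)) + r * (p - 1) * p ^ e = r\<^sup>2 + 1" for r
  proof -
    have "real (card (C_R_points p e a (r\<^sup>2))) + real (r * (p - 1) * p ^ e) = real (r\<^sup>2) + 1"
      using arg_cong[OF that(2), of real] by (simp only: of_nat_add of_nat_1)
    then show ?thesis using that(1) unfolding C_R_minimal_def genus by linarith
  qed
  have maximal: "C_R_maximal p e a (r\<^sup>2)"
    if "finite (C_R_points p e a (r\<^sup>2))" "card (C_R_points p e a (r\<^sup>2)) = r\<^sup>2 + 1 + r * (p - 1) * p ^ e" for r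
  proof -
    have "real (card (C_R_points p e a (r\<^sup>2))) = real (r\<^sup>2) + 1 + real (r * (p - 1) * p ^ e)"
      using arg_cong[OF that(2), of real] by (simp only: of_nat_add of_nat_1)
    then show ?thesis using that(1) unfolding C_R_maximal_def genus by linarith
  qed
  have q1: "p ^ (m * 1) = q" and q2: "p ^ (m * 2) = q\<^sup>2" by (simp_all add: assms(7) power_mult)
  have "odd q" using odd by (simp add: assms(7))
  then have "q mod 4 = 1 \<or> q mod 4 = 3" by presburger
  \<comment> \<open>An odd square is 1 mod 4, so r = q^2 always falls into the minimal case, while r
    = q distinguishes the other two claims.\<close>
  then have "q\<^sup>2 mod 4 = 1" by (auto simp: power2_eq_square mod_mult_eq[of q 4 q, symmetric])
  then have "C_R_minimal p e a ((q\<^sup>2)\<^sup>2)"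
    using count[of 2, unfolded q2] by (intro minimal) auto
  then have "C_R_minimal p e a (q ^ 4)" by (simp flip: power_mult)
  moreover have "q mod 4 = 1 \<longrightarrow> C_R_minimal p e a (q ^ 2)"
    using count[of 1, unfolded q1] minimal by auto
  moreover have "q mod 4 = 3 \<longrightarrow> C_R_maximal p e a (q ^ 2)"
    using count[of 1, unfolded q1] maximal by auto
  ultimately show ?thesis by blast
qed

end
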